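(* The analogue for infinite graphs of the statement that $K_1$ is the torsion free part of $K_0$ (which holds for finite graphs) is not true: there exists an infinite, locally finite, connected bi-directed graph $E$ such that $K_1(\mathcal{O}_E)$ is not isomorphic to the torsion free part $K_0(\mathcal{O}_E)/\mathrm{Tors}(K_0(\mathcal{O}_E))$ of $K_0(\mathcal{O}_E)$.
   Context: A bi-directed graph $E=(E^0,E^1,s,r)$ is obtained from a non-directed graph (loops and multiple edges allowed) by replacing each non-oriented edge with two distinct edges $e,\overline e\in E^1$ of opposite orientations (source $s(\overline e)=r(e)$, range $r(\overline e)=s(e)$, $\overline{\overline e}=e$). Locally finite means that every vertex is incident to only finitely many edges; connectedness is that of the underlying non-directed graph. The Bass-Hashimoto operator is $\Phi_E:\mathbb{Z}^{(E^1)}\to\mathbb{Z}^{(E^1)}$, $e\mapsto -\overline e+\sum_{e':\,r(e)=s(e')}e'$ (direct sum of copies of $\mathbb{Z}$ indexed by $E^1$). Its matrix $A_E$ has $(A_E)_{e,e'}=1$ if $r(e)=s(e')$ and $e'\neq\overline e$, and $0$ otherwise. $\mathcal{O}_E$ is the universal $C^*$-algebra generated by partial isometries $\{S_i:i\in E^1\}$ with mutually orthogonal range projections $S_iS_i^*$ and satisfying $S_i^*S_i=\sum_{j\in E^1}(A_E)_{ij}S_jS_j^*$. $\mathrm{Tors}(A)$ denotes the torsion subgroup of an abelian group $A$. *)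

theory Defs
  imports
    Complex_Main
    "HOL-Library.Poly_Mapping"
    "HOL-Algebra.Coset"
    "HOL-Algebra.Module"
    "Graph_Theory.Graph_Theory"
    "Jordan_Normal_Form.Matrix"
begin

section \<open>Normed *-algebras\<close>

text \<open>
  The carrier-based data of a complex normed *-algebra. The field \<open>one\<close> is meaningful only
  for unital algebras.
\<close>

record 'a star_alg = "(complex, 'a) module" +
  star :: "'a \<Rightarrow> 'a"
  cnorm :: "'a \<Rightarrow> real"

definition complex_alg :: "complex star_alg" where
  "complex_alg = \<lparr>carrier = UNIV, monoid.mult = (*), one = 1, zero = 0, add = (+),
     smult = (*), star = cnj, cnorm = cmod\<rparr>"

text \<open>
  The unitization of \<open>A\<close> is \<open>A \<times> \<complex>\<close>, whether or not \<open>A\<close> has a unit. The supremum is the norm of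
  left multiplication by \<open>a + \<lambda>1\<close> on \<open>A\<close>; for unital \<open>A\<close> this alone is only a seminorm,
  and the maximum with \<open>\<bar>\<lambda>\<bar>\<close> is the C*-norm in every case (for non-unital \<open>A\<close> the supremum
  dominates \<open>\<bar>\<lambda>\<bar>\<close>).
\<close>

definition unitization :: "'a star_alg \<Rightarrow> ('a \<times> complex) star_alg" where
  "unitization A =
     \<lparr>carrier = carrier A \<times> UNIV,
      monoid.mult = (\<lambda>(a, l) (b, m). (a \<otimes>\<^bsub>A\<^esub> b \<oplus>\<^bsub>A\<^esub> l \<odot>\<^bsub>A\<^esub> b \<oplus>\<^bsub>A\<^esub> m \<odot>\<^bsub>A\<^esub> a, l * m)),
      one = (\<zero>\<^bsub>A\<^esub>, 1),
      zero = (\<zero>\<^bsub>A\<^esub>, 0),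
      add = (\<lambda>(a, l) (b, m). (a \<oplus>\<^bsub>A\<^esub> b, l + m)),
      smult = (\<lambda>c (a, l). (c \<odot>\<^bsub>A\<^esub> a, c * l)),
      star = (\<lambda>(a, l). (star A a, cnj l)),
      cnorm = (\<lambda>(a, l). max (SUP b\<in>{b \<in> carrier A. cnorm A b \<le> 1}.
                                cnorm A (a \<otimes>\<^bsub>A\<^esub> b \<oplus>\<^bsub>A\<^esub> l \<odot>\<^bsub>A\<^esub> b)) (cmod l))\<rparr>"


section \<open>Universal C*-algebras given by generators and relations\<close>

text \<open>
  Words in the letters \<open>x\<close>, encoded as \<open>(x, False)\<close>, and \<open>x\<^sup>*\<close>, encoded as \<open>(x, True)\<close>.
  With concatenation as addition, finitely supported functions on words carry the convolution
  product of the free *-algebra.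
\<close>

datatype 'g star_word = Word (letters: "('g \<times> bool) list")

instantiation star_word :: (type) monoid_add
begin

definition zero_star_word :: "'a star_word" where
  "0 = Word []"

definition plus_star_word :: "'a star_word \<Rightarrow> 'a star_word \<Rightarrow> 'a star_word" where
  "v + w = Word (letters v @ letters w)"

instance
  by standard (simp_all add: zero_star_word_def plus_star_word_def)

end

type_synonym 'g star_poly = "'g star_word \<Rightarrow>\<^sub>0 complex"

definition word_star :: "'g star_word \<Rightarrow> 'g star_word" where
  "word_star w = Word (rev (map (\<lambda>(x, b). (x, \<not> b)) (letters w)))"

definition poly_star :: "'g star_poly \<Rightarrow> 'g star_poly" where
  "poly_star f = (\<Sum>w\<in>Poly_Mapping.keys f.
     Poly_Mapping.single (word_star w) (cnj (Poly_Mapping.lookup f w)))"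

definition poly_scale :: "complex \<Rightarrow> 'g star_poly \<Rightarrow> 'g star_poly" where
  "poly_scale c f = Poly_Mapping.map ((*) c) f"

definition gen :: "'g \<Rightarrow> 'g star_poly" where
  "gen x = Poly_Mapping.single (Word [(x, False)]) 1"

text \<open>
  The free non-unital *-algebra on \<open>G\<close>. The empty word is excluded, since the algebras
  considered here need not have a unit.
\<close>

definition free_star_alg :: "'g set \<Rightarrow> 'g star_poly set" where
  "free_star_alg G =
     {f. \<forall>w\<in>Poly_Mapping.keys f. letters w \<noteq> [] \<and> fst ` set (letters w) \<subseteq> G}"

definition cstar_seminorm_on :: "'g star_poly set \<Rightarrow> ('g star_poly \<Rightarrow> real) \<Rightarrow> bool" where
  "cstar_seminorm_on F p \<longleftrightarrow>
     (\<forall>f\<in>F. 0 \<le> p f) \<and>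
     (\<forall>f\<in>F. \<forall>g\<in>F. p (f + g) \<le> p f + p g) \<and>
     (\<forall>c. \<forall>f\<in>F. p (poly_scale c f) = cmod c * p f) \<and>
     (\<forall>f\<in>F. \<forall>g\<in>F. p (f * g) \<le> p f * p g) \<and>
     (\<forall>f\<in>F. p (poly_star f * f) = (p f)\<^sup>2)"

text \<open>
  C*-seminorms on the free *-algebra that vanish on the relators \<open>R\<close> are exactly the
  functions \<open>f \<mapsto> \<parallel>\<rho>(f)\<parallel>\<close> for *-homomorphisms \<open>\<rho>\<close> into C*-algebras in which
  the images of the generators satisfy the relations \<open>r = 0\<close>, \<open>r \<in> R\<close>. So
  the following is the supremum of \<open>\<parallel>\<rho>(f)\<parallel>\<close> over all representations of the relations, formed
  without quantifying over the types that carry the target algebras. It is the universal norm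
  whenever that supremum is finite, as is the case for relations that force the generators to be
  partial isometries.
\<close>

definition universal_norm :: "'g set \<Rightarrow> 'g star_poly set \<Rightarrow> 'g star_poly \<Rightarrow> real" where
  "universal_norm G R f =
     (SUP p\<in>{p. cstar_seminorm_on (free_star_alg G) p \<and> (\<forall>r\<in>R. p r = 0)}. p f)"

text \<open>
  The universal C*-algebra is the Hausdorff completion of the free *-algebra in the universal
  norm: Cauchy sequences modulo null sequences.
\<close>

definition cauchy_seqs :: "'g set \<Rightarrow> 'g star_poly set \<Rightarrow> (nat \<Rightarrow> 'g star_poly) set" where
  "cauchy_seqs G R =
     {X. (\<forall>n. X n \<in> free_star_alg G) \<and>
         (\<forall>e>0. \<exists>N. \<forall>m\<ge>N. \<forall>n\<ge>N. universal_norm G R (X m - X n) < e)}"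

definition null_rel ::
    "'g set \<Rightarrow> 'g star_poly set \<Rightarrow> ((nat \<Rightarrow> 'g star_poly) \<times> (nat \<Rightarrow> 'g star_poly)) set" where
  "null_rel G R =
     {(X, Y). X \<in> cauchy_seqs G R \<and> Y \<in> cauchy_seqs G R \<and>
              (\<lambda>n. universal_norm G R (X n - Y n)) \<longlonglongrightarrow> 0}"

definition universal_cstar ::
    "'g set \<Rightarrow> 'g star_poly set \<Rightarrow> (nat \<Rightarrow> 'g star_poly) set star_alg" where
  "universal_cstar G R = (let cls = (\<lambda>X. null_rel G R `` {X}) in
     \<lparr>carrier = cauchy_seqs G R // null_rel G R,
      monoid.mult = (\<lambda>a b. \<Union>X\<in>a. \<Union>Y\<in>b. cls (\<lambda>n. X n * Y n)),
      one = undefined,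
      zero = cls (\<lambda>n. 0),
      add = (\<lambda>a b. \<Union>X\<in>a. \<Union>Y\<in>b. cls (\<lambda>n. X n + Y n)),
      smult = (\<lambda>c a. \<Union>X\<in>a. cls (\<lambda>n. poly_scale c (X n))),
      star = (\<lambda>a. \<Union>X\<in>a. cls (\<lambda>n. poly_star (X n))),
      cnorm = (\<lambda>a. lim (\<lambda>n. universal_norm G R ((SOME X. X \<in> a) n)))\<rparr>)"


section \<open>The C*-algebra of a bi-directed graph\<close>

definition locally_finite :: "('v, 'e) pre_digraph \<Rightarrow> bool" where
  "locally_finite E \<longleftrightarrow> (\<forall>v\<in>verts E. finite (in_arcs E v \<union> out_arcs E v))"

definition edge_matrix :: "('v, 'e) pre_digraph \<Rightarrow> ('e \<Rightarrow> 'e) \<Rightarrow> 'e \<Rightarrow> 'e \<Rightarrow> complex" where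
  "edge_matrix E arev e f = (if head E e = tail E f \<and> f \<noteq> arev e then 1 else 0)"

text \<open>
  The sum in the last family of relators runs over the support of a row of the matrix, which is
  finite for locally finite graphs; \<open>sum\<close> over the full, possibly infinite, set of
  arcs would be \<open>0\<close> by convention.
\<close>

definition graph_relators ::
    "('v, 'e) pre_digraph \<Rightarrow> ('e \<Rightarrow> 'e) \<Rightarrow> 'e star_poly set" where
  "graph_relators E arev = (let S = gen; S' = (\<lambda>e. poly_star (gen e)) in
     {S e * S' e * S e - S e | e. e \<in> arcs E} \<union>
     {(S e * S' e) * (S f * S' f) | e f. e \<in> arcs E \<and> f \<in> arcs E \<and> e \<noteq> f} \<union>
     {S' e * S e - (\<Sum>f\<in>{f \<in> arcs E. edge_matrix E arev e f \<noteq> 0}.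
                      poly_scale (edge_matrix E arev e f) (S f * S' f)) | e. e \<in> arcs E})"

definition graph_cstar ::
    "('v, 'e) pre_digraph \<Rightarrow> ('e \<Rightarrow> 'e) \<Rightarrow> (nat \<Rightarrow> 'e star_poly) set star_alg" where
  "graph_cstar E arev = universal_cstar (arcs E) (graph_relators E arev)"


section \<open>Matrices over a *-algebra\<close>

definition mats :: "'a star_alg \<Rightarrow> nat \<Rightarrow> nat \<Rightarrow> 'a mat set" where
  "mats A m n = {M \<in> carrier_mat m n. elements_mat M \<subseteq> carrier A}"

definition mat_mult :: "'a star_alg \<Rightarrow> 'a mat \<Rightarrow> 'a mat \<Rightarrow> 'a mat" where
  "mat_mult A M N = mat (dim_row M) (dim_col N)
     (\<lambda>(i, j). \<Oplus>\<^bsub>A\<^esub>k\<in>{..<dim_col M}. M $$ (i, k) \<otimes>\<^bsub>A\<^esub> N $$ (k, j))"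

definition mat_star :: "'a star_alg \<Rightarrow> 'a mat \<Rightarrow> 'a mat" where
  "mat_star A M = mat (dim_col M) (dim_row M) (\<lambda>(i, j). star A (M $$ (j, i)))"

definition mat_zero :: "'a star_alg \<Rightarrow> nat \<Rightarrow> nat \<Rightarrow> 'a mat" where
  "mat_zero A m n = mat m n (\<lambda>_. \<zero>\<^bsub>A\<^esub>)"

definition mat_one :: "'a star_alg \<Rightarrow> nat \<Rightarrow> 'a mat" where
  "mat_one A n = mat n n (\<lambda>(i, j). if i = j then \<one>\<^bsub>A\<^esub> else \<zero>\<^bsub>A\<^esub>)"

definition mat_dsum :: "'a star_alg \<Rightarrow> 'a mat \<Rightarrow> 'a mat \<Rightarrow> 'a mat" where
  "mat_dsum A M N = four_block_mat
     M (mat_zero A (dim_row M) (dim_col N))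
     (mat_zero A (dim_row N) (dim_col M)) N"


section \<open>The group \<open>K\<^sub>0\<close>\<close>

definition projections :: "'a star_alg \<Rightarrow> 'a mat set" where
  "projections A = (\<Union>n. {p \<in> mats A n n. mat_mult A p p = p \<and> mat_star A p = p})"

text \<open>Murray--von Neumann equivalence of projections in matrix algebras of possibly different sizes.\<close>

definition mvn_rel :: "'a star_alg \<Rightarrow> ('a mat \<times> 'a mat) set" where
  "mvn_rel A = {(p, q). p \<in> projections A \<and> q \<in> projections A \<and>
     (\<exists>v\<in>mats A (dim_row q) (dim_row p).
        p = mat_mult A (mat_star A v) v \<and> q = mat_mult A v (mat_star A v))}"

definition V_monoid :: "'a star_alg \<Rightarrow> 'a mat set monoid" where
  "V_monoid A =
     \<lparr>carrier = projections A // mvn_rel A,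
      monoid.mult = (\<lambda>P Q. \<Union>p\<in>P. \<Union>q\<in>Q. mvn_rel A `` {mat_dsum A p q}),
      one = mvn_rel A `` {mat_zero A 0 0}\<rparr>"

definition grothendieck_rel :: "'a monoid \<Rightarrow> (('a \<times> 'a) \<times> ('a \<times> 'a)) set" where
  "grothendieck_rel M =
     {((a, b), (c, d)). a \<in> carrier M \<and> b \<in> carrier M \<and> c \<in> carrier M \<and> d \<in> carrier M \<and>
        (\<exists>e\<in>carrier M. a \<otimes>\<^bsub>M\<^esub> d \<otimes>\<^bsub>M\<^esub> e = c \<otimes>\<^bsub>M\<^esub> b \<otimes>\<^bsub>M\<^esub> e)}"

definition grothendieck_group :: "'a monoid \<Rightarrow> ('a \<times> 'a) set monoid" where
  "grothendieck_group M =
     \<lparr>carrier = (carrier M \<times> carrier M) // grothendieck_rel M,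
      monoid.mult = (\<lambda>X Y. \<Union>(a, b)\<in>X. \<Union>(c, d)\<in>Y.
                      grothendieck_rel M `` {(a \<otimes>\<^bsub>M\<^esub> c, b \<otimes>\<^bsub>M\<^esub> d)}),
      one = grothendieck_rel M `` {(\<one>\<^bsub>M\<^esub>, \<one>\<^bsub>M\<^esub>)}\<rparr>"

definition K00 :: "'a star_alg \<Rightarrow> ('a mat set \<times> 'a mat set) set monoid" where
  "K00 A = grothendieck_group (V_monoid A)"

text \<open>The homomorphism \<open>K00 A \<rightarrow> K00 B\<close> induced by a *-homomorphism \<open>h : A \<rightarrow> B\<close>.\<close>

definition K00_map ::
    "'b star_alg \<Rightarrow> ('a \<Rightarrow> 'b) \<Rightarrow> ('a mat set \<times> 'a mat set) set
       \<Rightarrow> ('b mat set \<times> 'b mat set) set" where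
  "K00_map B h Z = (let V_map = (\<lambda>P. \<Union>p\<in>P. mvn_rel B `` {map_mat h p}) in
     \<Union>(P, Q)\<in>Z. grothendieck_rel (V_monoid B) `` {(V_map P, V_map Q)})"

text \<open>
  \<open>K\<^sub>0(A)\<close> is the kernel of the map induced by the quotient map \<open>snd\<close> from the
  unitization to the complex numbers.
\<close>

definition K0 ::
    "'a star_alg \<Rightarrow> (('a \<times> complex) mat set \<times> ('a \<times> complex) mat set) set monoid" where
  "K0 A = (K00 (unitization A))
     \<lparr>carrier := kernel (K00 (unitization A)) (K00 complex_alg) (K00_map complex_alg snd)\<rparr>"


section \<open>The group \<open>K\<^sub>1\<close>\<close>

definition unitaries :: "'a star_alg \<Rightarrow> nat \<Rightarrow> 'a mat set" where
  "unitaries A n = {u \<in> mats A n n.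
     mat_mult A (mat_star A u) u = mat_one A n \<and> mat_mult A u (mat_star A u) = mat_one A n}"

text \<open>
  Homotopy in the unitary group of the \<open>n \<times> n\<close> matrices. The C*-norm on matrices is equivalent
  to the maximum of the norms of the entries, so norm continuity of a path is entrywise
  continuity.
\<close>

definition unitary_homotopic :: "'a star_alg \<Rightarrow> nat \<Rightarrow> 'a mat \<Rightarrow> 'a mat \<Rightarrow> bool" where
  "unitary_homotopic A n u v \<longleftrightarrow>
     (\<exists>\<gamma> :: real \<Rightarrow> 'a mat. \<gamma> 0 = u \<and> \<gamma> 1 = v \<and> (\<forall>t\<in>{0..1}. \<gamma> t \<in> unitaries A n) \<and>
        (\<forall>i<n. \<forall>j<n. \<forall>t\<in>{0..1}.
           ((\<lambda>s. cnorm A (\<gamma> s $$ (i, j) \<ominus>\<^bsub>A\<^esub> \<gamma> t $$ (i, j))) \<longlongrightarrow> 0) (at t within {0..1})))"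

definition K1_rel :: "'a star_alg \<Rightarrow> ('a mat \<times> 'a mat) set" where
  "K1_rel A = {(u, v). \<exists>m n. u \<in> unitaries A m \<and> v \<in> unitaries A n \<and>
     (\<exists>k\<ge>max m n. unitary_homotopic A k
        (mat_dsum A u (mat_one A (k - m))) (mat_dsum A v (mat_one A (k - n))))}"

definition K1 :: "'a star_alg \<Rightarrow> ('a \<times> complex) mat set monoid" where
  "K1 A = (let B = unitization A in
     \<lparr>carrier = (\<Union>n. unitaries B n) // K1_rel B,
      monoid.mult = (\<lambda>P Q. \<Union>u\<in>P. \<Union>v\<in>Q. K1_rel B `` {mat_dsum B u v}),
      one = K1_rel B `` {mat_one B 0}\<rparr>)"


section \<open>Torsion\<close>

definition torsion_subgroup :: "('a, 'b) monoid_scheme \<Rightarrow> 'a set" where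
  "torsion_subgroup G = {x \<in> carrier G. \<exists>n::nat. n > 0 \<and> x [^]\<^bsub>G\<^esub> n = \<one>\<^bsub>G\<^esub>}"

end

theory Submission
imports
  Defs
  "HOL-Analysis.Bounded_Linear_Function"
  "HOL-Analysis.Infinite_Sum"
  "HOL-Analysis.Lipschitz"
  "HOL-Computational_Algebra.Polynomial"
begin

text \<open>
The graph is the ray: the vertices are the natural numbers, and \<open>n\<close> is joined to \<open>n + 1\<close> by an edge
\<open>e\<^sub>n\<close> away from \<open>0\<close> and its reverse \<open>f\<^sub>n\<close>. A path that does not turn back has to stop when it
arrives at the vertex \<open>0\<close>, so the row of \<open>f\<^sub>0\<close> in the edge matrix is zero and \<open>S f\<^sub>0 = 0\<close>; the relation
\<open>(S f\<^sub>n\<^sub>+\<^sub>1)\<^sup>* S f\<^sub>n\<^sub>+\<^sub>1 = S f\<^sub>n (S f\<^sub>n)\<^sup>*\<close> then kills all the other \<open>S f\<^sub>n\<close>. The remaining generators satisfy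
\<open>(S e\<^sub>n)\<^sup>* S e\<^sub>n = S e\<^sub>n\<^sub>+\<^sub>1 (S e\<^sub>n\<^sub>+\<^sub>1)\<^sup>*\<close>, as the matrix units \<open>E\<^sub>n\<^sub>,\<^sub>n\<^sub>+\<^sub>1\<close> do, and the algebra of the graph is
the algebra \<open>K\<close> of compact operators on \<open>\<ell>\<^sup>2\<close>. So \<open>K\<^sub>1\<close> is trivial while \<open>K\<^sub>0\<close> is infinite cyclic.
An isomorphism is in particular a bijection; hence it is enough that \<open>K\<^sub>1\<close> has one element
(\<open>K1_trivial\<close>) and that the class of \<open>E\<^sub>0\<^sub>0\<close> in \<open>K\<^sub>0\<close> is not a torsion element (\<open>K0_mod_torsion_nontrivial\<close>).

The algebra is identified through its universal norm. Modulo the relations, each element of the free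
*-algebra is a linear combination of the \<open>N\<^sup>2\<close> matrix units of a corner, for some \<open>N\<close>. If \<open>p\<close> is a
C*-seminorm that respects the relations and \<open>h = f\<^sup>* f\<close>, then \<open>p h\<close> to the power \<open>2\<^sup>k\<close> is \<open>p\<close> of that power of
\<open>h\<close>, and this is at most \<open>N\<^sup>2\<close> times the same power of the operator norm of \<open>h\<close>. Letting \<open>k\<close> grow shows
that the operator norm is the largest such seminorm (\<open>universal_norm_ray\<close>). The completion thus consists
of the limits of finite matrices in operator norm.

Matrices over the unitization of \<open>K\<close> act on \<open>\<ell>\<^sup>2\<close> as well: with isometries \<open>V\<^sub>i\<close> whose ranges are
mutually orthogonal, \<open>x\<close> becomes \<open>\<Sum> V\<^sub>i x\<^sub>i\<^sub>j V\<^sub>j\<^sup>*\<close>. These operators lie in an AF algebra: a norm closed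
*-algebra in which every element is approximated by elements of finite-dimensional *-subalgebras.
Two properties of AF algebras carry both computations.

\<^item> Every isometry is unitary (\<open>AF_isometry_unitary\<close>), since an element of a finite-dimensional algebra
  that is left invertible is right invertible, and invertibility is an open condition.
  If \<open>n [E\<^sub>0\<^sub>0] = 0\<close> with \<open>n > 0\<close>, then \<open>E\<^sub>0\<^sub>0 \<oplus> p \<oplus> f\<close> is equivalent to \<open>f\<close> for some projections \<open>p\<close> and
  \<open>f\<close>, and a partial isometry that realizes this would extend to an isometry that is not unitary.

\<^item> Any two unitaries are joined by a path of unitaries (\<open>AF_unitaries_path_connected\<close>). A unitary
  \<open>u\<close> is close to a unitary \<open>w\<close> of a finite-dimensional *-subalgebra, which comes from Newton's
  iteration for the polar part. Both \<open>u w\<^sup>*\<close> and some multiple of \<open>w\<close> by a scalar of modulus \<open>1\<close> avoid the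
  spectral value \<open>-1\<close>, and unitaries with that property contract to \<open>1\<close> along the Cayley transform.
\<close>

section \<open>The Hilbert space of square-summable sequences\<close>

no_notation scalar_prod (infix "\<bullet>" 70)

text \<open>
  Complex sequences with the real part of the usual inner product: real Hilbert space theory
  then applies, and adjoints with respect to the real and to the complex inner product are the same
  for complex linear operators.
\<close>

typedef ell2 = "{x :: nat \<Rightarrow> complex. (\<lambda>i. (norm (x i))\<^sup>2) summable_on UNIV}"
  morphisms coords Abs_ell2
  by (rule exI[of _ "\<lambda>_. 0"]) simp

setup_lifting type_definition_ell2

lemma coords_summable: "(\<lambda>i. (norm (coords x i))\<^sup>2) summable_on UNIV"
  using coords[of x] by simp

lemma square_summable_bound:
  fixes x y z :: "nat \<Rightarrow> complex"
  assumes "(\<lambda>i. (norm (x i))\<^sup>2) summable_on UNIV" "(\<lambda>i. (norm (y i))\<^sup>2) summable_on UNIV"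
    and "\<And>i. (norm (z i))\<^sup>2 \<le> c * ((norm (x i))\<^sup>2 + (norm (y i))\<^sup>2)"
  shows "(\<lambda>i. (norm (z i))\<^sup>2) summable_on UNIV"
proof (rule summable_on_comparison_test)
  show "(\<lambda>i. c * ((norm (x i))\<^sup>2 + (norm (y i))\<^sup>2)) summable_on UNIV"
    by (intro summable_on_cmult_right summable_on_add assms)
qed (use assms(3) in auto)

lemma norm_add_square_le:
  fixes a b :: "'a::real_normed_vector"
  shows "(norm (a + b))\<^sup>2 \<le> 2 * ((norm a)\<^sup>2 + (norm b)\<^sup>2)"
proof -
  have "(norm (a + b))\<^sup>2 \<le> (norm a + norm b)\<^sup>2"
    by (simp add: norm_triangle_ineq power_mono)
  also have "\<dots> \<le> 2 * ((norm a)\<^sup>2 + (norm b)\<^sup>2)"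
    using sum_squares_bound[of "norm a" "norm b"] by (simp add: power2_sum)
  finally show ?thesis .
qed

instantiation ell2 :: real_vector
begin
lift_definition zero_ell2 :: ell2 is "\<lambda>_. 0" by simp
lift_definition plus_ell2 :: "ell2 \<Rightarrow> ell2 \<Rightarrow> ell2" is "\<lambda>x y i. x i + y i"
  subgoal for x y
    by (rule square_summable_bound[where c = 2 and x=x and y=y])
      (use norm_add_square_le[of "x _" "y _"] in auto)
  done
lift_definition uminus_ell2 :: "ell2 \<Rightarrow> ell2" is "\<lambda>x i. - x i" by simp
lift_definition minus_ell2 :: "ell2 \<Rightarrow> ell2 \<Rightarrow> ell2" is "\<lambda>x y i. x i - y i"
  subgoal for x y
    by (rule square_summable_bound[where c = 2 and x=x and y=y])
      (use norm_add_square_le[of "x _" "- y _"] in auto)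
  done
lift_definition scaleR_ell2 :: "real \<Rightarrow> ell2 \<Rightarrow> ell2" is "\<lambda>c x i. c *\<^sub>R x i"
  by (simp add: power_mult_distrib summable_on_cmult_right)
instance
  by standard (transfer; simp add: algebra_simps)+
end

lemma inner_summable:
  "(\<lambda>i. coords x i \<bullet> coords y i) summable_on UNIV"
proof (rule abs_summable_summable, rule summable_on_comparison_test)
  show "(\<lambda>i. (norm (coords x i))\<^sup>2 + (norm (coords y i))\<^sup>2) summable_on UNIV"
    by (intro summable_on_add coords_summable)
  fix i
  have "\<bar>coords x i \<bullet> coords y i\<bar> \<le> norm (coords x i) * norm (coords y i)"
    by (rule Cauchy_Schwarz_ineq2)
  also have "\<dots> \<le> (norm (coords x i))\<^sup>2 + (norm (coords y i))\<^sup>2"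
    using sum_squares_bound[of "norm (coords x i)" "norm (coords y i)"]
    using mult_nonneg_nonneg[OF norm_ge_zero norm_ge_zero, of "coords x i" "coords y i"] by linarith
  finally show "norm (coords x i \<bullet> coords y i) \<le> (norm (coords x i))\<^sup>2 + (norm (coords y i))\<^sup>2" by simp
qed auto

instantiation ell2 :: real_inner
begin
definition inner_ell2 :: "ell2 \<Rightarrow> ell2 \<Rightarrow> real" where
  "inner_ell2 x y = (\<Sum>\<^sub>\<infinity>i. coords x i \<bullet> coords y i)"
definition norm_ell2 :: "ell2 \<Rightarrow> real" where "norm_ell2 x = sqrt (x \<bullet> x)"
definition dist_ell2 :: "ell2 \<Rightarrow> ell2 \<Rightarrow> real" where "dist_ell2 x y = norm (x - y)"
definition sgn_ell2 :: "ell2 \<Rightarrow> ell2" where "sgn_ell2 x = x /\<^sub>R norm x"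
definition uniformity_ell2 :: "(ell2 \<times> ell2) filter" where
  "uniformity_ell2 = (INF e\<in>{0<..}. principal {(x, y). dist x y < e})"
definition open_ell2 :: "ell2 set \<Rightarrow> bool" where
  "open_ell2 U = (\<forall>x\<in>U. \<forall>\<^sub>F (x', y) in uniformity. x' = x \<longrightarrow> y \<in> U)"
instance
proof
  fix x y z :: ell2 and r :: real
  show "x \<bullet> y = y \<bullet> x" by (simp add: inner_ell2_def inner_commute)
  have "(\<Sum>\<^sub>\<infinity>i. coords x i \<bullet> coords z i + coords y i \<bullet> coords z i) = x \<bullet> z + y \<bullet> z"
    unfolding inner_ell2_def by (rule infsum_add) (rule inner_summable)+
  thus "(x + y) \<bullet> z = x \<bullet> z + y \<bullet> z"
    by (simp add: inner_ell2_def plus_ell2.rep_eq inner_add_left)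
  show "(r *\<^sub>R x) \<bullet> y = r * (x \<bullet> y)"
    by (simp add: inner_ell2_def scaleR_ell2.rep_eq infsum_cmult_right')
  show "0 \<le> x \<bullet> x" unfolding inner_ell2_def by (rule infsum_nonneg) simp
  show "(x \<bullet> x = 0) = (x = 0)"
  proof
    assume "x \<bullet> x = 0"
    hence "coords x i \<bullet> coords x i = 0" for i
      unfolding inner_ell2_def using nonneg_infsum_le_0D[of "\<lambda>i. coords x i \<bullet> coords x i" UNIV i]
      by (simp add: inner_summable)
    thus "x = 0" by (intro coords_inject[THEN iffD1]) (auto simp: zero_ell2.rep_eq)
  qed (simp add: inner_ell2_def zero_ell2.rep_eq)
qed (simp_all add: norm_ell2_def dist_ell2_def sgn_ell2_def uniformity_ell2_def open_ell2_def)
end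

lemma norm_ell2_square: "(norm x)\<^sup>2 = (\<Sum>\<^sub>\<infinity>i. (norm (coords x i))\<^sup>2)"
  by (simp add: power2_norm_eq_inner inner_ell2_def)

lemma finite_sum_coords_le: "finite F \<Longrightarrow> (\<Sum>i\<in>F. (norm (coords x i))\<^sup>2) \<le> (norm x)\<^sup>2"
  unfolding norm_ell2_square by (rule finite_sum_le_infsum) (auto simp: coords_summable)

lemma norm_coord_le: "norm (coords x i) \<le> norm x"
  using finite_sum_coords_le[of "{i}" x] by (auto intro: power2_le_imp_le)

lemma norm_ell2_leI:
  assumes "0 \<le> C" and "\<And>F. finite F \<Longrightarrow> (\<Sum>i\<in>F. (norm (coords x i))\<^sup>2) \<le> C\<^sup>2"
  shows "norm x \<le> C"
proof -
  have "(norm x)\<^sup>2 \<le> C\<^sup>2"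
    unfolding norm_ell2_square by (rule infsum_le_finite_sums[OF coords_summable]) (use assms in auto)
  thus ?thesis using assms(1) by (rule power2_le_imp_le)
qed

instance ell2 :: complete_space
proof
  fix X :: "nat \<Rightarrow> ell2" assume X: "Cauchy X"
  have "Cauchy (\<lambda>n. coords (X n) i)" for i
  proof (rule metric_CauchyI)
    fix e :: real assume "e > 0"
    then obtain M where M: "\<And>m n. m \<ge> M \<Longrightarrow> n \<ge> M \<Longrightarrow> dist (X m) (X n) < e"
      using X unfolding Cauchy_def by blast
    have "dist (coords (X m) i) (coords (X n) i) \<le> dist (X m) (X n)" for m n
      using norm_coord_le[of "X m - X n" i] by (simp add: dist_norm minus_ell2.rep_eq)
    thus "\<exists>M. \<forall>m\<ge>M. \<forall>n\<ge>M. dist (coords (X m) i) (coords (X n) i) < e"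
      using M by (meson le_less_trans)
  qed
  hence "\<forall>i. \<exists>l. (\<lambda>n. coords (X n) i) \<longlonglongrightarrow> l" by (meson Cauchy_convergent convergent_def)
  then obtain l where l: "\<And>i. (\<lambda>n. coords (X n) i) \<longlonglongrightarrow> l i" by metis
  have bound: "(\<Sum>i\<in>F. (norm (coords (X m) i - l i))\<^sup>2) \<le> e\<^sup>2"
    if M: "\<And>m n. m \<ge> M \<Longrightarrow> n \<ge> M \<Longrightarrow> dist (X m) (X n) < e" and "m \<ge> M" "finite F" for M m e F
  proof (rule LIMSEQ_le_const2)
    show "(\<lambda>n. \<Sum>i\<in>F. (norm (coords (X m) i - coords (X n) i))\<^sup>2) \<longlonglongrightarrow> (\<Sum>i\<in>F. (norm (coords (X m) i - l i))\<^sup>2)"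
      by (intro tendsto_intros l)
    have "(\<Sum>i\<in>F. (norm (coords (X m) i - coords (X n) i))\<^sup>2) \<le> e\<^sup>2" if "n \<ge> M" for n
    proof -
      have "(\<Sum>i\<in>F. (norm (coords (X m) i - coords (X n) i))\<^sup>2) \<le> (norm (X m - X n))\<^sup>2"
        using finite_sum_coords_le[OF \<open>finite F\<close>, of "X m - X n"] by (simp add: minus_ell2.rep_eq)
      also have "\<dots> \<le> e\<^sup>2"
        using M[OF \<open>m \<ge> M\<close> that] by (intro power_mono) (auto simp: dist_norm)
      finally show ?thesis .
    qed
    thus "\<exists>N. \<forall>n\<ge>N. (\<Sum>i\<in>F. (norm (coords (X m) i - coords (X n) i))\<^sup>2) \<le> e\<^sup>2" by blast
  qed
  obtain M1 where M1: "\<And>m n. m \<ge> M1 \<Longrightarrow> n \<ge> M1 \<Longrightarrow> dist (X m) (X n) < 1"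
    using X[unfolded Cauchy_def, rule_format, of 1] by auto
  have d: "(\<lambda>i. (norm (coords (X M1) i - l i))\<^sup>2) summable_on UNIV"
    by (rule nonneg_bdd_above_summable_on)
      (use bound[of M1 1, OF M1] in \<open>auto intro!: bdd_aboveI[of _ "1"]\<close>)
  have "(\<lambda>i. (norm (l i))\<^sup>2) summable_on UNIV"
  proof (rule square_summable_bound[OF coords_summable[of "X M1"] d, where c = 2])
    fix i
    show "(norm (l i))\<^sup>2 \<le> 2 * ((norm (coords (X M1) i))\<^sup>2 + (norm (coords (X M1) i - l i))\<^sup>2)"
      using norm_add_square_le[of "coords (X M1) i" "l i - coords (X M1) i"]
      by (simp add: norm_minus_commute)
  qed
  then obtain L where L: "coords L = l" using Abs_ell2_inverse by blast
  have "X \<longlonglongrightarrow> L"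
  proof (rule metric_LIMSEQ_I)
    fix e :: real assume "e > 0"
    then obtain M where M: "\<And>m n. m \<ge> M \<Longrightarrow> n \<ge> M \<Longrightarrow> dist (X m) (X n) < e/2"
      using X[unfolded Cauchy_def, rule_format, OF half_gt_zero[OF \<open>e > 0\<close>]] by blast
    have "dist (X m) L < e" if "m \<ge> M" for m
    proof -
      have "norm (X m - L) \<le> e/2"
        using bound[OF M that] \<open>e > 0\<close> by (intro norm_ell2_leI) (auto simp: minus_ell2.rep_eq L)
      thus ?thesis using \<open>e > 0\<close> by (simp add: dist_norm)
    qed
    thus "\<exists>no. \<forall>n\<ge>no. dist (X n) L < e" by blast
  qed
  thus "convergent X" by (auto simp: convergent_def)
qed

instance ell2 :: banach ..

lift_definition cscale :: "complex \<Rightarrow> ell2 \<Rightarrow> ell2" is "\<lambda>c x i. c * x i"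
  by (simp add: norm_mult power_mult_distrib summable_on_cmult_right)

lemma inner_cscale: "cscale c x \<bullet> y = x \<bullet> cscale (cnj c) y"
  by (simp add: inner_ell2_def cscale.rep_eq inner_complex_def algebra_simps)

lemma norm_cscale: "norm (cscale c x) = norm c * norm x"
proof -
  have "(norm (cscale c x))\<^sup>2 = (norm c * norm x)\<^sup>2"
    by (simp add: norm_ell2_square cscale.rep_eq norm_mult power_mult_distrib infsum_cmult_right')
  thus ?thesis by (simp add: power2_eq_iff_nonneg)
qed

lift_definition basis_vec :: "nat \<Rightarrow> ell2" is "\<lambda>k i. if i = k then 1 else 0"
proof -
  fix k :: nat
  have "(\<lambda>i. (norm (if i = k then 1 else 0 :: complex))\<^sup>2) summable_on {k}" by simp
  thus "(\<lambda>i. (norm (if i = k then 1 else 0 :: complex))\<^sup>2) summable_on UNIV"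
    by (rule summable_on_cong_neutral[THEN iffD1, rotated -1]) auto
qed

lemma ell2_eqI: "(\<And>i. coords x i = coords y i) \<Longrightarrow> x = y"
  by (simp add: coords_inject[symmetric] fun_eq_iff)

lemma norm_basis_vec: "norm (basis_vec k) = 1"
proof -
  have "(\<Sum>\<^sub>\<infinity>i. (norm (if i = k then 1 else 0 :: complex))\<^sup>2) = (\<Sum>\<^sub>\<infinity>i\<in>{k}. 1::real)"
    by (rule infsum_cong_neutral) auto
  hence "(norm (basis_vec k))\<^sup>2 = 1" by (simp add: norm_ell2_square basis_vec.rep_eq)
  thus ?thesis using norm_ge_zero[of "basis_vec k"] by (auto simp: power2_eq_1_iff)
qed

lifting_update ell2.lifting
lifting_forget ell2.lifting

section \<open>Bounded operators\<close>

definition adjoint_pair :: "(ell2 \<Rightarrow>\<^sub>L ell2) \<Rightarrow> (ell2 \<Rightarrow>\<^sub>L ell2) \<Rightarrow> bool" where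
  "adjoint_pair a b \<longleftrightarrow> (\<forall>x y. blinfun_apply a x \<bullet> y = x \<bullet> blinfun_apply b y)"

lemma adjoint_pair_sym: "adjoint_pair a b \<Longrightarrow> adjoint_pair b a"
  unfolding adjoint_pair_def by (metis inner_commute)

lemma adjoint_pair_unique: "adjoint_pair a b \<Longrightarrow> adjoint_pair a c \<Longrightarrow> b = c"
proof (rule blinfun_eqI)
  fix y assume "adjoint_pair a b" "adjoint_pair a c"
  hence "x \<bullet> (blinfun_apply b y - blinfun_apply c y) = 0" for x
    by (auto simp: adjoint_pair_def inner_diff_right)
  from this[of "blinfun_apply b y - blinfun_apply c y"]
  show "blinfun_apply b y = blinfun_apply c y" by simp
qed

lemma adjoint_pair_norm_le:
  assumes "adjoint_pair a b"
  shows "norm b \<le> norm a"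
proof (rule norm_blinfun_bound)
  fix y
  let ?z = "blinfun_apply b y"
  have "(norm ?z)\<^sup>2 = blinfun_apply a ?z \<bullet> y"
    using assms by (simp add: adjoint_pair_def power2_norm_eq_inner)
  also have "\<dots> \<le> norm (blinfun_apply a ?z) * norm y" by (rule norm_cauchy_schwarz)
  also have "\<dots> \<le> (norm a * norm ?z) * norm y" by (intro mult_right_mono norm_blinfun) simp
  finally have "norm ?z * norm ?z \<le> norm ?z * (norm a * norm y)"
    by (simp add: power2_eq_square mult_ac)
  thus "norm ?z \<le> norm a * norm y"
    by (cases "norm ?z = 0") (auto simp: mult_le_cancel_left)
qed simp

lemma adjoint_pair_norm_eq: "adjoint_pair a b \<Longrightarrow> norm b = norm a"
  by (meson adjoint_pair_norm_le adjoint_pair_sym order_antisym)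

definition complex_linear :: "(ell2 \<Rightarrow>\<^sub>L ell2) \<Rightarrow> bool" where
  "complex_linear a \<longleftrightarrow> (\<forall>c x. blinfun_apply a (cscale c x) = cscale c (blinfun_apply a x))"

lemma complex_linear_adjoint:
  assumes "adjoint_pair a b" "complex_linear a"
  shows "complex_linear b"
  unfolding complex_linear_def
proof (intro allI)
  fix c y
  have "x \<bullet> (blinfun_apply b (cscale c y) - cscale c (blinfun_apply b y)) = 0" for x
  proof -
    have "x \<bullet> blinfun_apply b (cscale c y) = cscale (cnj c) (blinfun_apply a x) \<bullet> y"
      using assms(1) unfolding adjoint_pair_def by (metis inner_cscale complex_cnj_cnj)
    also have "\<dots> = x \<bullet> cscale c (blinfun_apply b y)"
      using assms unfolding adjoint_pair_def complex_linear_def by (metis inner_cscale complex_cnj_cnj)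
    finally show ?thesis by (simp add: inner_diff_right)
  qed
  from this[of "blinfun_apply b (cscale c y) - cscale c (blinfun_apply b y)"]
  show "blinfun_apply b (cscale c y) = cscale c (blinfun_apply b y)" by simp
qed

text \<open>
  The complex linear operators with an adjoint. The existence of the adjoint is part of the
  definition, which spares the representation theorem for functionals; these operators are closed
  under norm limits because passing to adjoints is isometric.
\<close>

typedef cop = "{a. (\<exists>b. adjoint_pair a b) \<and> complex_linear a}"
  morphisms blinfun_of_cop Abs_cop
proof (rule exI[of _ 0], safe)
  show "\<exists>b. adjoint_pair 0 b" by (rule exI[of _ 0]) (simp add: adjoint_pair_def)
  show "complex_linear 0" by (auto simp: complex_linear_def cscale.rep_eq zero_ell2.rep_eq intro: ell2_eqI)
qed

setup_lifting type_definition_cop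

lemma cscale_add: "cscale c (x + y) = cscale c x + cscale c y"
  by (rule ell2_eqI) (simp add: cscale.rep_eq plus_ell2.rep_eq algebra_simps)
lemma cscale_minus: "cscale c (- x) = - cscale c x"
  by (rule ell2_eqI) (simp add: cscale.rep_eq uminus_ell2.rep_eq)
lemma cscale_diff: "cscale c (x - y) = cscale c x - cscale c y"
  by (rule ell2_eqI) (simp add: cscale.rep_eq minus_ell2.rep_eq algebra_simps)
lemma cscale_scaleR: "cscale c (r *\<^sub>R x) = r *\<^sub>R cscale c x"
  by (rule ell2_eqI) (simp add: cscale.rep_eq scaleR_ell2.rep_eq)
lemma cscale_zero: "cscale c 0 = 0"
  by (rule ell2_eqI) (simp add: cscale.rep_eq zero_ell2.rep_eq)
lemma cscale_cscale: "cscale c (cscale d x) = cscale (c * d) x"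
  by (rule ell2_eqI) (simp add: cscale.rep_eq)

lemmas cscale_linear = cscale_add cscale_minus cscale_diff cscale_scaleR cscale_zero

lemma bounded_linear_cscale: "bounded_linear (cscale c)"
  by (rule bounded_linear_intro[where K = "norm c"]) (auto simp: cscale_linear norm_cscale)

instantiation cop :: real_vector
begin
lift_definition zero_cop :: cop is 0
  by (auto simp: complex_linear_def cscale_linear adjoint_pair_def intro!: exI[of _ 0])
lift_definition plus_cop :: "cop \<Rightarrow> cop \<Rightarrow> cop" is "(+)"
  by (fastforce simp: complex_linear_def cscale_linear adjoint_pair_def blinfun.bilinear_simps inner_add
      intro: exI[of _ "_ + _"])
lift_definition uminus_cop :: "cop \<Rightarrow> cop" is "uminus"
  by (fastforce simp: complex_linear_def cscale_linear adjoint_pair_def blinfun.bilinear_simps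
      intro: exI[of _ "- _"])
lift_definition minus_cop :: "cop \<Rightarrow> cop \<Rightarrow> cop" is "(-)"
  by (fastforce simp: complex_linear_def cscale_linear adjoint_pair_def blinfun.bilinear_simps inner_diff
      intro: exI[of _ "_ - _"])
lift_definition scaleR_cop :: "real \<Rightarrow> cop \<Rightarrow> cop" is "(*\<^sub>R)"
  by (fastforce simp: complex_linear_def cscale_linear adjoint_pair_def blinfun.bilinear_simps
      intro: exI[of _ "_ *\<^sub>R _"])
instance by standard (transfer; simp add: algebra_simps)+
end

instantiation cop :: real_normed_algebra_1
begin
lift_definition one_cop :: cop is id_blinfun
  by (auto simp: complex_linear_def adjoint_pair_def intro!: exI[of _ id_blinfun])
lift_definition times_cop :: "cop \<Rightarrow> cop \<Rightarrow> cop" is "(o\<^sub>L)"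
  by (fastforce simp: complex_linear_def adjoint_pair_def intro: exI[of _ "_ o\<^sub>L _"])
lift_definition norm_cop :: "cop \<Rightarrow> real" is norm .
definition dist_cop :: "cop \<Rightarrow> cop \<Rightarrow> real" where "dist_cop x y = norm (x - y)"
definition sgn_cop :: "cop \<Rightarrow> cop" where "sgn_cop x = x /\<^sub>R norm x"
definition uniformity_cop :: "(cop \<times> cop) filter" where
  "uniformity_cop = (INF e\<in>{0<..}. principal {(x, y). dist x y < e})"
definition open_cop :: "cop set \<Rightarrow> bool" where
  "open_cop U = (\<forall>x\<in>U. \<forall>\<^sub>F (x', y) in uniformity. x' = x \<longrightarrow> y \<in> U)"
instance
proof
  fix x y z :: cop and r :: real
  show "x * y * z = x * (y * z)" by transfer (rule blinfun_eqI, simp)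
  show "1 * x = x" "x * 1 = x" by (transfer; auto intro!: blinfun_eqI)+
  show "(x + y) * z = x * z + y * z" "x * (y + z) = x * y + x * z"
    by (transfer; auto intro!: blinfun_eqI simp: blinfun.bilinear_simps)+
  show "r *\<^sub>R x * y = r *\<^sub>R (x * y)" "x * r *\<^sub>R y = r *\<^sub>R (x * y)"
    by (transfer; auto intro!: blinfun_eqI simp: blinfun.bilinear_simps)+
  show "norm (x * y) \<le> norm x * norm y" by transfer (rule norm_blinfun_compose)
  show n1: "norm (1::cop) = 1"
  proof transfer
    have "norm (basis_vec 0) \<le> norm (id_blinfun :: ell2 \<Rightarrow>\<^sub>L ell2) * norm (basis_vec 0)"
      using norm_blinfun[of id_blinfun "basis_vec 0"] by simp
    moreover have "norm (id_blinfun :: ell2 \<Rightarrow>\<^sub>L ell2) \<le> 1" by (rule norm_blinfun_bound) auto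
    ultimately show "norm (id_blinfun :: ell2 \<Rightarrow>\<^sub>L ell2) = 1" by (simp add: norm_basis_vec)
  qed
  show "norm x = 0 \<longleftrightarrow> x = 0" by transfer simp
  show "norm (x + y) \<le> norm x + norm y" by transfer (rule norm_triangle_ineq)
  show "norm (r *\<^sub>R x) = \<bar>r\<bar> * norm x" by transfer simp
  show "(0::cop) \<noteq> 1"
  proof
    assume "(0::cop) = 1"
    with n1 have "norm (0::cop) = 1" by simp
    thus False by transfer simp
  qed
qed (simp_all add: dist_cop_def sgn_cop_def uniformity_cop_def open_cop_def)
end

lift_definition op_apply :: "cop \<Rightarrow> ell2 \<Rightarrow> ell2" is blinfun_apply .

lemma cop_eqI: "(\<And>x. op_apply a x = op_apply b x) \<Longrightarrow> a = b"
  by transfer (auto intro: blinfun_eqI)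

lemma op_apply_simps [simp]:
  "op_apply (a + b) x = op_apply a x + op_apply b x"
  "op_apply (a - b) x = op_apply a x - op_apply b x"
  "op_apply (a * b) x = op_apply a (op_apply b x)"
  "op_apply (- a) x = - op_apply a x"
  "op_apply (r *\<^sub>R a) x = r *\<^sub>R op_apply a x"
  "op_apply 1 x = x" "op_apply 0 x = 0"
  by (transfer; simp add: blinfun.bilinear_simps)+

lemma op_apply_linear [simp]:
  "op_apply a (x + y) = op_apply a x + op_apply a y"
  "op_apply a (x - y) = op_apply a x - op_apply a y"
  "op_apply a (- x) = - op_apply a x"
  "op_apply a 0 = 0"
  by (transfer; simp add: blinfun.bilinear_simps)+

lemma op_apply_cscale: "op_apply a (cscale c x) = cscale c (op_apply a x)"
  by transfer (simp add: complex_linear_def)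

lemma norm_op_apply: "norm (op_apply a x) \<le> norm a * norm x"
  by transfer (rule norm_blinfun)

lemma norm_op_leI: "0 \<le> c \<Longrightarrow> (\<And>x. norm (op_apply a x) \<le> c * norm x) \<Longrightarrow> norm a \<le> c"
  by transfer (auto intro: norm_blinfun_bound)

lift_definition adj :: "cop \<Rightarrow> cop" is "\<lambda>a. THE b. adjoint_pair a b"
proof safe
  fix a b assume ab: "adjoint_pair a b" and a: "complex_linear a"
  have "(THE b. adjoint_pair a b) = b" using ab by (blast intro: adjoint_pair_unique)
  thus "\<exists>c. adjoint_pair (THE b. adjoint_pair a b) c" "complex_linear (THE b. adjoint_pair a b)"
    using ab a by (auto intro: adjoint_pair_sym complex_linear_adjoint)
qed

lemma adjoint_pair_adj: "adjoint_pair (blinfun_of_cop a) (blinfun_of_cop (adj a))"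
proof -
  obtain b where ab: "adjoint_pair (blinfun_of_cop a) b" using blinfun_of_cop[of a] by blast
  thus ?thesis unfolding adj.rep_eq by (rule theI) (rule adjoint_pair_unique[OF _ ab])
qed

lemma inner_adj: "op_apply a x \<bullet> y = x \<bullet> op_apply (adj a) y"
  using adjoint_pair_adj[of a] unfolding adjoint_pair_def op_apply.rep_eq by blast

lemma adj_eqI: "(\<And>x y. op_apply a x \<bullet> y = x \<bullet> op_apply b y) \<Longrightarrow> adj a = b"
proof -
  assume "\<And>x y. op_apply a x \<bullet> y = x \<bullet> op_apply b y"
  hence "adjoint_pair (blinfun_of_cop a) (blinfun_of_cop b)"
    unfolding adjoint_pair_def op_apply.rep_eq by blast
  from adjoint_pair_unique[OF adjoint_pair_adj this] show ?thesis
    by (rule blinfun_of_cop_inject[THEN iffD1])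
qed

lemma adj_adj [simp]: "adj (adj a) = a"
proof (rule adj_eqI)
  fix x y
  have "op_apply (adj a) x \<bullet> y = y \<bullet> op_apply (adj a) x" by (rule inner_commute)
  also have "\<dots> = op_apply a y \<bullet> x" by (rule inner_adj[symmetric])
  also have "\<dots> = x \<bullet> op_apply a y" by (rule inner_commute)
  finally show "op_apply (adj a) x \<bullet> y = x \<bullet> op_apply a y" .
qed
lemma adj_add: "adj (a + b) = adj a + adj b"
  by (rule adj_eqI) (simp add: inner_adj inner_add)
lemma adj_diff: "adj (a - b) = adj a - adj b"
  by (rule adj_eqI) (simp add: inner_adj inner_diff)
lemma adj_mult: "adj (a * b) = adj b * adj a"
  by (rule adj_eqI) (simp add: inner_adj)
lemma adj_one [simp]: "adj 1 = 1" by (rule adj_eqI) simp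
lemma adj_zero [simp]: "adj 0 = 0" by (rule adj_eqI) simp
lemma norm_adj [simp]: "norm (adj a) = norm a"
  using adjoint_pair_norm_eq[OF adjoint_pair_adj[of a]] by (simp add: norm_cop.rep_eq)

text \<open>
  The C*-identity: \<open>(norm (a x))\<^sup>2\<close> is the inner product of \<open>x\<close> with \<open>a\<^sup>* a x\<close>.
\<close>

lemma norm_adj_mult: "norm (adj a * a) = (norm a)\<^sup>2"
proof (rule antisym)
  show "norm (adj a * a) \<le> (norm a)\<^sup>2"
    by (metis norm_adj norm_mult_ineq power2_eq_square)
  have "norm a \<le> sqrt (norm (adj a * a))"
  proof (rule norm_op_leI)
    fix x
    have "(norm (op_apply a x))\<^sup>2 = x \<bullet> op_apply (adj a * a) x"
      by (simp add: power2_norm_eq_inner inner_adj)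
    also have "\<dots> \<le> norm x * norm (op_apply (adj a * a) x)" by (rule norm_cauchy_schwarz)
    also have "\<dots> \<le> norm x * (norm (adj a * a) * norm x)" by (intro mult_left_mono norm_op_apply) simp
    also have "\<dots> = (sqrt (norm (adj a * a)) * norm x)\<^sup>2"
      by (simp add: power_mult_distrib power2_eq_square)
    finally show "norm (op_apply a x) \<le> sqrt (norm (adj a * a)) * norm x"
      by (rule power2_le_imp_le) simp
  qed simp
  from power_mono[OF this, of 2] show "(norm a)\<^sup>2 \<le> norm (adj a * a)" by simp
qed

instance cop :: banach
proof
  fix X :: "nat \<Rightarrow> cop" assume X: "Cauchy X"
  have 1: "Cauchy (\<lambda>n. blinfun_of_cop (Y n))" if "Cauchy Y" for Y
    using that unfolding Cauchy_def dist_norm by (simp add: norm_cop.rep_eq minus_cop.rep_eq)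
  have X': "Cauchy (\<lambda>n. adj (X n))"
    using X unfolding Cauchy_def dist_norm by (simp flip: adj_diff)
  obtain A where A: "(\<lambda>n. blinfun_of_cop (X n)) \<longlonglongrightarrow> A"
    using 1[OF X] by (meson Cauchy_convergent convergent_def)
  obtain B where B: "(\<lambda>n. blinfun_of_cop (adj (X n))) \<longlonglongrightarrow> B"
    using 1[OF X'] by (meson Cauchy_convergent convergent_def)
  have lim: "(\<lambda>n. blinfun_apply (Y n) x) \<longlonglongrightarrow> blinfun_apply C x" if "Y \<longlonglongrightarrow> C" for Y and C :: "ell2 \<Rightarrow>\<^sub>L ell2" and x
    using that by (intro tendsto_intros)
  have "adjoint_pair A B"
    unfolding adjoint_pair_def
  proof (intro allI)
    fix x y
    have "(\<lambda>n. op_apply (X n) x \<bullet> y) \<longlonglongrightarrow> blinfun_apply A x \<bullet> y"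
      unfolding op_apply.rep_eq by (intro tendsto_intros lim A)
    moreover have "(\<lambda>n. x \<bullet> op_apply (adj (X n)) y) \<longlonglongrightarrow> x \<bullet> blinfun_apply B y"
      unfolding op_apply.rep_eq by (intro tendsto_intros lim B)
    ultimately show "blinfun_apply A x \<bullet> y = x \<bullet> blinfun_apply B y"
      by (simp add: inner_adj LIMSEQ_unique)
  qed
  moreover have "complex_linear A"
    unfolding complex_linear_def
  proof (intro allI)
    fix c x
    have "(\<lambda>n. op_apply (X n) (cscale c x)) \<longlonglongrightarrow> blinfun_apply A (cscale c x)"
      unfolding op_apply.rep_eq by (rule lim[OF A])
    moreover have "(\<lambda>n. cscale c (op_apply (X n) x)) \<longlonglongrightarrow> cscale c (blinfun_apply A x)"
      unfolding op_apply.rep_eq by (rule bounded_linear.tendsto[OF bounded_linear_cscale lim[OF A]])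
    ultimately show "blinfun_apply A (cscale c x) = cscale c (blinfun_apply A x)"
      by (simp add: op_apply_cscale LIMSEQ_unique)
  qed
  ultimately obtain L where L: "blinfun_of_cop L = A" using Abs_cop_inverse by blast
  have "X \<longlonglongrightarrow> L"
    using A unfolding LIMSEQ_iff by (simp add: norm_cop.rep_eq minus_cop.rep_eq L)
  thus "convergent X" by (auto simp: convergent_def)
qed

text \<open>
  The scalar multiples of the identity. They make \<open>cop\<close> a complex algebra on top of its real
  type class structure.
\<close>

lift_definition scal :: "complex \<Rightarrow> cop" is "\<lambda>c. Blinfun (cscale c)"
  by (auto simp: complex_linear_def adjoint_pair_def bounded_linear_Blinfun_apply bounded_linear_cscale
      inner_cscale cscale_cscale mult.commute intro!: exI[of _ "Blinfun (cscale (cnj _))"])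

lemma op_apply_scal [simp]: "op_apply (scal c) x = cscale c x"
  by transfer (simp add: bounded_linear_Blinfun_apply bounded_linear_cscale)

lemma scal_add: "scal (c + d) = scal c + scal d"
  by (rule cop_eqI, rule ell2_eqI) (simp add: cscale.rep_eq plus_ell2.rep_eq algebra_simps)
lemma scal_diff: "scal (c - d) = scal c - scal d"
  by (rule cop_eqI, rule ell2_eqI) (simp add: cscale.rep_eq minus_ell2.rep_eq algebra_simps)
lemma scal_minus: "scal (- c) = - scal c"
  by (rule cop_eqI, rule ell2_eqI) (simp add: cscale.rep_eq uminus_ell2.rep_eq)
lemma scal_mult: "scal (c * d) = scal c * scal d"
  by (rule cop_eqI) (simp add: cscale_cscale)
lemma scal_of_real: "scal (of_real r) = r *\<^sub>R 1"
  by (rule cop_eqI, rule ell2_eqI) (simp only: op_apply_scal op_apply_simps cscale.rep_eq scaleR_ell2.rep_eq scaleR_conv_of_real[where 'a = complex])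
lemma scal_0 [simp]: "scal 0 = 0" using scal_of_real[of 0] by simp
lemma scal_1 [simp]: "scal 1 = 1" using scal_of_real[of 1] by simp
lemma scal_central: "a * scal c = scal c * a"
  by (rule cop_eqI) (simp add: op_apply_cscale)
lemma adj_scal: "adj (scal c) = scal (cnj c)"
  by (rule adj_eqI) (simp add: inner_cscale)
lemma norm_scal_mult: "norm (scal c * a) = norm c * norm a"
proof (cases "c = 0")
  case False
  have le: "norm (scal d * b) \<le> norm d * norm b" for d b
    by (rule norm_op_leI)
       (auto simp: norm_cscale mult.assoc intro: mult_left_mono norm_op_apply)
  have "norm (scal (inverse c) * (scal c * a)) \<le> norm (inverse c) * norm (scal c * a)" by (rule le)
  hence "norm a \<le> norm (inverse c) * norm (scal c * a)"
    using False by (simp flip: mult.assoc scal_mult)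
  hence "norm c * norm a \<le> norm (scal c * a)"
    using False by (simp add: norm_divide field_simps)
  with le[of c a] show ?thesis by simp
qed simp
lemma norm_scal [simp]: "norm (scal c) = norm c"
  using norm_scal_mult[of c 1] by simp

section \<open>Partial injections as operators\<close>

text \<open>
  Partial injections of the basis, given together with their inverses. Matrix units and the
  isometries below are all of this kind, so that products and adjoints can be computed on indices.
\<close>

definition mutually_inverse :: "(nat \<rightharpoonup> nat) \<Rightarrow> (nat \<rightharpoonup> nat) \<Rightarrow> bool" where
  "mutually_inverse g g' \<longleftrightarrow> (\<forall>m k. g m = Some k \<longleftrightarrow> g' k = Some m)"

lemma mutually_inverse_sym: "mutually_inverse g g' \<Longrightarrow> mutually_inverse g' g"
  by (auto simp: mutually_inverse_def)

definition pullback :: "(nat \<rightharpoonup> nat) \<Rightarrow> ell2 \<Rightarrow> nat \<Rightarrow> complex" where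
  "pullback g x m = (case g m of None \<Rightarrow> 0 | Some k \<Rightarrow> coords x k)"

lemma pullback_sum_le:
  assumes "mutually_inverse g g'" "finite F"
  shows "(\<Sum>m\<in>F. (norm (pullback g x m))\<^sup>2) \<le> (norm x)\<^sup>2"
proof -
  let ?G = "F \<inter> dom g"
  have inj: "inj_on (\<lambda>m. the (g m)) ?G"
  proof (rule inj_onI)
    fix m n assume "m \<in> ?G" "n \<in> ?G" and eq: "the (g m) = the (g n)"
    then obtain k where "g m = Some k" "g n = Some k" by auto
    hence "g' k = Some m" "g' k = Some n" using assms(1) unfolding mutually_inverse_def by blast+
    thus "m = n" by simp
  qed
  have "(\<Sum>m\<in>F. (norm (pullback g x m))\<^sup>2) = (\<Sum>m\<in>?G. (norm (coords x (the (g m))))\<^sup>2)"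
    by (rule sum.mono_neutral_cong_right) (use assms(2) in \<open>auto simp: pullback_def split: option.splits\<close>)
  also have "\<dots> = (\<Sum>k\<in>(\<lambda>m. the (g m)) ` ?G. (norm (coords x k))\<^sup>2)"
    by (simp add: sum.reindex[OF inj])
  also have "\<dots> \<le> (norm x)\<^sup>2" by (rule finite_sum_coords_le) (use assms(2) in auto)
  finally show ?thesis .
qed

definition pullback_vec :: "(nat \<rightharpoonup> nat) \<Rightarrow> ell2 \<Rightarrow> ell2" where
  "pullback_vec g x = Abs_ell2 (pullback g x)"

lemma coords_pullback_vec:
  assumes "mutually_inverse g g'"
  shows "coords (pullback_vec g x) m = (case g m of None \<Rightarrow> 0 | Some k \<Rightarrow> coords x k)"
proof -
  have "(\<lambda>m. (norm (pullback g x m))\<^sup>2) summable_on UNIV"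
    by (rule nonneg_bdd_above_summable_on)
      (use pullback_sum_le[OF assms] in \<open>auto intro!: bdd_aboveI[of _ "(norm x)\<^sup>2"]\<close>)
  thus ?thesis unfolding pullback_vec_def by (subst Abs_ell2_inverse) (auto simp: pullback_def)
qed

lemma bounded_linear_pullback_vec:
  assumes "mutually_inverse g g'"
  shows "bounded_linear (pullback_vec g)"
proof (rule bounded_linear_intro[where K = 1])
  show "pullback_vec g (x + y) = pullback_vec g x + pullback_vec g y" for x y
    by (rule ell2_eqI) (simp add: coords_pullback_vec[OF assms] plus_ell2.rep_eq split: option.split)
  show "pullback_vec g (r *\<^sub>R x) = r *\<^sub>R pullback_vec g x" for r x
    by (rule ell2_eqI) (simp add: coords_pullback_vec[OF assms] scaleR_ell2.rep_eq split: option.split)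
  show "norm (pullback_vec g x) \<le> norm x * 1" for x
    using pullback_sum_le[OF assms]
    by (auto intro!: norm_ell2_leI simp: coords_pullback_vec[OF assms] pullback_def)
qed

lemma inner_pullback_vec:
  assumes "mutually_inverse g g'"
  shows "pullback_vec g x \<bullet> y = x \<bullet> pullback_vec g' y"
proof -
  have bij: "bij_betw (\<lambda>m. the (g m)) (dom g) (dom g')"
  proof (rule bij_betw_byWitness[where f' = "\<lambda>k. the (g' k)"])
    have 1: "g' k = Some m" if "g m = Some k" for m k
      using assms that unfolding mutually_inverse_def by blast
    have 2: "g m = Some k" if "g' k = Some m" for m k
      using assms that unfolding mutually_inverse_def by blast
    show "\<forall>m\<in>dom g. the (g' (the (g m))) = m" using 1 by fastforce
    show "\<forall>k\<in>dom g'. the (g (the (g' k))) = k" using 2 by fastforce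
    show "(\<lambda>m. the (g m)) ` dom g \<subseteq> dom g'" using 1 by fastforce
    show "(\<lambda>k. the (g' k)) ` dom g' \<subseteq> dom g" using 2 by fastforce
  qed
  have "pullback_vec g x \<bullet> y = (\<Sum>\<^sub>\<infinity>m\<in>dom g. coords x (the (g m)) \<bullet> coords y (the (g' (the (g m)))))"
    unfolding inner_ell2_def coords_pullback_vec[OF assms]
  proof (rule infsum_cong_neutral)
    fix m assume "m \<in> UNIV \<inter> dom g"
    then obtain k where k: "g m = Some k" by auto
    hence "g' k = Some m" using assms unfolding mutually_inverse_def by blast
    with k show "(case g m of None \<Rightarrow> 0 | Some k \<Rightarrow> coords x k) \<bullet> coords y m =
        coords x (the (g m)) \<bullet> coords y (the (g' (the (g m))))" by simp
  qed (auto split: option.splits)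
  also have "\<dots> = (\<Sum>\<^sub>\<infinity>k\<in>dom g'. coords x k \<bullet> coords y (the (g' k)))"
    by (rule infsum_reindex_bij_betw[OF bij, of "\<lambda>k. coords x k \<bullet> coords y (the (g' k))"])
  also have "\<dots> = x \<bullet> pullback_vec g' y"
    unfolding inner_ell2_def coords_pullback_vec[OF mutually_inverse_sym[OF assms]]
    by (rule infsum_cong_neutral) (auto split: option.splits)
  finally show ?thesis .
qed

definition pinj_op :: "(nat \<rightharpoonup> nat) \<Rightarrow> cop" where
  "pinj_op g = Abs_cop (Blinfun (pullback_vec g))"

lemma op_apply_pinj_op:
  assumes "mutually_inverse g g'"
  shows "op_apply (pinj_op g) = pullback_vec g"
proof -
  note bl = bounded_linear_pullback_vec[OF assms] bounded_linear_pullback_vec[OF mutually_inverse_sym[OF assms]]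
  have "adjoint_pair (Blinfun (pullback_vec g)) (Blinfun (pullback_vec g'))"
    by (simp add: adjoint_pair_def bounded_linear_Blinfun_apply bl inner_pullback_vec[OF assms])
  moreover have "complex_linear (Blinfun (pullback_vec g))"
    by (auto simp: complex_linear_def bounded_linear_Blinfun_apply bl cscale.rep_eq coords_pullback_vec[OF assms]
        intro!: ell2_eqI split: option.split)
  ultimately show ?thesis
    unfolding op_apply.rep_eq pinj_op_def
    by (subst Abs_cop_inverse) (auto simp: bounded_linear_Blinfun_apply bl)
qed

lemma coords_pinj_op:
  "mutually_inverse g g' \<Longrightarrow>
     coords (op_apply (pinj_op g) x) m = (case g m of None \<Rightarrow> 0 | Some k \<Rightarrow> coords x k)"
  by (simp add: op_apply_pinj_op coords_pullback_vec)

lemma adj_pinj_op: "mutually_inverse g g' \<Longrightarrow> adj (pinj_op g) = pinj_op g'"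
  by (rule adj_eqI) (simp add: op_apply_pinj_op inner_pullback_vec mutually_inverse_sym op_apply_pinj_op[OF mutually_inverse_sym])

lemma norm_pinj_op_le:
  assumes "mutually_inverse g g'"
  shows "norm (pinj_op g) \<le> 1"
  by (rule norm_op_leI)
    (use pullback_sum_le[OF assms] in
      \<open>auto intro!: norm_ell2_leI simp: coords_pinj_op[OF assms] pullback_def\<close>)

definition munit :: "nat \<Rightarrow> nat \<Rightarrow> cop" where
  "munit a b = pinj_op [a \<mapsto> b]"

text \<open>
  The pairing function splits the basis of \<open>\<ell>\<^sup>2\<close> into infinitely many infinite slices.
  \<open>slice i\<close> is an isometry of \<open>\<ell>\<^sup>2\<close> onto slice number \<open>i\<close>, and \<open>unslice i\<close> is its adjoint: isometries as
  in a Cuntz algebra.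
\<close>

definition slice :: "nat \<Rightarrow> cop" where
  "slice i = pinj_op (\<lambda>m. if fst (prod_decode m) = i then Some (snd (prod_decode m)) else None)"

definition unslice :: "nat \<Rightarrow> cop" where
  "unslice i = pinj_op (\<lambda>k. Some (prod_encode (i, k)))"

lemma mutually_inverse_munit: "mutually_inverse [a \<mapsto> b] [b \<mapsto> a]"
  by (auto simp: mutually_inverse_def)

lemma eq_prod_encode_iff: "m = prod_encode (i, k) \<longleftrightarrow> fst (prod_decode m) = i \<and> snd (prod_decode m) = k"
proof
  assume "fst (prod_decode m) = i \<and> snd (prod_decode m) = k"
  hence "prod_decode m = (i, k)" by (simp add: prod_eq_iff)
  thus "m = prod_encode (i, k)" by (metis prod_decode_inverse)
qed simp

lemma mutually_inverse_slice:
  "mutually_inverse (\<lambda>m. if fst (prod_decode m) = i then Some (snd (prod_decode m)) else None)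
     (\<lambda>k. Some (prod_encode (i, k)))"
  by (auto simp: mutually_inverse_def eq_prod_encode_iff eq_commute[of "prod_encode _"])

lemma coords_munit [simp]: "coords (op_apply (munit a b) x) m = (if m = a then coords x b else 0)"
  unfolding munit_def by (subst coords_pinj_op[OF mutually_inverse_munit]) simp

lemma coords_slice [simp]: "coords (op_apply (slice i) x) m =
    (if fst (prod_decode m) = i then coords x (snd (prod_decode m)) else 0)"
  unfolding slice_def by (subst coords_pinj_op[OF mutually_inverse_slice]) simp

lemma coords_unslice [simp]: "coords (op_apply (unslice i) x) k = coords x (prod_encode (i, k))"
  unfolding unslice_def by (subst coords_pinj_op[OF mutually_inverse_sym[OF mutually_inverse_slice]]) simp

lemma adj_munit [simp]: "adj (munit a b) = munit b a"
  unfolding munit_def by (rule adj_pinj_op[OF mutually_inverse_munit])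

lemma adj_slice [simp]: "adj (slice i) = unslice i"
  unfolding slice_def unslice_def by (rule adj_pinj_op[OF mutually_inverse_slice])

lemma adj_unslice [simp]: "adj (unslice i) = slice i"
  by (metis adj_adj adj_slice)

lemma norm_munit_le: "norm (munit a b) \<le> 1"
  unfolding munit_def by (rule norm_pinj_op_le[OF mutually_inverse_munit])

lemma norm_slice_le: "norm (slice i) \<le> 1"
  unfolding slice_def by (rule norm_pinj_op_le[OF mutually_inverse_slice])

lemma norm_unslice_le: "norm (unslice i) \<le> 1"
  using norm_slice_le[of i] norm_adj[of "slice i"] by simp

lemma coords_zero [simp]: "coords 0 i = 0" by (simp add: zero_ell2.rep_eq)

lemma op_coords_eqI: "(\<And>x i. coords (op_apply a x) i = coords (op_apply b x) i) \<Longrightarrow> a = b"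
  by (intro cop_eqI ell2_eqI)

lemma munit_mult: "munit a b * munit c d = (if b = c then munit a d else 0)"
  by (rule op_coords_eqI) auto

lemma unslice_slice: "unslice i * slice j = (if i = j then 1 else 0)"
  by (rule op_coords_eqI) auto

lemma slice_munit_unslice:
  "slice i * munit a b * unslice j = munit (prod_encode (i, a)) (prod_encode (j, b))"
  by (rule op_coords_eqI) (auto simp: eq_prod_encode_iff)

lemma unslice_munit_slice:
  "unslice i * munit s t * slice j =
     (if fst (prod_decode s) = i \<and> fst (prod_decode t) = j
      then munit (snd (prod_decode s)) (snd (prod_decode t)) else 0)"
  by (rule op_coords_eqI) (auto simp: eq_commute[of "prod_encode _"] eq_prod_encode_iff)

lemma munit_slice_unslice:
  "munit s t * (slice i * unslice j) =
     (if fst (prod_decode t) = i then munit s (prod_encode (j, snd (prod_decode t))) else 0)"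
  by (rule op_coords_eqI) auto

lemma slice_unslice_munit:
  "(slice i * unslice j) * munit s t =
     (if fst (prod_decode s) = j then munit (prod_encode (i, snd (prod_decode s))) t else 0)"
proof -
  have "(slice i * unslice j) * munit s t = adj (munit t s * (slice j * unslice i))"
    by (simp add: adj_mult mult.assoc)
  also have "\<dots> = (if fst (prod_decode s) = j then munit (prod_encode (i, snd (prod_decode s))) t else 0)"
    by (simp add: munit_slice_unslice)
  finally show ?thesis .
qed

lemma munit_basis_vec: "op_apply (munit a b) (basis_vec c) = (if b = c then basis_vec a else 0)"
  by (rule ell2_eqI) (simp add: basis_vec.rep_eq)

lemma norm_munit [simp]: "norm (munit a b) = 1"
proof (rule antisym[OF norm_munit_le])
  show "1 \<le> norm (munit a b)"
    using norm_op_apply[of "munit a b" "basis_vec b"] by (simp add: munit_basis_vec norm_basis_vec)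
qed

section \<open>Finite-dimensional *-algebras of operators\<close>

definition unitary_op :: "cop \<Rightarrow> bool" where
  "unitary_op u \<longleftrightarrow> adj u * u = 1 \<and> u * adj u = 1"

definition star_subalgebra :: "cop set \<Rightarrow> bool" where
  "star_subalgebra D \<longleftrightarrow> 1 \<in> D \<and> subspace D \<and> (\<forall>c. \<forall>x\<in>D. scal c * x \<in> D) \<and>
     (\<forall>x\<in>D. \<forall>y\<in>D. x * y \<in> D) \<and> (\<forall>x\<in>D. adj x \<in> D)"

definition finite_dim :: "cop set \<Rightarrow> bool" where
  "finite_dim D \<longleftrightarrow> (\<exists>S. finite S \<and> D \<subseteq> span S)"

text \<open>
  AF algebras of operators, by the local characterization.
\<close>

definition AF_algebra :: "cop set \<Rightarrow> bool" where
  "AF_algebra A \<longleftrightarrow> closed A \<and> star_subalgebra A \<and>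
     (\<forall>z\<in>A. \<forall>e>0. \<exists>D. star_subalgebra D \<and> finite_dim D \<and> D \<subseteq> A \<and> (\<exists>y\<in>D. norm (z - y) < e))"

lemma star_subalgebraD:
  assumes "star_subalgebra D"
  shows "1 \<in> D" "subspace D" "x \<in> D \<Longrightarrow> scal c * x \<in> D" "x \<in> D \<Longrightarrow> y \<in> D \<Longrightarrow> x * y \<in> D"
    "x \<in> D \<Longrightarrow> adj x \<in> D" "0 \<in> D" "x \<in> D \<Longrightarrow> y \<in> D \<Longrightarrow> x + y \<in> D" "x \<in> D \<Longrightarrow> y \<in> D \<Longrightarrow> x - y \<in> D"
    "x \<in> D \<Longrightarrow> r *\<^sub>R x \<in> D" "x \<in> D \<Longrightarrow> - x \<in> D" "scal c \<in> D"
proof -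
  show "scal c \<in> D" using assms unfolding star_subalgebra_def by (metis mult.right_neutral)
qed (use assms in \<open>unfold star_subalgebra_def\<close>,
  auto intro: subspace_0 subspace_add subspace_diff subspace_scale subspace_neg)

lemma star_subalgebra_power: "star_subalgebra D \<Longrightarrow> x \<in> D \<Longrightarrow> x ^ n \<in> D"
  by (induction n) (auto intro: star_subalgebraD)

text \<open>
  The coefficient of \<open>b\<close> in an element of the larger space is bounded by the norm of the element divided by
  the distance from \<open>b\<close> to the smaller space. Hence coefficients of convergent sequences converge.
\<close>

lemma closed_span_insert:
  fixes b :: "'a::real_normed_vector"
  assumes V: "closed (span S)" and b: "b \<notin> span S"
  shows "closed (span (insert b S))"
proof -
  define d where "d = infdist b (span S)"
  have "span S \<noteq> {}" using span_zero by blast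
  with b have "d \<noteq> 0" unfolding d_def by (simp add: in_closed_iff_infdist_zero[OF V])
  hence d: "d > 0" unfolding d_def using infdist_nonneg[of b "span S"] by simp
  have bound: "\<bar>t\<bar> * d \<le> norm (t *\<^sub>R b + v)" if "v \<in> span S" for t v
  proof (cases "t = 0")
    case False
    have "d \<le> dist b (- (inverse t *\<^sub>R v))"
      unfolding d_def by (rule infdist_le) (use that in \<open>auto intro: span_neg span_scale\<close>)
    hence "\<bar>t\<bar> * d \<le> \<bar>t\<bar> * norm (b + inverse t *\<^sub>R v)" by (simp add: dist_norm mult_left_mono)
    also have "\<dots> = norm (t *\<^sub>R (b + inverse t *\<^sub>R v))" by simp
    also have "\<dots> = norm (t *\<^sub>R b + v)" using False by (simp add: scaleR_add_right del: norm_scaleR)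
    finally show ?thesis .
  qed simp
  show ?thesis
    unfolding closed_sequential_limits
  proof (intro allI impI, elim conjE)
    fix z l assume z: "\<forall>n. z n \<in> span (insert b S)" and lim: "z \<longlonglongrightarrow> l"
    have "\<forall>n. \<exists>k. z n - k *\<^sub>R b \<in> span S" using z by (auto simp: span_insert)
    then obtain t where t: "\<And>n. z n - t n *\<^sub>R b \<in> span S" by metis
    have Cz: "Cauchy z" using lim by (rule LIMSEQ_imp_Cauchy)
    have "\<bar>t m - t n\<bar> * d \<le> norm (z m - z n)" for m n
      using bound[OF span_diff[OF t[of m] t[of n]], of "t m - t n"] by (simp add: algebra_simps)
    hence td: "\<bar>t m - t n\<bar> \<le> norm (z m - z n) / d" for m n
      using d by (simp add: field_simps)
    have "Cauchy t"
    proof (rule metric_CauchyI)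
      fix e :: real assume "e > 0"
      hence "e * d > 0" using d by simp
      then obtain M where "\<And>m n. m \<ge> M \<Longrightarrow> n \<ge> M \<Longrightarrow> norm (z m - z n) < e * d"
        using Cz unfolding Cauchy_def dist_norm by blast
      hence "norm (z m - z n) / d < e" if "m \<ge> M" "n \<ge> M" for m n
        using that d by (simp add: pos_divide_less_eq)
      hence "dist (t m) (t n) < e" if "m \<ge> M" "n \<ge> M" for m n
        using le_less_trans[OF td] that by (simp add: dist_norm)
      thus "\<exists>M. \<forall>m\<ge>M. \<forall>n\<ge>M. dist (t m) (t n) < e" by blast
    qed
    then obtain t0 where t0: "t \<longlonglongrightarrow> t0" by (meson Cauchy_convergent convergent_def)
    have "(\<lambda>n. z n - t n *\<^sub>R b) \<longlonglongrightarrow> l - t0 *\<^sub>R b" by (intro tendsto_intros lim t0)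
    hence "l - t0 *\<^sub>R b \<in> span S" by (rule closed_sequentially[OF V t])
    thus "l \<in> span (insert b S)" by (auto simp: span_insert)
  qed
qed

lemma closed_span_finite:
  fixes S :: "'a::real_normed_vector set"
  assumes "finite S"
  shows "closed (span S)"
  using assms
proof (induction S)
  case (insert b S)
  thus ?case by (cases "b \<in> span S") (auto simp: span_redundant closed_span_insert)
qed auto

text \<open>
  Keeps the limits of Newton's iteration inside a finite-dimensional *-algebra.
\<close>

lemma finite_dim_closed:
  assumes "subspace D" "finite_dim D"
  shows "closed D"
proof -
  obtain S where S: "finite S" "D \<subseteq> span S" using assms(2) by (auto simp: finite_dim_def)
  obtain B where B: "B \<subseteq> D" "independent B" "D \<subseteq> span B" using maximal_independent_subset by blast
  have "finite B" using independent_span_bound[OF S(1) B(2)] B(1) S(2) by blast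
  moreover have "span B = D" using B assms(1) by (intro antisym span_minimal) auto
  ultimately show ?thesis using closed_span_finite[of B] by simp
qed

text \<open>
  Horner evaluation at an operator. The coefficients are complex scalars, which are central, while
  the operators form a noncommutative ring.
\<close>

definition eval_poly :: "cop \<Rightarrow> complex poly \<Rightarrow> cop" where
  "eval_poly y p = fold_coeffs (\<lambda>a b. scal a + y * b) p 0"

lemma eval_poly_0 [simp]: "eval_poly y 0 = 0"
  by (simp add: eval_poly_def)

lemma eval_poly_pCons [simp]: "eval_poly y (pCons a p) = scal a + y * eval_poly y p"
  by (cases "p = 0 \<and> a = 0") (auto simp add: eval_poly_def)

lemma eval_poly_add: "eval_poly y (p + q) = eval_poly y p + eval_poly y q"
  by (induction p q rule: poly_induct2) (simp_all add: scal_add algebra_simps)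

lemma eval_poly_smult: "eval_poly y (smult c p) = scal c * eval_poly y p"
proof (induction p)
  case (pCons a p)
  have "y * (scal c * eval_poly y p) = scal c * (y * eval_poly y p)"
    by (simp only: mult.assoc[symmetric] scal_central[of y])
  with pCons.IH show ?case by (simp add: scal_mult distrib_left)
qed simp

lemma eval_poly_diff: "eval_poly y (p - q) = eval_poly y p - eval_poly y q"
proof -
  have "p - q = p + smult (- 1) q" by simp
  thus ?thesis by (simp only: eval_poly_add eval_poly_smult scal_minus scal_1) simp
qed

lemma eval_poly_sum: "eval_poly y (\<Sum>i\<in>I. f i) = (\<Sum>i\<in>I. eval_poly y (f i))"
  by (induction I rule: infinite_finite_induct) (simp_all add: eval_poly_add)

lemma eval_poly_monom: "eval_poly y (monom c n) = scal c * y ^ n"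
  by (induction n) (simp_all add: monom_0 monom_Suc mult.assoc[symmetric] scal_central[of y])

lemma eval_poly_commute: "y * eval_poly y p = eval_poly y p * y"
proof (induction p)
  case (pCons a p)
  have "y * (y * eval_poly y p) = y * (eval_poly y p * y)" by (simp only: pCons.IH)
  thus ?case by (simp add: distrib_left distrib_right scal_central[of y] mult.assoc)
qed simp

lemma eval_poly_mem: "star_subalgebra D \<Longrightarrow> y \<in> D \<Longrightarrow> eval_poly y p \<in> D"
  by (induction p) (auto intro: star_subalgebraD)

text \<open>
  More powers than the dimension permits are linearly dependent.
\<close>

lemma finite_dim_algebraic:
  assumes "star_subalgebra D" "finite_dim D" "y \<in> D"
  obtains p where "p \<noteq> 0" "eval_poly y p = 0"
proof -
  obtain S where S: "finite S" "D \<subseteq> span S" using assms(2) by (auto simp: finite_dim_def)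
  define f where "f = (\<lambda>i::nat. y ^ i)"
  let ?I = "{..card S}"
  have fS: "f ` ?I \<subseteq> span S" using S(2) star_subalgebra_power[OF assms(1,3)] by (auto simp: f_def)
  show thesis
  proof (cases "inj_on f ?I")
    case False
    then obtain i j where ij: "i \<noteq> j" "y ^ i = y ^ j" by (auto simp: inj_on_def f_def)
    show thesis
    proof (rule that[of "monom 1 i - monom 1 j"])
      have "coeff (monom 1 i - monom 1 j :: complex poly) i = 1" using ij(1) by simp
      thus "monom 1 i - monom 1 j \<noteq> (0 :: complex poly)" by (metis coeff_0 zero_neq_one)
    qed (simp add: eval_poly_diff eval_poly_monom ij)
  next
    case True
    have "dependent (f ` ?I)"
      using independent_span_bound[OF S(1) _ fS] card_image[OF True] by fastforce
    then obtain u where u: "\<exists>v\<in>f ` ?I. u v \<noteq> 0" "(\<Sum>v\<in>f ` ?I. u v *\<^sub>R v) = 0"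
      by (auto simp: dependent_finite)
    define p where "p = (\<Sum>i\<in>?I. monom (complex_of_real (u (f i))) i)"
    have "coeff p i = complex_of_real (u (f i))" if "i \<in> ?I" for i
      using that by (simp add: p_def coeff_sum)
    hence "p \<noteq> 0" using u(1) by (metis coeff_0 imageE of_real_eq_0_iff)
    moreover have "eval_poly y p = 0"
      using u(2) by (simp add: p_def eval_poly_sum eval_poly_monom scal_of_real sum.reindex[OF True])
        (simp add: f_def)
    ultimately show thesis by (rule that)
  qed
qed

lemma eval_poly_division:
  "(y - scal \<mu>) * eval_poly y (synthetic_div p \<mu>) = eval_poly y p - scal (poly p \<mu>)"
proof -
  have "eval_poly y p = eval_poly y ([:- \<mu>, 1:] * synthetic_div p \<mu> + [:poly p \<mu>:])"
    by (simp only: synthetic_div_correct')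
  also have "\<dots> = (y - scal \<mu>) * eval_poly y (synthetic_div p \<mu>) + scal (poly p \<mu>)"
    by (simp add: eval_poly_add eval_poly_diff eval_poly_smult scal_minus algebra_simps)
  finally show ?thesis by simp
qed

text \<open>
  If \<open>p\<close> annihilates \<open>y\<close>, then the quotient of \<open>p\<close> by \<open>X - \<mu>\<close> provides an inverse of \<open>y - \<mu>\<close> up to the nonzero
  scalar \<open>poly p \<mu>\<close>. So the spectrum is contained in the finite set of roots of \<open>p\<close>.
\<close>

lemma invertible_off_roots:
  assumes "star_subalgebra D" "y \<in> D" "eval_poly y p = 0" "poly p \<mu> \<noteq> 0"
  obtains s where "s \<in> D" "(y - scal \<mu>) * s = 1" "s * (y - scal \<mu>) = 1"
proof -
  define q where "q = eval_poly y (synthetic_div p \<mu>)"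
  define s where "s = scal (- inverse (poly p \<mu>)) * q"
  have 1: "(y - scal \<mu>) * q = - scal (poly p \<mu>)"
    unfolding q_def by (simp add: eval_poly_division assms(3))
  have comm: "(y - scal \<mu>) * q = q * (y - scal \<mu>)"
    unfolding q_def by (simp only: left_diff_distrib right_diff_distrib eval_poly_commute scal_central[of "eval_poly _ _"])
  have 2: "s * (y - scal \<mu>) = 1"
    using assms(4) 1 comm by (simp add: s_def mult.assoc scal_minus flip: scal_mult)
  have "(y - scal \<mu>) * s = scal (- inverse (poly p \<mu>)) * ((y - scal \<mu>) * q)"
    unfolding s_def by (simp only: mult.assoc[symmetric] scal_central[of "y - _"])
  also have "\<dots> = 1" using assms(4) 1 by (simp add: scal_minus flip: scal_mult)
  finally have "(y - scal \<mu>) * s = 1" .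
  moreover have "s \<in> D" unfolding s_def q_def using assms by (auto intro!: star_subalgebraD eval_poly_mem)
  ultimately show ?thesis using 2 that by blast
qed

text \<open>
  A left invertible element can be cancelled from a polynomial relation, so \<open>0\<close> is not a root of a
  relation of least degree.
\<close>

lemma left_invertible_imp_right_invertible:
  assumes "star_subalgebra D" "finite_dim D" "y \<in> D" and k: "k * y = 1"
  obtains s where "y * s = 1"
proof -
  define P where "P = (\<lambda>p. p \<noteq> 0 \<and> eval_poly y p = 0)"
  obtain p where p: "P p" and min: "\<And>q. P q \<Longrightarrow> degree p \<le> degree q"
    using finite_dim_algebraic[OF assms(1-3)] ex_has_least_nat[of P _ degree] unfolding P_def by metis
  have "poly p 0 \<noteq> 0"
  proof
    assume "poly p 0 = 0"
    then obtain q where q: "p = [:0, 1:] * q" by (metis dvdE minus_zero poly_eq_0_iff_dvd)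
    hence q0: "q \<noteq> 0" and deg: "degree p = Suc (degree q)" using p by (auto simp: P_def)
    have "y * eval_poly y q = 0" using p q by (simp add: P_def)
    hence "k * (y * eval_poly y q) = 0" by simp
    hence "eval_poly y q = 0" using k by (simp flip: mult.assoc)
    with min[of q] q0 deg show False by (simp add: P_def)
  qed
  with invertible_off_roots[OF assms(1,3), of p 0] p show ?thesis using that by (auto simp: P_def)
qed

lemma neumann_inverse:
  fixes x :: "'a::{real_normed_algebra_1, banach}"
  assumes x: "norm x < 1" and A: "closed A" "subspace A" "1 \<in> A" "\<And>n. x ^ n \<in> A"
  obtains k where "k \<in> A" "(1 - x) * k = 1" "k * (1 - x) = 1"
proof -
  have sm: "summable (\<lambda>n. x ^ n)"
    by (rule summable_comparison_test'[OF summable_geometric[of "norm x"]])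
      (use x in \<open>auto intro: norm_power_ineq\<close>)
  define k where "k = suminf (\<lambda>n. x ^ n)"
  have sm': "summable (\<lambda>n. x ^ Suc n)" using sm by (subst summable_Suc_iff)
  have split: "k = 1 + suminf (\<lambda>n. x ^ Suc n)" unfolding k_def using suminf_split_head[OF sm] by simp
  have "x * k = suminf (\<lambda>n. x ^ Suc n)" unfolding k_def by (subst suminf_mult[OF sm, symmetric]) simp
  moreover have "k * x = suminf (\<lambda>n. x ^ Suc n)"
    unfolding k_def by (subst suminf_mult2[OF sm]) (simp add: power_commutes)
  moreover have "k \<in> A"
  proof (rule closed_sequentially[OF A(1)])
    show "(\<lambda>n. \<Sum>i<n. x ^ i) \<longlonglongrightarrow> k" unfolding k_def using sm by (rule summable_LIMSEQ)
    show "\<And>n. (\<Sum>i<n. x ^ i) \<in> A" using A by (intro subspace_sum) auto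
  qed
  ultimately show ?thesis using that split by (auto simp: algebra_simps)
qed

lemma norm_isometry_le: 
  assumes "adj w * w = 1"
  shows "norm w = 1"
  using norm_adj_mult[of w] assms norm_ge_zero[of w] by (auto simp: power2_eq_1_iff eq_commute[of 1])

text \<open>
  For \<open>y\<close> close to the isometry \<open>w\<close>, the product \<open>w\<^sup>* y\<close> is close to \<open>1\<close> and therefore invertible. If \<open>y\<close> lies in
  a finite-dimensional algebra, its left invertibility makes it invertible; then \<open>w\<^sup>*\<close> is invertible too.
\<close>

theorem AF_isometry_unitary:
  assumes "AF_algebra A" "w \<in> A" and iso: "adj w * w = 1"
  shows "w * adj w = 1"
proof -
  obtain D y where D: "star_subalgebra D" "finite_dim D" "y \<in> D" and y: "norm (w - y) < 1"
    using assms(1,2) unfolding AF_algebra_def by (meson less_numeral_extra(1))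
  have "norm (adj w * (w - y)) \<le> 1 * norm (w - y)"
    using norm_mult_ineq[of "adj w" "w - y"] norm_isometry_le[OF iso] by simp
  hence "norm (adj w * (w - y)) < 1" using y by simp
  then obtain k where k: "(1 - adj w * (w - y)) * k = 1" "k * (1 - adj w * (w - y)) = 1"
    using neumann_inverse[of "adj w * (w - y)" UNIV] by auto
  have eq: "1 - adj w * (w - y) = adj w * y" using iso by (simp add: algebra_simps)
  have "(k * adj w) * y = 1" using k(2) eq by (simp add: mult.assoc)
  then obtain s where s: "y * s = 1" using left_invertible_imp_right_invertible[OF D] by blast
  have "s = k * adj w" proof -
    have "k * adj w = (k * adj w) * (y * s)" using s by simp
    also have "\<dots> = ((k * adj w) * y) * s" by (simp only: mult.assoc)
    finally show ?thesis using \<open>(k * adj w) * y = 1\<close> by simp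
  qed
  hence left: "(y * k) * adj w = 1" using s by (simp add: mult.assoc)
  \<comment> \<open>The left inverse y * k of adj w agrees with its right inverse w.\<close>
  have "y * k = (y * k) * (adj w * w)" using iso by simp
  also have "\<dots> = ((y * k) * adj w) * w" by (simp only: mult.assoc)
  finally have "y * k = w" using left by simp
  with left show ?thesis by simp
qed

section \<open>Paths of unitaries\<close>

text \<open>
  The defect \<open>h = 1 - y\<^sup>* y\<close> becomes \<open>1 - (1 + h/2)\<^sup>2 (1 - h)\<close>, which is of second order in \<open>h\<close>.
\<close>

lemma newton_step_identity:
  fixes y :: cop
  defines "h \<equiv> 1 - adj y * y"
  shows "1 - adj (y * (1 + (1/2) *\<^sub>R h)) * (y * (1 + (1/2) *\<^sub>R h)) = (3/4) *\<^sub>R (h * h) + (1/4) *\<^sub>R (h * h * h)"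
proof -
  have adj_scaleR: "adj (r *\<^sub>R x) = r *\<^sub>R adj x" for r x
  proof -
    have "adj (r *\<^sub>R x) = adj (scal (of_real r) * x)" by (simp add: scal_of_real)
    also have "\<dots> = adj x * scal (of_real r)" by (simp add: adj_mult adj_scal)
    finally show ?thesis by (simp add: scal_of_real)
  qed
  have "adj h = h" by (simp add: h_def adj_diff adj_mult)
  hence "adj (y * (1 + (1/2) *\<^sub>R h)) = (1 + (1/2) *\<^sub>R h) * adj y"
    by (simp add: adj_mult adj_add adj_scaleR)
  hence "adj (y * (1 + (1/2) *\<^sub>R h)) * (y * (1 + (1/2) *\<^sub>R h)) =
      (1 + (1/2) *\<^sub>R h) * (adj y * y) * (1 + (1/2) *\<^sub>R h)" by (simp only: mult.assoc)
  also have "adj y * y = 1 - h" by (simp add: h_def)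
  also have "1 - (1 + (1/2) *\<^sub>R h) * (1 - h) * (1 + (1/2) *\<^sub>R h) =
      (3/4) *\<^sub>R (h * h) + (1/4) *\<^sub>R (h * h * h)"
  proof -
    have half: "x - (1/2) *\<^sub>R x = (1/2) *\<^sub>R x" for x :: cop
      using scaleR_left_diff_distrib[of 1 "1/2" x] by simp
    have quarter: "(1/4) *\<^sub>R x + (1/2) *\<^sub>R x = (3/4) *\<^sub>R x" for x :: cop
      by (simp flip: scaleR_left_distrib)
    have "(1 + (1/2) *\<^sub>R h) * (1 - h) = 1 - (h - (1/2) *\<^sub>R h) - (1/2) *\<^sub>R (h * h)"
      by (simp add: distrib_right right_diff_distrib)
    also have "\<dots> = 1 - (1/2) *\<^sub>R h - (1/2) *\<^sub>R (h * h)" by (simp only: half)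
    finally have "(1 + (1/2) *\<^sub>R h) * (1 - h) * (1 + (1/2) *\<^sub>R h) =
        (1 - (1/2) *\<^sub>R h - (1/2) *\<^sub>R (h * h)) + (1 - (1/2) *\<^sub>R h - (1/2) *\<^sub>R (h * h)) * ((1/2) *\<^sub>R h)"
      by (simp only: distrib_left mult.right_neutral)
    also have "\<dots> = 1 - ((1/4) *\<^sub>R (h * h) + (1/2) *\<^sub>R (h * h)) - (1/4) *\<^sub>R (h * h * h)"
      by (simp add: left_diff_distrib scaleR_right_diff_distrib)
    also have "\<dots> = 1 - (3/4) *\<^sub>R (h * h) - (1/4) *\<^sub>R (h * h * h)" by (simp only: quarter)
    finally show ?thesis by simp
  qed
  finally show ?thesis .
qed

text \<open>
  Newton's iteration for the unitary part of the polar decomposition. It stays inside every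
  *-algebra that contains the starting point and replaces the inverse square root of \<open>y\<^sup>* y\<close>.
\<close>

fun newton_iterate :: "cop \<Rightarrow> nat \<Rightarrow> cop" where
  "newton_iterate y 0 = y"
| "newton_iterate y (Suc n) = (let z = newton_iterate y n in z * (1 + (1/2) *\<^sub>R (1 - adj z * z)))"

lemma continuous_adj: "X \<longlonglongrightarrow> x \<Longrightarrow> (\<lambda>n. adj (X n)) \<longlonglongrightarrow> adj x"
  unfolding LIMSEQ_iff by (simp flip: adj_diff)

text \<open>
  Once the defect is at most \<open>1/2\<close> it is at least halved in each step, so the iterates converge
  geometrically and the limit has no defect.
\<close>

lemma nearby_isometry:
  assumes D: "star_subalgebra D" "closed D" "y \<in> D" and small: "norm (1 - adj y * y) \<le> 1/2"
  obtains w where "w \<in> D" "adj w * w = 1" "norm (w - y) \<le> 2 * norm (1 - adj y * y)"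
proof -
  let ?Y = "newton_iterate y"
  define H where "H n = 1 - adj (?Y n) * ?Y n" for n
  define \<eta> where "\<eta> = norm (1 - adj y * y)"
  have \<eta>: "0 \<le> \<eta>" "\<eta> \<le> 1/2" using small by (auto simp: \<eta>_def)
  have step: "?Y (Suc n) = ?Y n * (1 + (1/2) *\<^sub>R H n)" for n by (simp add: Let_def H_def)
  have mem: "?Y n \<in> D" for n
    by (induction n) (auto simp: Let_def intro!: D star_subalgebraD[OF D(1)])
  have Hle: "norm (H n) \<le> \<eta> * (1/2)^n" for n
  proof (induction n)
    case (Suc n)
    let ?a = "norm (H n)"
    have le: "\<eta> * (1/2)^n \<le> 1/2" using \<eta> mult_mono[of \<eta> "1/2" "(1/2)^n" 1] by (simp add: power_le_one)
    hence a: "?a \<le> 1/2" using Suc by linarith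
    have "H (Suc n) = (3/4) *\<^sub>R (H n * H n) + (1/4) *\<^sub>R (H n * H n * H n)"
      using newton_step_identity[of "?Y n"] unfolding H_def step by simp
    also have "norm \<dots> \<le> 3/4 * norm (H n * H n) + 1/4 * norm (H n * H n * H n)"
      by (rule order_trans[OF norm_triangle_ineq]) simp
    also have "\<dots> \<le> 3/4 * (?a * ?a) + 1/4 * ((?a * ?a) * ?a)"
      by (intro add_mono mult_left_mono order_trans[OF norm_mult_ineq mult_right_mono] norm_mult_ineq) auto
    also have "\<dots> \<le> 3/4 * (?a * ?a) + 1/4 * ((?a * ?a) * 1)"
      using a by (intro add_mono mult_left_mono) auto
    also have "\<dots> = ?a * ?a" by simp
    also have "\<dots> \<le> ?a * (1/2)" using a by (intro mult_left_mono) auto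
    also have "\<dots> \<le> (\<eta> * (1/2)^n) * (1/2)" using Suc by (intro mult_right_mono) auto
    finally show ?case by simp
  qed (simp add: H_def \<eta>_def)
  have H_half: "norm (H n) \<le> 1/2" for n
    using Hle[of n] \<eta> mult_mono[of \<eta> "1/2" "(1/2)^n" 1] by (simp add: power_le_one)
  have Yle: "norm (?Y n) \<le> 2" for n
  proof (rule power2_le_imp_le)
    have "(norm (?Y n))\<^sup>2 = norm (1 - H n)" by (simp add: norm_adj_mult H_def)
    also have "\<dots> \<le> norm (1::cop) + norm (H n)" by (rule norm_triangle_ineq4)
    also have "\<dots> \<le> 2\<^sup>2" using H_half[of n] by simp
    finally show "(norm (?Y n))\<^sup>2 \<le> 2\<^sup>2" .
  qed simp
  define d where "d n = ?Y (Suc n) - ?Y n" for n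
  have dle: "norm (d n) \<le> \<eta> * (1/2)^n" for n
  proof -
    have "d n = (1/2) *\<^sub>R (?Y n * H n)" unfolding d_def step by (simp add: distrib_left)
    hence "norm (d n) = 1/2 * norm (?Y n * H n)" by simp
    also have "\<dots> \<le> 1/2 * (2 * norm (H n))"
      by (intro mult_left_mono order_trans[OF norm_mult_ineq mult_right_mono[OF Yle]]) auto
    finally show ?thesis using Hle[of n] by simp
  qed
  have smg: "summable (\<lambda>n. \<eta> * (1/2)^n)" by (intro summable_mult summable_geometric) simp
  have smd: "summable d" by (rule summable_comparison_test'[OF smg]) (use dle in auto)
  have Y_eq: "?Y n = y + (\<Sum>i<n. d i)" for n
    by (induction n) (simp_all add: d_def del: newton_iterate.simps(2))
  define w where "w = y + suminf d"
  have lim: "?Y \<longlonglongrightarrow> w"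
    unfolding w_def Y_eq[abs_def] by (intro tendsto_intros summable_LIMSEQ smd)
  have "w \<in> D" by (rule closed_sequentially[OF D(2) mem lim])
  moreover have "norm (w - y) \<le> 2 * norm (1 - adj y * y)"
  proof -
    have "norm (w - y) \<le> suminf (\<lambda>n. \<eta> * (1/2)^n)"
      unfolding w_def using norm_suminf_le[OF dle smg] by simp
    also have "\<dots> = 2 * \<eta>" by (subst suminf_mult) (auto simp: suminf_geometric intro: summable_geometric)
    finally show ?thesis by (simp add: \<eta>_def)
  qed
  moreover have "adj w * w = 1"
  proof -
    have "H \<longlonglongrightarrow> 1 - adj w * w"
      unfolding H_def[abs_def] by (intro tendsto_intros continuous_adj lim)
    moreover have "H \<longlonglongrightarrow> 0"
    proof (rule Lim_null_comparison[OF always_eventually])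
      show "\<forall>n. norm (H n) \<le> \<eta> * (1/2)^n" using Hle by blast
      show "(\<lambda>n. \<eta> * (1/2)^n) \<longlonglongrightarrow> 0" by (intro tendsto_mult_right_zero LIMSEQ_realpow_zero) auto
    qed
    ultimately show ?thesis using LIMSEQ_unique by fastforce
  qed
  ultimately show ?thesis using that by blast
qed

definition unitary_path :: "cop set \<Rightarrow> cop \<Rightarrow> cop \<Rightarrow> (real \<Rightarrow> cop) \<Rightarrow> bool" where
  "unitary_path A u v \<gamma> \<longleftrightarrow> \<gamma> 0 = u \<and> \<gamma> 1 = v \<and> continuous_on {0..1} \<gamma> \<and>
     (\<forall>t\<in>{0..1}. \<gamma> t \<in> A \<and> unitary_op (\<gamma> t))"

lemma unitary_op_mult: "unitary_op u \<Longrightarrow> unitary_op v \<Longrightarrow> unitary_op (u * v)"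
proof -
  assume u: "unitary_op u" and v: "unitary_op v"
  have "adj (u * v) * (u * v) = adj v * ((adj u * u) * v)" by (simp only: adj_mult mult.assoc)
  moreover have "(u * v) * adj (u * v) = u * ((v * adj v) * adj u)" by (simp only: adj_mult mult.assoc)
  ultimately show ?thesis using u v by (simp add: unitary_op_def)
qed

lemma unitary_op_norm: "unitary_op u \<Longrightarrow> norm u = 1"
  by (rule norm_isometry_le) (simp add: unitary_op_def)

lemma unitary_path_mult:
  assumes "star_subalgebra A" "unitary_path A u v \<gamma>" "unitary_path A u' v' \<gamma>'"
  shows "unitary_path A (u * u') (v * v') (\<lambda>t. \<gamma> t * \<gamma>' t)"
  using assms by (auto simp: unitary_path_def intro!: continuous_on_mult unitary_op_mult star_subalgebraD(4))

lemma unitary_path_reverse: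
  assumes "unitary_path A u v \<gamma>"
  shows "unitary_path A v u (\<lambda>t. \<gamma> (1 - t))"
proof -
  have "continuous_on {0..1} (\<lambda>t. \<gamma> (1 - t))"
    by (rule continuous_on_compose2[of "{0..1}" \<gamma>])
      (use assms in \<open>auto simp: unitary_path_def intro!: continuous_intros\<close>)
  thus ?thesis using assms by (auto simp: unitary_path_def)
qed

lemma unitary_op_scal: "norm c = 1 \<Longrightarrow> unitary_op (scal c)"
  by (simp add: unitary_op_def adj_scal complex_norm_square[symmetric] mult.commute[of "cnj c"] flip: scal_mult)

text \<open>
  The path is \<open>((1 - t) + (1 + t) u) ((1 + t) + (1 - t) u)\<^sup>-\<^sup>1\<close>, the Cayley transform of a
  rescaled inverse Cayley transform of \<open>u\<close>. For \<open>t > 0\<close> the denominator is invertible because \<open>u\<close> has norm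
  \<open>1\<close>; only at \<open>t = 0\<close> is the invertibility of \<open>1 + u\<close> needed.
\<close>

lemma cayley_path:
  assumes A: "star_subalgebra A" "closed A" and u: "u \<in> A" "unitary_op u"
    and g: "g \<in> A" "(1 + u) * g = 1" "g * (1 + u) = 1"
  obtains \<gamma> where "unitary_path A 1 u \<gamma>"
proof -
  note mem = star_subalgebraD[OF A(1)]
  have uu: "adj u * u = 1" "u * adj u = 1" using u(2) by (auto simp: unitary_op_def)
  define P where "P t = (1 + t) *\<^sub>R 1 + (1 - t) *\<^sub>R u" for t
  define C where "C t = (1 - t) *\<^sub>R 1 + (1 + t) *\<^sub>R u" for t
  have "\<exists>r\<in>A. P t * r = 1 \<and> r * P t = 1" if t: "t \<in> {0..1}" for t
  proof (cases "t = 0")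
    case True
    with g show ?thesis by (auto simp: P_def)
  next
    case False
    with t have t: "t > 0" "t \<le> 1" by auto
    define x where "x = (- ((1 - t) / (1 + t))) *\<^sub>R u"
    have "norm x < 1" using t unitary_op_norm[OF u(2)] by (simp add: x_def)
    moreover have "x \<in> A" unfolding x_def by (intro mem u)
    ultimately have x1: "norm x < 1" and xA: "x \<in> A" by auto
    obtain k where k: "k \<in> A" "(1 - x) * k = 1" "k * (1 - x) = 1"
      using neumann_inverse[OF x1 A(2) mem(2,1) star_subalgebra_power[OF A(1) xA]] .
    have "P t = (1 + t) *\<^sub>R (1 - x)" using t by (simp add: P_def x_def scaleR_right_distrib)
    with k t show ?thesis by (intro bexI[of _ "(1 / (1 + t)) *\<^sub>R k"]) (auto intro: mem)
  qed
  then obtain r where r: "\<And>t. t \<in> {0..1} \<Longrightarrow> r t \<in> A" "\<And>t. t \<in> {0..1} \<Longrightarrow> P t * r t = 1"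
    "\<And>t. t \<in> {0..1} \<Longrightarrow> r t * P t = 1" by metis
  define \<gamma> where "\<gamma> t = C t * r t" for t
  have adjP: "adj (P t) = (1 + t) *\<^sub>R 1 + (1 - t) *\<^sub>R adj u" for t
    by (rule adj_eqI) (simp add: P_def inner_add inner_adj)
  have adjC: "adj (C t) = (1 - t) *\<^sub>R 1 + (1 + t) *\<^sub>R adj u" for t
    by (rule adj_eqI) (simp add: C_def inner_add inner_adj)
  have expand: "(p *\<^sub>R 1 + q *\<^sub>R adj u) * (p *\<^sub>R 1 + q *\<^sub>R u) = (p*p + q*q) *\<^sub>R 1 + (p*q) *\<^sub>R (u + adj u)"
    "(p *\<^sub>R 1 + q *\<^sub>R u) * (p *\<^sub>R 1 + q *\<^sub>R adj u) = (p*p + q*q) *\<^sub>R 1 + (p*q) *\<^sub>R (u + adj u)" for p q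
    by (simp_all add: distrib_left distrib_right uu scaleR_right_distrib scaleR_left_distrib ac_simps)
  have PP: "adj (P t) * P t = adj (C t) * C t" "P t * adj (P t) = C t * adj (C t)" for t
    unfolding adjP adjC unfolding P_def C_def expand by (simp_all add: ac_simps)
  \<comment> \<open>Numerator and denominator commute and have the same absolute value, so their
    quotient is unitary.\<close>
  have PC: "P t * C t = C t * P t" for t
    unfolding P_def C_def by (simp add: distrib_left distrib_right algebra_simps)
  have un: "unitary_op (\<gamma> t)" if t: "t \<in> {0..1}" for t
  proof -
    have adjr: "adj (r t) * adj (P t) = 1" "adj (P t) * adj (r t) = 1"
      using r(2,3)[OF t] by (metis adj_mult adj_one)+
    have Cr: "C t * r t = r t * C t"
    proof -
      have "C t * r t = (r t * P t) * (C t * r t)" using r(3)[OF t] by simp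
      also have "\<dots> = r t * (P t * C t) * r t" by (simp only: mult.assoc)
      also have "\<dots> = (r t * C t) * (P t * r t)" by (simp only: PC mult.assoc)
      finally show ?thesis using r(2)[OF t] by simp
    qed
    have "adj (\<gamma> t) * \<gamma> t = adj (r t) * (adj (C t) * C t) * r t"
      by (simp only: \<gamma>_def adj_mult mult.assoc)
    also have "\<dots> = (adj (r t) * adj (P t)) * (P t * r t)" by (simp only: PP(1)[symmetric] mult.assoc)
    finally have 1: "adj (\<gamma> t) * \<gamma> t = 1" using adjr r(2)[OF t] by simp
    have "\<gamma> t * adj (\<gamma> t) = r t * (C t * adj (C t)) * adj (r t)"
      by (simp only: \<gamma>_def Cr adj_mult mult.assoc)
    also have "\<dots> = (r t * P t) * (adj (P t) * adj (r t))" by (simp only: PP(2)[symmetric] mult.assoc)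
    finally have "\<gamma> t * adj (\<gamma> t) = 1" using adjr r(3)[OF t] by simp
    with 1 show ?thesis by (simp add: unitary_op_def)
  qed
  \<comment> \<open>A uniform bound on the inverse of the denominator: P t + C t is 2 (1 + u), so r t is
    g (1 + \<gamma> t) / 2.\<close>
  have rle: "norm (r t) \<le> norm g" if t: "t \<in> {0..1}" for t
  proof -
    have "P t + C t = 2 *\<^sub>R (1 + u)" by (simp add: P_def C_def algebra_simps scaleR_2)
    hence "P t * r t + C t * r t = (2 *\<^sub>R (1 + u)) * r t" by (simp only: distrib_right[symmetric])
    hence "1 + \<gamma> t = (2 *\<^sub>R (1 + u)) * r t" using r(2)[OF t] by (simp only: \<gamma>_def)
    hence "g * (1 + \<gamma> t) = 2 *\<^sub>R ((g * (1 + u)) * r t)" by (simp add: mult.assoc)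
    hence "r t = (1/2) *\<^sub>R (g * (1 + \<gamma> t))" using g(3) by simp
    hence "norm (r t) \<le> 1/2 * (norm g * norm (1 + \<gamma> t))" by (simp add: norm_mult_ineq)
    also have "\<dots> \<le> 1/2 * (norm g * 2)"
      using norm_triangle_ineq[of 1 "\<gamma> t"] unitary_op_norm[OF un[OF t]] by (intro mult_left_mono) auto
    finally show ?thesis by simp
  qed
  have "continuous_on {0..1} r"
  proof (rule lipschitz_on_continuous_on[of "norm g * 2 * norm g"], rule lipschitz_onI)
    fix s t :: real assume st: "s \<in> {0..1}" "t \<in> {0..1}"
    have "r s - r t = r s * (P t * r t) - (r s * P s) * r t" using r st by simp
    also have "\<dots> = r s * (P t - P s) * r t" by (simp only: left_diff_distrib right_diff_distrib mult.assoc)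
    also have "P t - P s = (t - s) *\<^sub>R (1 - u)" by (simp add: P_def algebra_simps)
    finally have eq: "r s - r t = r s * ((t - s) *\<^sub>R (1 - u)) * r t" .
    have "norm (r s - r t) \<le> norm (r s * ((t - s) *\<^sub>R (1 - u))) * norm (r t)"
      unfolding eq by (rule norm_mult_ineq)
    also have "\<dots> \<le> (norm (r s) * norm ((t - s) *\<^sub>R (1 - u))) * norm (r t)"
      by (intro mult_right_mono norm_mult_ineq) simp
    also have "\<dots> \<le> (norm g * (\<bar>t - s\<bar> * 2)) * norm g"
      using rle st norm_triangle_ineq4[of 1 u] unitary_op_norm[OF u(2)]
      by (intro mult_mono) (auto intro!: mult_nonneg_nonneg mult_left_mono)
    finally show "dist (r s) (r t) \<le> norm g * 2 * norm g * dist s t"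
      by (simp add: dist_norm abs_minus_commute mult_ac)
  qed simp
  hence "continuous_on {0..1} \<gamma>" unfolding \<gamma>_def C_def by (intro continuous_intros)
  moreover have "\<gamma> 0 = 1" using r(2)[of 0] by (simp add: \<gamma>_def P_def C_def)
  moreover have "\<gamma> 1 = u"
  proof -
    have "\<gamma> 1 = u * (P 1 * r 1)" by (simp add: \<gamma>_def P_def C_def)
    thus ?thesis using r(2)[of 1] by simp
  qed
  moreover have "\<gamma> t \<in> A" if "t \<in> {0..1}" for t
    unfolding \<gamma>_def C_def by (intro mem u r that)
  ultimately have "unitary_path A 1 u \<gamma>" using un unfolding unitary_path_def by blast
  thus ?thesis by (rule that)
qed

lemma unit_circle_non_root:
  fixes p :: "complex poly"
  assumes "p \<noteq> 0"
  obtains \<theta> :: real where "poly p (- cis \<theta>) \<noteq> 0"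
proof -
  have inj: "inj_on (\<lambda>\<theta>. - cis \<theta>) {0..1}"
  proof (rule inj_onI)
    fix a b :: real assume ab: "a \<in> {0..1}" "b \<in> {0..1}" and "- cis a = - cis b"
    hence "cos a = cos b" by (simp add: complex_eq_iff)
    moreover have "1 \<le> pi" using pi_ge_two by simp
    ultimately show "a = b" using ab cos_inj_pi[of a b] by auto
  qed
  have "infinite ((\<lambda>\<theta>::real. - cis \<theta>) ` {0..1})" using inj by (simp add: finite_image_iff infinite_Icc)
  hence "\<not> (\<lambda>\<theta>::real. - cis \<theta>) ` {0..1} \<subseteq> {z. poly p z = 0}"
    using poly_roots_finite[OF assms] finite_subset by blast
  thus ?thesis using that by blast
qed

text \<open>
  With \<open>w\<close> a unitary of a finite-dimensional *-subalgebra near \<open>u\<close>, the factorization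
  \<open>u = (u w\<^sup>*) \<lambda> (\<lambda>\<^sup>-\<^sup>1 w)\<close> has three factors that contract to \<open>1\<close>: the first is close to \<open>1\<close>, the second is a
  scalar of modulus \<open>1\<close>, and \<open>\<lambda>\<close> is chosen such that \<open>-\<lambda>\<close> is not in the finite spectrum of \<open>w\<close>.
\<close>

theorem AF_unitary_connected:
  assumes AF: "AF_algebra A" and u: "u \<in> A" "unitary_op u"
  obtains \<gamma> where "unitary_path A 1 u \<gamma>"
proof -
  have A: "star_subalgebra A" "closed A" using AF by (auto simp: AF_algebra_def)
  note memA = star_subalgebraD[OF A(1)]
  have uu: "adj u * u = 1" "u * adj u = 1" using u(2) by (auto simp: unitary_op_def)
  \<comment> \<open>The constant makes the defect of y at most 21/100, hence w within 42/100 of y and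
    within 1 of u.\<close>
  obtain D y where D: "star_subalgebra D" "finite_dim D" "D \<subseteq> A" "y \<in> D" and uy: "norm (u - y) < 1/10"
  proof -
    have "(1/10 :: real) > 0" by simp
    with AF u(1) show ?thesis using that unfolding AF_algebra_def by blast
  qed
  note memD = star_subalgebraD[OF D(1)]
  have clD: "closed D" using finite_dim_closed D memD(2) by blast
  have nu: "norm u = 1" by (rule unitary_op_norm[OF u(2)])
  have ny: "norm y \<le> 11/10" using norm_triangle_ineq4[of u "u - y"] nu uy by simp
  have "1 - adj y * y = adj u * (u - y) + adj (u - y) * y"
    using uu by (simp add: adj_diff algebra_simps)
  hence "norm (1 - adj y * y) \<le> norm (adj u * (u - y)) + norm (adj (u - y) * y)"
    by (simp add: norm_triangle_ineq)
  also have "\<dots> \<le> norm (adj u) * norm (u - y) + norm (adj (u - y)) * norm y"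
    by (intro add_mono norm_mult_ineq)
  also have "\<dots> \<le> 1/10 + 1/10 * (11/10)"
    using nu uy ny by (intro add_mono mult_mono) auto
  finally have small: "norm (1 - adj y * y) \<le> 21/100" by simp
  hence half: "norm (1 - adj y * y) \<le> 1/2" by linarith
  obtain w where w: "w \<in> D" "adj w * w = 1" "norm (w - y) \<le> 2 * norm (1 - adj y * y)"
    using nearby_isometry[OF D(1) clD D(4) half] .
  have wA: "w \<in> A" using w D by blast
  have "w * adj w = 1" by (rule AF_isometry_unitary[OF AF wA w(2)])
  with w(2) have uw: "unitary_op w" by (simp add: unitary_op_def)
  have uw': "unitary_op (adj w)" using uw by (simp add: unitary_op_def)
  have "norm (u - w) \<le> norm (u - y) + norm (w - y)" using norm_triangle_ineq4[of "u - y" "w - y"] by simp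
  hence near: "norm (u - w) < 1" using uy w(3) small by linarith
  define v where "v = u * adj w"
  have v: "v \<in> A" "unitary_op v" unfolding v_def using u wA uw' by (auto intro: memA unitary_op_mult)
  have vw: "v * w = u" unfolding v_def using w(2) by (simp add: mult.assoc)
  obtain \<gamma>1 where \<gamma>1: "unitary_path A 1 v \<gamma>1"
  proof -
    define x where "x = (1/2) *\<^sub>R (1 - v)"
    have "1 - v = (w - u) * adj w" using \<open>w * adj w = 1\<close> by (simp add: v_def left_diff_distrib)
    hence "norm (1 - v) \<le> norm (w - u) * norm (adj w)" by (simp only: norm_mult_ineq)
    hence "norm x < 1" using near unitary_op_norm[OF uw] by (simp add: x_def norm_minus_commute)
    moreover have "x \<in> A" unfolding x_def by (intro memA v)
    ultimately have x1: "norm x < 1" and xA: "x \<in> A" by auto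
    obtain k where k: "k \<in> A" "(1 - x) * k = 1" "k * (1 - x) = 1"
      using neumann_inverse[OF x1 A(2) memA(2,1) star_subalgebra_power[OF A(1) xA]] .
    have "1 + v = 2 *\<^sub>R (1 - x)" by (simp add: x_def scaleR_right_diff_distrib scaleR_2)
    with k have "(1 + v) * ((1/2) *\<^sub>R k) = 1" "((1/2) *\<^sub>R k) * (1 + v) = 1" "(1/2) *\<^sub>R k \<in> A"
      by (auto intro: memA)
    from cayley_path[OF A v this(3,1,2)] show ?thesis using that .
  qed
  obtain p where p: "p \<noteq> 0" "eval_poly w p = 0" using finite_dim_algebraic[OF D(1,2) w(1)] .
  obtain \<theta> where \<theta>: "poly p (- cis \<theta>) \<noteq> 0" using unit_circle_non_root[OF p(1)] .
  obtain s where s: "s \<in> D" "(w - scal (- cis \<theta>)) * s = 1" "s * (w - scal (- cis \<theta>)) = 1"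
    using invertible_off_roots[OF D(1) w(1) p(2) \<theta>] .
  define x where "x = scal (cis (- \<theta>)) * w"
  have x: "x \<in> A" "unitary_op x" unfolding x_def
    by (intro memA wA) (intro unitary_op_mult unitary_op_scal uw, simp)
  have cc: "scal (cis \<theta>) * scal (cis (- \<theta>)) = 1" "scal (cis (- \<theta>)) * scal (cis \<theta>) = 1"
    by (simp_all add: cis_mult flip: scal_mult)
  have xw: "scal (cis \<theta>) * x = w" unfolding x_def using cc by (simp flip: mult.assoc)
  obtain \<gamma>2 where \<gamma>2: "unitary_path A 1 x \<gamma>2"
  proof (rule cayley_path[OF A x])
    have eq: "1 + x = scal (cis (- \<theta>)) * (w - scal (- cis \<theta>))"
      using cc by (simp add: x_def distrib_left scal_minus)
    show "scal (cis \<theta>) * s \<in> A" using s(1) D(3) by (auto intro: memA)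
    have "(1 + x) * (scal (cis \<theta>) * s) = (1 + x) * (s * scal (cis \<theta>))" by (simp only: scal_central[of s])
    also have "\<dots> = scal (cis (- \<theta>)) * (((w - scal (- cis \<theta>)) * s) * scal (cis \<theta>))" by (simp only: eq mult.assoc)
    finally show "(1 + x) * (scal (cis \<theta>) * s) = 1" using s(2) cc by simp
    have "(scal (cis \<theta>) * s) * (1 + x) = (s * scal (cis \<theta>)) * (1 + x)" by (simp only: scal_central[of s])
    also have "\<dots> = s * ((scal (cis \<theta>) * scal (cis (- \<theta>))) * (w - scal (- cis \<theta>)))" by (simp only: eq mult.assoc)
    finally show "(scal (cis \<theta>) * s) * (1 + x) = 1" using s(3) cc by simp
  qed
  have rot: "unitary_path A 1 (scal (cis \<theta>)) (\<lambda>t. scal (cis (t * \<theta>)))"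
  proof -
    have "continuous_on UNIV scal"
      by (rule lipschitz_on_continuous_on[of 1], rule lipschitz_onI)
        (auto simp: dist_norm simp flip: scal_diff)
    hence "continuous_on {0..1} (\<lambda>t. scal (cis (t * \<theta>)))"
      by (rule continuous_on_compose2) (auto intro!: continuous_intros)
    thus ?thesis by (auto simp: unitary_path_def intro: memA unitary_op_scal)
  qed
  have "unitary_path A (1 * (1 * 1)) (v * (scal (cis \<theta>) * x)) (\<lambda>t. \<gamma>1 t * (scal (cis (t * \<theta>)) * \<gamma>2 t))"
    by (intro unitary_path_mult A \<gamma>1 \<gamma>2 rot)
  thus ?thesis using that by (simp add: xw vw)
qed

corollary AF_unitaries_path_connected:
  assumes AF: "AF_algebra A" and "u \<in> A" "unitary_op u" "v \<in> A" "unitary_op v"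
  obtains \<gamma> where "unitary_path A u v \<gamma>"
proof -
  obtain \<gamma>1 where 1: "unitary_path A 1 u \<gamma>1" using AF_unitary_connected[OF AF assms(2,3)] .
  obtain \<gamma>2 where 2: "unitary_path A 1 v \<gamma>2" using AF_unitary_connected[OF AF assms(4,5)] .
  have "star_subalgebra A" using AF by (simp add: AF_algebra_def)
  from unitary_path_mult[OF this unitary_path_reverse[OF 1] 2] show ?thesis using that by simp
qed

section \<open>AF algebras from systems of partial isometries\<close>

definition cspan :: "cop set \<Rightarrow> cop set" where
  "cspan G = span (G \<union> (\<lambda>g. scal \<i> * g) ` G)"

lemma cspan_base: "g \<in> G \<Longrightarrow> g \<in> cspan G"
  by (simp add: cspan_def span_base)

lemma cspan_subspace: "subspace (cspan G)"
  by (simp add: cspan_def)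

lemma cspan_mono: "G \<subseteq> H \<Longrightarrow> cspan G \<subseteq> cspan H"
  unfolding cspan_def by (intro span_mono) auto

lemma cspan_i: "x \<in> cspan G \<Longrightarrow> scal \<i> * x \<in> cspan G"
  unfolding cspan_def
proof (induction rule: span_induct_alt)
  case (step c x y)
  have ii: "scal \<i> * (scal \<i> * g) = - g" for g
    by (simp add: scal_minus flip: mult.assoc scal_mult)
  have "scal \<i> * x \<in> span (G \<union> (\<lambda>g. scal \<i> * g) ` G)"
    using step(1)
  proof
    assume "x \<in> (\<lambda>g. scal \<i> * g) ` G"
    then obtain g where "g \<in> G" "scal \<i> * x = - g" using ii by auto
    thus ?thesis by (auto intro: span_base span_neg)
  qed (auto intro: span_base)
  thus ?case using step(2) by (auto simp: distrib_left intro: span_add span_scale)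
qed (simp add: span_zero)

text \<open>
  Reduces complex multiples to real multiples and multiplication by the imaginary unit, so that
  real spans suffice.
\<close>

lemma scal_decompose: "scal c * x = Re c *\<^sub>R x + Im c *\<^sub>R (scal \<i> * x)"
proof -
  have "scal c = scal (of_real (Re c) + of_real (Im c) * \<i>)"
    by (rule arg_cong[of _ _ scal]) (simp add: complex_eq_iff)
  hence "scal c * x = (scal (of_real (Re c)) + scal (of_real (Im c)) * scal \<i>) * x"
    by (simp only: scal_add scal_mult)
  also have "\<dots> = Re c *\<^sub>R x + Im c *\<^sub>R (scal \<i> * x)"
    by (simp add: scal_of_real distrib_right)
  finally show ?thesis .
qed

lemma cspan_scal: "x \<in> cspan G \<Longrightarrow> scal c * x \<in> cspan G"
  using cspan_i[of x G] cspan_subspace[of G]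
  by (auto simp: scal_decompose[of c] intro: subspace_add subspace_scale)

lemma cspan_induct [consumes 1, case_names zero add scale base]:
  assumes "x \<in> cspan G" "P 0" "\<And>x y. P x \<Longrightarrow> P y \<Longrightarrow> P (x + y)" "\<And>c x. P x \<Longrightarrow> P (scal c * x)"
    "\<And>g. g \<in> G \<Longrightarrow> P g"
  shows "P x"
  using assms(1) unfolding cspan_def
proof (induction rule: span_induct_alt)
  case (step c x y)
  have "P x" using step(1) assms(4,5) by auto
  hence "P (scal (of_real c) * x)" by (rule assms(4))
  hence "P (c *\<^sub>R x)" by (simp add: scal_of_real)
  thus ?case using step(2) by (rule assms(3))
qed (rule assms(2))

lemma star_subalgebra_cspan:
  assumes "1 \<in> G" "\<And>g h. g \<in> G \<Longrightarrow> h \<in> G \<Longrightarrow> g * h \<in> insert 0 G" "\<And>g. g \<in> G \<Longrightarrow> adj g \<in> G"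
  shows "star_subalgebra (cspan G)"
proof -
  note sub = subspace_0[OF cspan_subspace[of G]] subspace_add[OF cspan_subspace[of G]]
  have "x * y \<in> cspan G" if "x \<in> cspan G" "y \<in> cspan G" for x y
    using that(1)
  proof (induction rule: cspan_induct)
    case (base g)
    from that(2) show ?case
    proof (induction rule: cspan_induct)
      case (base h)
      thus ?case using assms(2)[OF \<open>g \<in> G\<close> base] sub(1) by (auto intro: cspan_base)
    next
      case (scale c x)
      have "g * (scal c * x) = scal c * (g * x)" by (simp only: mult.assoc[symmetric] scal_central[of g])
      thus ?case using scale by (simp add: cspan_scal)
    qed (auto simp: distrib_left sub)
  qed (auto simp: distrib_right mult.assoc sub cspan_scal)
  moreover have "adj x \<in> cspan G" if "x \<in> cspan G" for x
    using that
  proof (induction rule: cspan_induct)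
    case (scale c x)
    have "adj (scal c * x) = scal (cnj c) * adj x" by (simp only: adj_mult adj_scal scal_central)
    thus ?case using scale by (simp add: cspan_scal)
  qed (auto simp: adj_add sub intro: cspan_base assms(3))
  ultimately show ?thesis
    unfolding star_subalgebra_def using assms(1) by (auto intro: cspan_base cspan_subspace cspan_scal)
qed

lemma finite_dim_cspan: "finite G \<Longrightarrow> finite_dim (cspan G)"
  unfolding finite_dim_def cspan_def by (rule exI[of _ "G \<union> (\<lambda>g. scal \<i> * g) ` G"]) auto

lemma closure_induct2:
  fixes S :: "cop set"
  assumes "\<And>x. x \<in> S \<Longrightarrow> f x \<in> closure T" and "continuous_on UNIV f" and "x \<in> closure S"
  shows "f x \<in> closure T"
proof -
  have "f ` closure S \<subseteq> closure T"
    by (rule image_closure_subset) (use assms continuous_on_subset[OF assms(2)] in auto)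
  thus ?thesis using assms(3) by blast
qed

lemma continuous_on_adj: "continuous_on S adj"
  by (rule lipschitz_on_continuous_on[of 1], rule lipschitz_onI) (auto simp: dist_norm simp flip: adj_diff)

lemma subspace_closure: "subspace S \<Longrightarrow> subspace (closure (S :: cop set))"
proof (rule subspaceI)
  assume S: "subspace S"
  show "0 \<in> closure S" by (rule subsetD[OF closure_subset subspace_0[OF S]])
  have 1: "x + y \<in> closure S" if "x \<in> S" "y \<in> closure S" for x y
    by (rule closure_induct2[OF _ _ that(2)])
      (auto intro!: continuous_intros subsetD[OF closure_subset] subspace_add[OF S] that(1))
  show "x + y \<in> closure S" if "x \<in> closure S" "y \<in> closure S" for x y
    using closure_induct2[OF _ _ that(1), of "\<lambda>x. x + y" "S"] 1 that(2) by (simp add: continuous_intros)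
  show "c *\<^sub>R x \<in> closure S" if "x \<in> closure S" for c x
    by (rule closure_induct2[OF _ _ that])
      (auto intro!: continuous_intros subsetD[OF closure_subset] subspace_scale[OF S])
qed

lemma star_subalgebra_closure:
  assumes S: "star_subalgebra S"
  shows "star_subalgebra (closure S)"
proof -
  note mem = star_subalgebraD[OF S]
  have cl: "x \<in> closure S" if "x \<in> S" for x using that by (rule subsetD[OF closure_subset])
  have 1: "x * y \<in> closure S" if "x \<in> S" "y \<in> closure S" for x y
    by (rule closure_induct2[OF _ _ that(2)]) (auto intro!: continuous_intros cl mem that(1))
  have "x * y \<in> closure S" if "x \<in> closure S" "y \<in> closure S" for x y
    by (rule closure_induct2[OF _ _ that(1), of "\<lambda>x. x * y"]) (auto intro!: continuous_intros 1 that(2))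
  moreover have "scal c * x \<in> closure S" if "x \<in> closure S" for c x
    by (rule closure_induct2[OF _ _ that]) (auto intro!: continuous_intros cl mem)
  moreover have "adj x \<in> closure S" if "x \<in> closure S" for x
    by (rule closure_induct2[OF _ _ that]) (auto intro!: continuous_on_adj cl mem)
  ultimately show ?thesis
    unfolding star_subalgebra_def using cl mem subspace_closure[of S] by auto
qed

text \<open>
  A finite set that is closed under adjoints and, up to zero, under products spans a finite-dimensional
  *-algebra. This is the source of all the AF algebras considered here.
\<close>

lemma AF_algebra_closure_Union:
  assumes G: "\<And>N. finite (G N)" "\<And>N. 1 \<in> G N" "\<And>N g h. g \<in> G N \<Longrightarrow> h \<in> G N \<Longrightarrow> g * h \<in> insert 0 (G N)"
    "\<And>N g. g \<in> G N \<Longrightarrow> adj g \<in> G N" and mono: "\<And>N. G N \<subseteq> G (Suc N)"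
  shows "AF_algebra (closure (\<Union>N::nat. cspan (G N)))"
proof -
  let ?U = "\<Union>N. cspan (G N)"
  have D: "star_subalgebra (cspan (G N))" for N by (rule star_subalgebra_cspan[OF G(2-4)])
  have le: "cspan (G M) \<subseteq> cspan (G N)" if "M \<le> N" for M N
    by (rule cspan_mono) (use lift_Suc_mono_le[of G, OF mono that] in auto)
  have two: "\<exists>N. x \<in> cspan (G N) \<and> y \<in> cspan (G N)" if "x \<in> ?U" "y \<in> ?U" for x y
  proof -
    from that obtain M N where "x \<in> cspan (G M)" "y \<in> cspan (G N)" by auto
    thus ?thesis using le[of M "max M N"] le[of N "max M N"] by (intro exI[of _ "max M N"]) auto
  qed
  have "subspace ?U"
  proof (rule subspaceI)
    show "x + y \<in> ?U" if "x \<in> ?U" "y \<in> ?U" for x y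
      using two[OF that] star_subalgebraD(7)[OF D] by blast
  qed (blast intro: star_subalgebraD(6,9)[OF D])+
  moreover have "x * y \<in> ?U" if "x \<in> ?U" "y \<in> ?U" for x y
    using two[OF that] star_subalgebraD(4)[OF D] by blast
  moreover have "1 \<in> ?U" using star_subalgebraD(1)[OF D] by blast
  moreover have "scal c * x \<in> ?U" if "x \<in> ?U" for c x
    using that star_subalgebraD(3)[OF D] by blast
  moreover have "adj x \<in> ?U" if "x \<in> ?U" for x
    using that star_subalgebraD(5)[OF D] by blast
  ultimately have U: "star_subalgebra ?U"
    unfolding star_subalgebra_def by (intro conjI allI ballI)
  have "\<exists>D. star_subalgebra D \<and> finite_dim D \<and> D \<subseteq> closure ?U \<and> (\<exists>y\<in>D. norm (z - y) < e)"
    if z: "z \<in> closure ?U" and e: "e > 0" for z e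
  proof -
    obtain y where "y \<in> ?U" "dist y z < e" using z e unfolding closure_approachable by blast
    then obtain N where "y \<in> cspan (G N)" "norm (z - y) < e" by (auto simp: dist_norm norm_minus_commute)
    moreover have "cspan (G N) \<subseteq> closure ?U" by (rule order_trans[OF _ closure_subset]) blast
    ultimately show ?thesis using D[of N] finite_dim_cspan[OF G(1), of N]
      by (intro exI[of _ "cspan (G N)"] conjI bexI[of _ y])
  qed
  thus ?thesis unfolding AF_algebra_def using star_subalgebra_closure[OF U] by auto
qed

section \<open>Compact operators\<close>

definition munits :: "nat \<Rightarrow> cop set" where
  "munits N = {munit a b | a b. a < N \<and> b < N}"

definition finite_rank :: "cop set" where
  "finite_rank = (\<Union>N. cspan (munits N))"

definition compact_ops :: "cop set" where
  "compact_ops = closure finite_rank"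

definition compact_plus_scalars :: "cop set" where
  "compact_plus_scalars = {a + scal c | a c. a \<in> compact_ops}"

lemma munits_mono: "M \<le> N \<Longrightarrow> munits M \<subseteq> munits N"
  unfolding munits_def by fastforce

lemma finite_rank_pair:
  assumes "x \<in> finite_rank" "y \<in> finite_rank"
  obtains N where "x \<in> cspan (munits N)" "y \<in> cspan (munits N)"
proof -
  from assms obtain M N where "x \<in> cspan (munits M)" "y \<in> cspan (munits N)" by (auto simp: finite_rank_def)
  thus ?thesis using that[of "max M N"] cspan_mono[OF munits_mono[of M "max M N"]]
      cspan_mono[OF munits_mono[of N "max M N"]] by auto
qed

lemma finite_rank_subspace: "subspace finite_rank"
proof (rule subspaceI)
  show "x + y \<in> finite_rank" if xy: "x \<in> finite_rank" "y \<in> finite_rank" for x y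
  proof -
    from xy obtain N where "x \<in> cspan (munits N)" "y \<in> cspan (munits N)" by (rule finite_rank_pair)
    thus ?thesis unfolding finite_rank_def using subspace_add[OF cspan_subspace] by blast
  qed
qed (auto simp: finite_rank_def intro: subspace_0[OF cspan_subspace] subspace_scale[OF cspan_subspace])

lemma finite_rank_scal: "x \<in> finite_rank \<Longrightarrow> scal c * x \<in> finite_rank"
  by (auto simp: finite_rank_def intro: cspan_scal)

lemma munit_finite_rank: "munit a b \<in> finite_rank"
proof -
  have "munit a b \<in> munits (Suc (max a b))"
    unfolding munits_def by (intro CollectI exI[of _ a] exI[of _ b]) auto
  thus ?thesis unfolding finite_rank_def by (blast intro: cspan_base)
qed

lemma finite_rank_induct [consumes 1, case_names zero add scale munit]:
  assumes "x \<in> finite_rank" "P 0" "\<And>x y. P x \<Longrightarrow> P y \<Longrightarrow> P (x + y)" "\<And>c x. P x \<Longrightarrow> P (scal c * x)"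
    "\<And>a b. P (munit a b)"
  shows "P x"
proof -
  from assms(1) obtain N where "x \<in> cspan (munits N)" by (auto simp: finite_rank_def)
  thus ?thesis by (rule cspan_induct) (use assms(2-) in \<open>auto simp: munits_def\<close>)
qed

lemma finite_rank_mult:
  assumes "x \<in> finite_rank" "y \<in> finite_rank"
  shows "x * y \<in> finite_rank"
  using assms(1)
proof (induction rule: finite_rank_induct)
  case (munit a b)
  from assms(2) show ?case
  proof (induction rule: finite_rank_induct)
    case (scale c x)
    have "munit a b * (scal c * x) = scal c * (munit a b * x)"
      by (simp only: mult.assoc[symmetric] scal_central[of "munit a b"])
    thus ?case using scale by (simp add: finite_rank_scal)
  qed (auto simp: munit_mult distrib_left munit_finite_rank finite_rank_subspace subspace_0 subspace_add)
qed (auto simp: distrib_right mult.assoc finite_rank_scal finite_rank_subspace subspace_0 subspace_add)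

lemma finite_rank_adj: "x \<in> finite_rank \<Longrightarrow> adj x \<in> finite_rank"
proof (induction rule: finite_rank_induct)
  case (scale c x)
  have "adj (scal c * x) = scal (cnj c) * adj x" by (simp only: adj_mult adj_scal scal_central)
  thus ?case using scale by (simp add: finite_rank_scal)
qed (auto simp: adj_add munit_finite_rank finite_rank_subspace subspace_0 subspace_add)

lemma closed_compact_ops: "closed compact_ops"
  by (simp add: compact_ops_def)

lemma finite_rank_compact: "x \<in> finite_rank \<Longrightarrow> x \<in> compact_ops"
  unfolding compact_ops_def by (rule subsetD[OF closure_subset])

lemma compact_ops_subspace: "subspace compact_ops"
  unfolding compact_ops_def by (rule subspace_closure[OF finite_rank_subspace])

lemma compact_ops_scal: "x \<in> compact_ops \<Longrightarrow> scal c * x \<in> compact_ops"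
  unfolding compact_ops_def
  by (erule closure_induct2[rotated -1])
    (auto intro!: continuous_intros subsetD[OF closure_subset] finite_rank_scal)

lemma compact_ops_adj: "x \<in> compact_ops \<Longrightarrow> adj x \<in> compact_ops"
  unfolding compact_ops_def
  by (erule closure_induct2[rotated -1])
    (auto intro!: continuous_on_adj subsetD[OF closure_subset] finite_rank_adj)

lemma compact_ops_mult: "x \<in> compact_ops \<Longrightarrow> y \<in> compact_ops \<Longrightarrow> x * y \<in> compact_ops"
proof -
  have 1: "x * y \<in> compact_ops" if "x \<in> finite_rank" "y \<in> compact_ops" for x y
    unfolding compact_ops_def
    by (rule closure_induct2[of finite_rank "\<lambda>y. x * y"])
      (use that in \<open>auto intro!: continuous_intros subsetD[OF closure_subset] finite_rank_mult simp: compact_ops_def\<close>)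
  assume x: "x \<in> compact_ops" and y: "y \<in> compact_ops"
  show ?thesis unfolding compact_ops_def
    by (rule closure_induct2[of finite_rank "\<lambda>x. x * y"])
      (use x 1[OF _ y] in \<open>auto intro!: continuous_intros simp: compact_ops_def\<close>)
qed

lemma compact_basis_vec_tendsto:
  assumes "a \<in> compact_ops"
  shows "(\<lambda>k. norm (op_apply a (basis_vec k))) \<longlonglongrightarrow> 0"
proof (rule LIMSEQ_I)
  fix e :: real assume e: "e > 0"
  obtain b where b: "b \<in> finite_rank" "dist b a < e"
    using assms e unfolding compact_ops_def closure_approachable by blast
  obtain N where "b \<in> cspan (munits N)" using b(1) by (auto simp: finite_rank_def)
  hence b0: "op_apply b (basis_vec k) = 0" if "k \<ge> N" for k
    by (induction rule: cspan_induct) (use that in \<open>auto simp: munits_def munit_basis_vec cscale_zero\<close>)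
  have "norm (op_apply a (basis_vec k)) < e" if "k \<ge> N" for k
  proof -
    have "norm (op_apply a (basis_vec k)) = norm (op_apply (a - b) (basis_vec k))" using b0[OF that] by simp
    also have "\<dots> \<le> norm (a - b)" using norm_op_apply[of "a - b" "basis_vec k"] by (simp add: norm_basis_vec)
    finally show ?thesis using b(2) by (simp add: dist_norm norm_minus_commute)
  qed
  thus "\<exists>no. \<forall>n\<ge>no. norm (norm (op_apply a (basis_vec n)) - 0) < e" by auto
qed

text \<open>
  A compact operator almost annihilates the basis vectors that are far out, and there the operator \<open>a + c\<close> acts
  like \<open>c\<close>. As a consequence the scalar part is a continuous function of the operator.
\<close>

lemma scalar_part_bound:
  assumes "a \<in> compact_ops"
  shows "norm c \<le> norm (a + scal c)"
proof (rule LIMSEQ_le_const2)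
  show "(\<lambda>k. norm c - norm (op_apply a (basis_vec k))) \<longlonglongrightarrow> norm c"
    using tendsto_diff[OF tendsto_const compact_basis_vec_tendsto[OF assms], of "norm c"] by simp
  have "norm c - norm (op_apply a (basis_vec k)) \<le> norm (a + scal c)" for k
  proof -
    have "norm c = norm (cscale c (basis_vec k))" by (simp add: norm_cscale norm_basis_vec)
    also have "\<dots> = norm (op_apply (a + scal c) (basis_vec k) - op_apply a (basis_vec k))" by simp
    also have "\<dots> \<le> norm (op_apply (a + scal c) (basis_vec k)) + norm (op_apply a (basis_vec k))"
      by (rule norm_triangle_ineq4)
    also have "norm (op_apply (a + scal c) (basis_vec k)) \<le> norm (a + scal c)"
      using norm_op_apply[of "a + scal c" "basis_vec k"] by (simp add: norm_basis_vec del: op_apply_simps)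
    finally show ?thesis by simp
  qed
  thus "\<exists>N. \<forall>k\<ge>N. norm c - norm (op_apply a (basis_vec k)) \<le> norm (a + scal c)" by blast
qed

lemma compact_plus_scalar_inject:
  assumes "a \<in> compact_ops" "b \<in> compact_ops" "a + scal c = b + scal d"
  shows "a = b \<and> c = d"
proof -
  have "norm (c - d) \<le> norm ((a - b) + scal (c - d))"
    by (rule scalar_part_bound) (intro subspace_diff compact_ops_subspace assms)
  also have "(a - b) + scal (c - d) = 0" using assms(3) by (simp add: scal_diff algebra_simps)
  finally show ?thesis using assms(3) by simp
qed

lemma closed_compact_plus_scalars: "closed compact_plus_scalars"
  unfolding closed_sequential_limits
proof (intro allI impI, elim conjE)
  fix x l assume x: "\<forall>n. x n \<in> compact_plus_scalars" and lim: "x \<longlonglongrightarrow> l"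
  have "\<forall>n. \<exists>a c. a \<in> compact_ops \<and> x n = a + scal c" using x unfolding compact_plus_scalars_def by blast
  then obtain a c where a: "\<And>n. a n \<in> compact_ops" and xn: "\<And>n. x n = a n + scal (c n)" by metis
  have "norm (c m - c n) \<le> norm (x m - x n)" for m n
    using scalar_part_bound[OF subspace_diff[OF compact_ops_subspace a[of m] a[of n]], of "c m - c n"]
    by (simp add: xn scal_diff algebra_simps)
  moreover have "Cauchy x" using lim by (rule LIMSEQ_imp_Cauchy)
  ultimately have "Cauchy c" unfolding Cauchy_def dist_norm by (meson le_less_trans)
  then obtain d where d: "c \<longlonglongrightarrow> d" by (meson Cauchy_convergent convergent_def)
  have "(\<lambda>n. scal (c n)) \<longlonglongrightarrow> scal d"
    using d unfolding LIMSEQ_iff by (simp flip: scal_diff)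
  hence "(\<lambda>n. x n - scal (c n)) \<longlonglongrightarrow> l - scal d" by (intro tendsto_diff lim)
  moreover have "x n - scal (c n) \<in> compact_ops" for n using a by (simp add: xn)
  ultimately have "l - scal d \<in> compact_ops" by (rule closed_sequentially[OF closed_compact_ops, rotated])
  thus "l \<in> compact_plus_scalars" unfolding compact_plus_scalars_def
    by (intro CollectI exI[of _ "l - scal d"] exI[of _ d]) simp
qed

section \<open>Matrices over the compact operators\<close>

lemma compact_plus_scalarsI: "a \<in> compact_ops \<Longrightarrow> a + scal c \<in> compact_plus_scalars"
  unfolding compact_plus_scalars_def by blast

lemma compact_in_compact_plus_scalars: "a \<in> compact_ops \<Longrightarrow> a \<in> compact_plus_scalars"
  using compact_plus_scalarsI[of a 0] by simp

lemma scalar_in_compact_plus_scalars: "scal c \<in> compact_plus_scalars"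
  using compact_plus_scalarsI[of 0 c] subspace_0[OF compact_ops_subspace] by simp

lemma star_subalgebra_compact_plus_scalars: "star_subalgebra compact_plus_scalars"
proof -
  note K = compact_ops_subspace
  have mult: "x * y \<in> compact_plus_scalars" if "x \<in> compact_plus_scalars" "y \<in> compact_plus_scalars" for x y
  proof -
    from that obtain a b c d where "a \<in> compact_ops" "b \<in> compact_ops" "x = a + scal c" "y = b + scal d"
      unfolding compact_plus_scalars_def by blast
    moreover from this have eq: "x * y = (a * b + scal c * b + scal d * a) + scal (c * d)"
      by (simp add: distrib_left distrib_right scal_mult scal_central[of a])
    ultimately show ?thesis
      unfolding eq by (intro compact_plus_scalarsI subspace_add[OF K] compact_ops_mult compact_ops_scal)
  qed
  have add: "x + y \<in> compact_plus_scalars" if "x \<in> compact_plus_scalars" "y \<in> compact_plus_scalars" for x y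
  proof -
    from that obtain a b c d where "a \<in> compact_ops" "b \<in> compact_ops" "x = a + scal c" "y = b + scal d"
      unfolding compact_plus_scalars_def by blast
    moreover from this have eq: "x + y = (a + b) + scal (c + d)" by (simp add: scal_add)
    ultimately show ?thesis unfolding eq by (intro compact_plus_scalarsI subspace_add[OF K])
  qed
  have scal: "scal c * x \<in> compact_plus_scalars" if "x \<in> compact_plus_scalars" for c x
    by (rule mult[OF scalar_in_compact_plus_scalars that])
  have "subspace compact_plus_scalars"
  proof (rule subspaceI)
    show "r *\<^sub>R x \<in> compact_plus_scalars" if "x \<in> compact_plus_scalars" for r x
      using scal[OF that, of "of_real r"] by (simp add: scal_of_real)
  qed (use add scalar_in_compact_plus_scalars[of 0] in auto)
  moreover have "adj x \<in> compact_plus_scalars" if "x \<in> compact_plus_scalars" for x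
  proof -
    from that obtain a c where a: "a \<in> compact_ops" "x = a + scal c" unfolding compact_plus_scalars_def by blast
    have "adj x = adj a + scal (cnj c)" by (simp add: a(2) adj_add adj_scal)
    thus ?thesis using compact_plus_scalarsI[OF compact_ops_adj[OF a(1)]] by simp
  qed
  ultimately show ?thesis
    unfolding star_subalgebra_def using mult scal scalar_in_compact_plus_scalars[of 1] by auto
qed

definition block_indices :: "nat \<Rightarrow> nat \<Rightarrow> nat set" where
  "block_indices n N = prod_encode ` ({..<n} \<times> {..<N})"

text \<open>
  The matrix units inside the first \<open>n\<close> slices, the matrix units of \<open>n \<times> n\<close> scalar matrices, which move
  whole slices, and the identity.
\<close>

definition block_gens :: "nat \<Rightarrow> nat \<Rightarrow> cop set" where
  "block_gens n N = insert 1 ((\<lambda>(s, t). munit s t) ` (block_indices n N \<times> block_indices n N) \<union>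
     (\<lambda>(i, j). slice i * unslice j) ` ({..<n} \<times> {..<n}))"

text \<open>
  The AF algebra in which \<open>n \<times> n\<close> matrices over the unitization of the compact operators live. It also
  contains the identity of \<open>\<ell>\<^sup>2\<close>, which is larger than the identity matrix \<open>corner n\<close>.
\<close>

definition block_algebra :: "nat \<Rightarrow> cop set" where
  "block_algebra n = closure (\<Union>N. cspan (block_gens n N))"

lemma block_gens_cases:
  assumes "g \<in> block_gens n N"
  obtains (one) "g = 1"
    | (unit) i a j b where "i < n" "a < N" "j < n" "b < N" "g = munit (prod_encode (i, a)) (prod_encode (j, b))"
    | (shift) i j where "i < n" "j < n" "g = slice i * unslice j"
proof -
  from assms consider "g = 1" | "g \<in> (\<lambda>(s, t). munit s t) ` (block_indices n N \<times> block_indices n N)"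
    | "g \<in> (\<lambda>(i, j). slice i * unslice j) ` ({..<n} \<times> {..<n})"
    unfolding block_gens_def insert_iff Un_iff by (elim disjE)
  thus ?thesis
  proof cases
    case 2
    then obtain s t where st: "s \<in> block_indices n N" "t \<in> block_indices n N" "g = munit s t" by auto
    from st(1) obtain i a where "i < n" "a < N" "s = prod_encode (i, a)" by (auto simp: block_indices_def)
    moreover from st(2) obtain j b where "j < n" "b < N" "t = prod_encode (j, b)" by (auto simp: block_indices_def)
    ultimately show ?thesis using unit st(3) by simp
  next
    case 3
    then obtain i j where "i < n" "j < n" "g = slice i * unslice j" by auto
    thus ?thesis by (rule shift)
  qed (rule one)
qed

lemma munit_in_block_gens:
  "i < n \<Longrightarrow> a < N \<Longrightarrow> j < n \<Longrightarrow> b < N \<Longrightarrow> munit (prod_encode (i, a)) (prod_encode (j, b)) \<in> block_gens n N"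
  unfolding block_gens_def block_indices_def
  by (rule insertI2, rule UnI1, rule image_eqI[where x = "(prod_encode (i, a), prod_encode (j, b))"]) auto

lemma shift_in_block_gens: "i < n \<Longrightarrow> j < n \<Longrightarrow> slice i * unslice j \<in> block_gens n N"
  unfolding block_gens_def
  by (rule insertI2, rule UnI2, rule image_eqI[where x = "(i, j)"]) auto

lemma shift_mult: "(slice i * unslice j) * (slice k * unslice l) = (if j = k then slice i * unslice l else 0)"
proof -
  have "(slice i * unslice j) * (slice k * unslice l) = slice i * (unslice j * slice k) * unslice l"
    by (simp only: mult.assoc)
  thus ?thesis by (simp add: unslice_slice)
qed

lemma AF_block_algebra: "AF_algebra (block_algebra n)"
  unfolding block_algebra_def
proof (rule AF_algebra_closure_Union)
  fix N
  show "finite (block_gens n N)" by (auto simp: block_gens_def block_indices_def)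
  show "1 \<in> block_gens n N" by (simp add: block_gens_def)
  show "g * h \<in> insert 0 (block_gens n N)" if g: "g \<in> block_gens n N" and h: "h \<in> block_gens n N" for g h
    using g
  proof (cases rule: block_gens_cases)
    case one
    thus ?thesis using h by simp
  next
    case unit
    from h show ?thesis
    proof (cases rule: block_gens_cases)
      case one
      thus ?thesis using g by simp
    qed (use unit in \<open>auto simp: munit_mult munit_slice_unslice munit_in_block_gens\<close>)
  next
    case shift
    from h show ?thesis
    proof (cases rule: block_gens_cases)
      case one
      thus ?thesis using g by simp
    qed (use shift in \<open>auto simp: shift_mult slice_unslice_munit munit_in_block_gens shift_in_block_gens\<close>)
  qed
  show "adj g \<in> block_gens n N" if "g \<in> block_gens n N" for g
    using that
  proof (cases rule: block_gens_cases)
    case one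
    thus ?thesis by (simp add: block_gens_def)
  qed (auto simp: adj_mult munit_in_block_gens shift_in_block_gens)
  show "block_gens n N \<subseteq> block_gens n (Suc N)"
    unfolding block_gens_def block_indices_def by (auto simp: less_Suc_eq)
qed

lemma closed_block_algebra: "closed (block_algebra n)" by (simp add: block_algebra_def)

lemma star_subalgebra_block_algebra: "star_subalgebra (block_algebra n)"
  using AF_block_algebra by (simp add: AF_algebra_def)

lemmas block_algebraD = star_subalgebraD[OF star_subalgebra_block_algebra]

lemma block_gens_subset: "g \<in> block_gens n N \<Longrightarrow> g \<in> block_algebra n"
  unfolding block_algebra_def by (rule subsetD[OF closure_subset], rule UN_I[OF UNIV_I], rule cspan_base)

lemma block_algebra_induct [consumes 1, case_names closed zero add scale base]:
  assumes "z \<in> block_algebra n" "closed (Collect P)" "P 0" "\<And>x y. P x \<Longrightarrow> P y \<Longrightarrow> P (x + y)"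
    "\<And>c x. P x \<Longrightarrow> P (scal c * x)" "\<And>N g. g \<in> block_gens n N \<Longrightarrow> P g"
  shows "P z"
proof -
  have "P x" if "x \<in> cspan (block_gens n N)" for x N
    using that by (induction rule: cspan_induct) (use assms in auto)
  hence "(\<Union>N. cspan (block_gens n N)) \<subseteq> Collect P" by blast
  hence "block_algebra n \<subseteq> Collect P" unfolding block_algebra_def using assms(2) by (rule closure_minimal)
  thus ?thesis using assms(1) by blast
qed

lemma scal_sandwich: "x * (scal c * y) * z = scal c * (x * y * z)"
  by (simp only: mult.assoc[symmetric] scal_central[of x])

text \<open>
  The converse of \<open>assemble_in_block_algebra\<close> below: taking entries leads back to the unitization, because it is
  norm closed and contains the entries of the generators.
\<close>

lemma block_algebra_entry:
  assumes "z \<in> block_algebra n"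
  shows "unslice i * z * slice j \<in> compact_plus_scalars"
proof -
  note mem = star_subalgebraD[OF star_subalgebra_compact_plus_scalars]
  from assms show ?thesis
  proof (induction rule: block_algebra_induct)
    case closed
    have "continuous_on UNIV (\<lambda>z. unslice i * z * slice j)" by (intro continuous_intros)
    from closed_vimage[OF closed_compact_plus_scalars this] show ?case by (simp add: vimage_def)
  next
    case (base N g)
    thus ?case
    proof (cases rule: block_gens_cases)
      case (unit k a l b)
      hence "unslice i * g * slice j = (if k = i \<and> l = j then munit a b else 0)" by (simp add: unslice_munit_slice)
      thus ?thesis using mem compact_in_compact_plus_scalars[OF finite_rank_compact[OF munit_finite_rank]] by simp
    next
      case (shift k l)
      hence "unslice i * g * slice j = (unslice i * slice k) * (unslice l * slice j)" by (simp only: mult.assoc)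
      thus ?thesis using mem by (simp add: unslice_slice)
    qed (use mem in \<open>simp add: unslice_slice\<close>)
  qed (auto simp: distrib_left distrib_right scal_sandwich mem)
qed

definition corner :: "nat \<Rightarrow> cop" where
  "corner n = (\<Sum>i<n. slice i * unslice i)"

lemma corner_slice: "corner n * slice k = (if k < n then slice k else 0)"
  by (simp add: corner_def sum_distrib_right mult.assoc unslice_slice if_distrib[of "(*) _"] cong: if_cong)

lemma unslice_corner: "unslice k * corner n = (if k < n then unslice k else 0)"
proof -
  have "unslice k * corner n = (\<Sum>i<n. (unslice k * slice i) * unslice i)"
    by (simp add: corner_def sum_distrib_left mult.assoc)
  thus ?thesis by (simp add: unslice_slice if_distrib[of "\<lambda>x. x * _"] cong: if_cong)
qed

lemma corner_idem: "corner n * corner n = corner n"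
  by (subst (2) corner_def) (simp add: sum_distrib_left mult.assoc[symmetric] corner_slice, simp add: corner_def)

lemma adj_sum: "adj (\<Sum>i\<in>I. f i) = (\<Sum>i\<in>I. adj (f i))"
  by (induction I rule: infinite_finite_induct) (simp_all add: adj_add)

lemma adj_corner [simp]: "adj (corner n) = corner n"
  by (simp add: corner_def adj_sum adj_mult)

text \<open>
  This makes the restriction to the corner, and with it the passage to entries, multiplicative.
\<close>

lemma block_algebra_corner:
  assumes "z \<in> block_algebra n"
  shows "corner n * z = z * corner n"
  using assms
proof (induction rule: block_algebra_induct)
  case closed
  have "closed {z. corner n * z = z * corner n}"
    by (intro closed_Collect_eq continuous_intros)
  thus ?case by simp
next
  case (base N g)
  thus ?case
  proof (cases rule: block_gens_cases)
    case (unit k a l b)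
    have "corner n * g = g"
      using unit by (simp add: corner_def sum_distrib_right slice_unslice_munit)
    moreover have "g * corner n = g"
      using unit by (simp add: corner_def sum_distrib_left munit_slice_unslice)
    ultimately show ?thesis by simp
  next
    case (shift k l)
    have "corner n * g = g" using shift by (simp add: mult.assoc[symmetric] corner_slice)
    moreover have "g * corner n = g" using shift by (simp add: mult.assoc unslice_corner)
    ultimately show ?thesis by simp
  qed simp
next
  case (scale c x)
  have "corner n * (scal c * x) = scal c * (corner n * x)" by (simp only: mult.assoc[symmetric] scal_central[of "corner n"])
  thus ?case using scale by (simp add: mult.assoc)
qed (simp_all add: distrib_left distrib_right)

text \<open>
  Stable isomorphism made concrete: the entries of a matrix are moved to the slices of one Hilbert space, so that
  matrices of all sizes become operators on \<open>\<ell>\<^sup>2\<close>.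
\<close>

definition assemble :: "nat \<Rightarrow> (nat \<Rightarrow> nat \<Rightarrow> cop) \<Rightarrow> cop" where
  "assemble n x = (\<Sum>i<n. \<Sum>j<n. slice i * x i j * unslice j)"

lemma assemble_cong: "(\<And>i j. i < n \<Longrightarrow> j < n \<Longrightarrow> x i j = y i j) \<Longrightarrow> assemble n x = assemble n y"
  unfolding assemble_def by (intro sum.cong) auto

lemma unslice_assemble:
  assumes "i < n"
  shows "unslice i * assemble n x = (\<Sum>j<n. x i j * unslice j)"
proof -
  have "unslice i * assemble n x = (\<Sum>k<n. \<Sum>j<n. (unslice i * slice k) * x k j * unslice j)"
    by (simp add: assemble_def sum_distrib_left mult.assoc)
  also have "\<dots> = (\<Sum>k<n. if k = i then (\<Sum>j<n. x i j * unslice j) else 0)"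
    by (intro sum.cong) (auto simp: unslice_slice)
  finally show ?thesis using assms by simp
qed

lemma assemble_entry:
  assumes "i < n" "j < n"
  shows "unslice i * assemble n x * slice j = x i j"
proof -
  have "unslice i * assemble n x * slice j = (\<Sum>k<n. if k = j then x i k else 0)"
    by (simp add: unslice_assemble[OF assms(1)] sum_distrib_right mult.assoc unslice_slice if_distrib cong: if_cong)
  thus ?thesis using assms by simp
qed

lemma assemble_mult: "assemble n x * assemble n y = assemble n (\<lambda>i j. \<Sum>k<n. x i k * y k j)"
proof -
  have "assemble n x * assemble n y = (\<Sum>i<n. \<Sum>k<n. slice i * x i k * (unslice k * assemble n y))"
    by (subst assemble_def) (simp add: sum_distrib_right mult.assoc)
  also have "\<dots> = (\<Sum>i<n. \<Sum>k<n. \<Sum>j<n. slice i * (x i k * y k j) * unslice j)"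
    by (intro sum.cong refl) (simp add: unslice_assemble sum_distrib_left mult.assoc)
  also have "\<dots> = (\<Sum>i<n. \<Sum>j<n. \<Sum>k<n. slice i * (x i k * y k j) * unslice j)"
    by (intro sum.cong refl sum.swap)
  also have "\<dots> = assemble n (\<lambda>i j. \<Sum>k<n. x i k * y k j)"
    by (simp add: assemble_def sum_distrib_left sum_distrib_right)
  finally show ?thesis .
qed

lemma adj_assemble: "adj (assemble n x) = assemble n (\<lambda>i j. adj (x j i))"
proof -
  have "adj (assemble n x) = (\<Sum>i<n. \<Sum>j<n. slice j * adj (x i j) * unslice i)"
    by (simp add: assemble_def adj_sum adj_mult mult.assoc)
  also have "\<dots> = assemble n (\<lambda>i j. adj (x j i))" unfolding assemble_def by (rule sum.swap)
  finally show ?thesis .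
qed

lemma assemble_delta: "assemble n (\<lambda>i j. if i = j then 1 else 0) = corner n"
proof -
  have "(\<Sum>j<n. slice i * (if i = j then 1 else 0) * unslice j) = slice i * unslice i" if "i < n" for i
  proof -
    have "(\<Sum>j<n. slice i * (if i = j then 1 else 0) * unslice j) = (\<Sum>j<n. if i = j then slice i * unslice j else 0)"
      by (intro sum.cong) auto
    thus ?thesis using that by simp
  qed
  thus ?thesis unfolding assemble_def corner_def by (intro sum.cong) auto
qed

lemma corner_assemble: "corner n * assemble n x = assemble n x" "assemble n x * corner n = assemble n x"
proof -
  show "corner n * assemble n x = assemble n x"
    unfolding assemble_def sum_distrib_left
    by (intro sum.cong refl) (simp add: mult.assoc[symmetric] corner_slice)
  show "assemble n x * corner n = assemble n x"
    unfolding assemble_def sum_distrib_right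
    by (intro sum.cong refl) (simp add: mult.assoc unslice_corner)
qed

lemma corner_in_block_algebra: "corner n \<in> block_algebra n"
  unfolding corner_def
  by (intro subspace_sum[OF block_algebraD(2)]) (auto intro: block_gens_subset[OF shift_in_block_gens])

lemma assemble_in_block_algebra:
  assumes "\<And>i j. i < n \<Longrightarrow> j < n \<Longrightarrow> x i j \<in> compact_plus_scalars"
  shows "assemble n x \<in> block_algebra n"
proof -
  note mem = block_algebraD
  have fr: "slice i * a * unslice j \<in> block_algebra n" if ij: "i < n" "j < n" and a: "a \<in> finite_rank" for i j a
    using a
  proof (induction rule: finite_rank_induct)
    case (munit a b)
    show ?case unfolding slice_munit_unslice
      by (rule block_gens_subset[of _ _ "Suc (max a b)"]) (auto intro!: munit_in_block_gens ij)
  qed (auto simp: distrib_left distrib_right scal_sandwich mem)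
  have "slice i * y * unslice j \<in> block_algebra n" if ij: "i < n" "j < n" and y: "y \<in> compact_plus_scalars" for i j y
  proof -
    obtain a c where a: "a \<in> compact_ops" "y = a + scal c" using y unfolding compact_plus_scalars_def by blast
    have "slice i * a * unslice j \<in> closure (block_algebra n)"
      by (rule closure_induct2[of finite_rank "\<lambda>a. slice i * a * unslice j"])
        (use a(1) in \<open>auto intro!: continuous_intros subsetD[OF closure_subset] fr[OF ij] simp: compact_ops_def\<close>)
    hence "slice i * a * unslice j \<in> block_algebra n" by (simp add: closed_block_algebra)
    moreover have "slice i * scal c * unslice j \<in> block_algebra n"
      using mem(3)[OF block_gens_subset[OF shift_in_block_gens[OF ij, of 0]], of c]
      by (simp add: scal_central[of "slice i"] mult.assoc)
    ultimately show ?thesis by (simp add: a(2) distrib_left distrib_right mem)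
  qed
  thus ?thesis unfolding assemble_def using assms by (intro subspace_sum[OF mem(2)]) auto
qed

section \<open>The ray\<close>

text \<open>
  The edge \<open>2 * n\<close> leads from \<open>n\<close> to \<open>n + 1\<close>, and the edge \<open>2 * n + 1\<close> leads back.
\<close>

definition ray :: "(nat, nat) pre_digraph" where
  "ray = \<lparr>verts = UNIV, arcs = UNIV,
     tail = (\<lambda>e. if even e then e div 2 else e div 2 + 1),
     head = (\<lambda>e. if even e then e div 2 + 1 else e div 2)\<rparr>"

definition ray_rev :: "nat \<Rightarrow> nat" where
  "ray_rev e = (if even e then e + 1 else e - 1)"

lemma ray_simps [simp]: "verts ray = UNIV" "arcs ray = UNIV"
  "tail ray e = (if even e then e div 2 else e div 2 + 1)"
  "head ray e = (if even e then e div 2 + 1 else e div 2)"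
  by (simp_all add: ray_def)

abbreviation relators :: "nat star_poly set" where
  "relators \<equiv> graph_relators ray ray_rev"

abbreviation free_alg :: "nat star_poly set" where
  "free_alg \<equiv> free_star_alg UNIV"

section \<open>The free *-algebra on the edges\<close>

lemma sum_monomials: "f = (\<Sum>w\<in>Poly_Mapping.keys f. Poly_Mapping.single w (Poly_Mapping.lookup f w))"
  by (rule poly_mapping_eqI)
    (simp add: lookup_sum lookup_single when_def in_keys_iff if_distrib cong: if_cong)

lemma poly_scale_single: "poly_scale c (Poly_Mapping.single w d) = Poly_Mapping.single w (c * d)"
  unfolding poly_scale_def by (rule map_single) simp

lemma poly_scale_conv: "poly_scale c f = Poly_Mapping.single 0 c * f"
  unfolding poly_scale_def by (rule mult_map_scale_conv_mult)

lemma poly_scale_zero [simp]: "poly_scale c 0 = 0" "poly_scale 0 f = 0"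
  by (simp_all add: poly_scale_conv)

lemma poly_scale_one [simp]: "poly_scale 1 f = f"
  by (simp add: poly_scale_conv)

lemma poly_scale_minus: "poly_scale (- 1) f = - f"
  by (simp add: poly_scale_conv single_uminus)

lemma lookup_poly_scale: "Poly_Mapping.lookup (poly_scale c f) w = c * Poly_Mapping.lookup f w"
  unfolding poly_scale_def by (simp add: Poly_Mapping.map.rep_eq when_def)

lemma poly_scale_assoc: "poly_scale c (poly_scale d f) = poly_scale (c * d) f"
  by (rule poly_mapping_eqI) (simp add: lookup_poly_scale)

lemma poly_scale_add_left: "poly_scale (c + d) f = poly_scale c f + poly_scale d f"
  by (rule poly_mapping_eqI) (simp add: lookup_poly_scale lookup_add distrib_right)

lemma poly_scale_mult_left: "poly_scale c f * g = poly_scale c (f * g)"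
  by (simp add: poly_scale_conv mult.assoc)

lemma single_0_central: "f * Poly_Mapping.single (0 :: nat star_word) (c :: complex) = Poly_Mapping.single 0 c * f"
proof -
  have "f * Poly_Mapping.single 0 c = (\<Sum>w\<in>Poly_Mapping.keys f. Poly_Mapping.single w (Poly_Mapping.lookup f w) * Poly_Mapping.single 0 c)"
    by (subst (1) sum_monomials) (simp add: sum_distrib_right)
  also have "\<dots> = (\<Sum>w\<in>Poly_Mapping.keys f. Poly_Mapping.single 0 c * Poly_Mapping.single w (Poly_Mapping.lookup f w))"
    by (simp add: mult_single mult.commute)
  also have "\<dots> = Poly_Mapping.single 0 c * f"
    by (subst (2) sum_monomials) (simp add: sum_distrib_left)
  finally show ?thesis .
qed

lemma poly_scale_mult_right: "f * poly_scale c g = poly_scale c (f * (g :: nat star_poly))"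
  by (simp add: poly_scale_conv single_0_central flip: mult.assoc)

lemma star_poly_induct [case_names zero add word]:
  fixes f :: "'a star_poly"
  assumes "P 0" "\<And>f g. P f \<Longrightarrow> P g \<Longrightarrow> P (f + g)" "\<And>w c. w \<in> Poly_Mapping.keys f \<Longrightarrow> P (Poly_Mapping.single w c)"
  shows "P f"
proof -
  have "P (\<Sum>w\<in>K. Poly_Mapping.single w (Poly_Mapping.lookup f w))" if "finite K" "K \<subseteq> Poly_Mapping.keys f" for K
    using that by (induction K) (auto intro: assms)
  from this[of "Poly_Mapping.keys f"] show ?thesis by (simp flip: sum_monomials)
qed

lemma sum_keys_superset:
  fixes F :: "'a star_word \<Rightarrow> complex \<Rightarrow> 'b::comm_monoid_add"
  assumes "finite K" "Poly_Mapping.keys f \<subseteq> K" "\<And>w. F w 0 = 0"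
  shows "(\<Sum>w\<in>Poly_Mapping.keys f. F w (Poly_Mapping.lookup f w)) = (\<Sum>w\<in>K. F w (Poly_Mapping.lookup f w))"
  by (rule sum.mono_neutral_left) (use assms in \<open>auto simp: in_keys_iff\<close>)

text \<open>
  Yields the additivity of \<open>poly_star\<close> and of the representation \<open>rep\<close>.
\<close>

lemma sum_keys_add:
  fixes F :: "'a star_word \<Rightarrow> complex \<Rightarrow> 'b::comm_monoid_add"
  assumes "\<And>w. F w 0 = 0" "\<And>w c d. F w (c + d) = F w c + F w d"
  shows "(\<Sum>w\<in>Poly_Mapping.keys (f + g). F w (Poly_Mapping.lookup (f + g) w)) =
    (\<Sum>w\<in>Poly_Mapping.keys f. F w (Poly_Mapping.lookup f w)) + (\<Sum>w\<in>Poly_Mapping.keys g. F w (Poly_Mapping.lookup g w))"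
proof -
  let ?K = "Poly_Mapping.keys f \<union> Poly_Mapping.keys g"
  have "Poly_Mapping.keys (f + g) \<subseteq> ?K" by (rule keys_add)
  thus ?thesis
    using sum_keys_superset[of ?K "f + g" F] sum_keys_superset[of ?K f F] sum_keys_superset[of ?K g F] assms
    by (simp add: lookup_add sum.distrib)
qed

lemma poly_star_add: "poly_star (f + g) = poly_star f + poly_star g"
  unfolding poly_star_def
  by (rule sum_keys_add[where F = "\<lambda>w c. Poly_Mapping.single (word_star w) (cnj c)"]) (simp_all add: single_add)

lemma poly_star_single: "poly_star (Poly_Mapping.single w c) = Poly_Mapping.single (word_star w) (cnj c)"
  by (cases "c = 0") (simp_all add: poly_star_def)

lemma poly_star_0 [simp]: "poly_star 0 = 0" by (simp add: poly_star_def)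

lemma word_star_word_star [simp]: "word_star (word_star w) = w"
  by (cases w) (simp add: word_star_def rev_map comp_def case_prod_unfold)

lemma word_star_add: "word_star (v + w) = word_star w + word_star v"
  by (simp add: word_star_def plus_star_word_def)

lemma poly_star_star [simp]: "poly_star (poly_star f) = f"
  by (induction f rule: star_poly_induct) (simp_all add: poly_star_add poly_star_single)

lemma poly_star_mult: "poly_star (f * g) = poly_star g * poly_star f"
proof (induction f rule: star_poly_induct)
  case (word v c)
  show ?case
    by (induction g rule: star_poly_induct)
      (simp_all add: poly_star_add poly_star_single distrib_left distrib_right mult_single word_star_add mult.commute)
qed (simp_all add: poly_star_add distrib_left distrib_right)

lemma poly_star_uminus: "poly_star (- f) = - poly_star f"
  using poly_star_add[of f "- f"] by (simp add: eq_neg_iff_add_eq_0 add.commute)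

lemma poly_star_diff: "poly_star (f - g) = poly_star f - poly_star g"
  using poly_star_add[of f "- g"] by (simp add: poly_star_uminus)

lemma free_alg_iff: "f \<in> free_alg \<longleftrightarrow> (\<forall>w\<in>Poly_Mapping.keys f. letters w \<noteq> [])"
  by (simp add: free_star_alg_def)

lemma free_alg_zero: "0 \<in> free_alg" by (simp add: free_alg_iff)

lemma free_alg_add: "f \<in> free_alg \<Longrightarrow> g \<in> free_alg \<Longrightarrow> f + g \<in> free_alg"
  unfolding free_alg_iff using keys_add[of f g] by blast

lemma free_alg_mult:
  assumes "f \<in> free_alg" "g \<in> free_alg"
  shows "f * g \<in> free_alg"
  unfolding free_alg_iff
proof
  fix w assume "w \<in> Poly_Mapping.keys (f * g)"
  then obtain a b where "w = a + b" "a \<in> Poly_Mapping.keys f" using keys_mult[of f g] by blast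
  with assms(1) show "letters w \<noteq> []" by (simp add: free_alg_iff plus_star_word_def)
qed

lemma free_alg_scale: "f \<in> free_alg \<Longrightarrow> poly_scale c f \<in> free_alg"
  by (auto simp: free_alg_iff in_keys_iff lookup_poly_scale)

lemma free_alg_uminus: "f \<in> free_alg \<Longrightarrow> - f \<in> free_alg"
  using free_alg_scale[of f "- 1"] by (simp add: poly_scale_minus)

lemma free_alg_diff: "f \<in> free_alg \<Longrightarrow> g \<in> free_alg \<Longrightarrow> f - g \<in> free_alg"
  using free_alg_add[of f "- g"] free_alg_uminus[of g] by simp

lemma free_alg_single: "letters w \<noteq> [] \<Longrightarrow> Poly_Mapping.single w c \<in> free_alg"
  by (simp add: free_alg_iff)

lemma free_alg_sum: "(\<And>i. i \<in> I \<Longrightarrow> f i \<in> free_alg) \<Longrightarrow> (\<Sum>i\<in>I. f i) \<in> free_alg"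
  by (induction I rule: infinite_finite_induct) (auto intro: free_alg_zero free_alg_add)

lemma letters_word_star: "letters (word_star w) = [] \<longleftrightarrow> letters w = []"
  by (simp add: word_star_def)

lemma free_alg_star: "f \<in> free_alg \<Longrightarrow> poly_star f \<in> free_alg"
  unfolding poly_star_def by (intro free_alg_sum free_alg_single) (auto simp: free_alg_iff letters_word_star)

lemma gen_free_alg: "gen x \<in> free_alg"
  unfolding gen_def by (rule free_alg_single) simp

lemmas free_alg_intros = free_alg_zero free_alg_add free_alg_mult free_alg_scale free_alg_uminus
  free_alg_diff free_alg_sum free_alg_star gen_free_alg

section \<open>The representation by matrix units\<close>

text \<open>
  The edges towards \<open>0\<close> have to act as zero in every representation, by \<open>eqv_backward_edge\<close>.
\<close>

definition rep_letter :: "nat \<times> bool \<Rightarrow> cop" where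
  "rep_letter x = (case x of (e, b) \<Rightarrow>
     if odd e then 0 else if b then munit (e div 2 + 1) (e div 2) else munit (e div 2) (e div 2 + 1))"

definition rep_word :: "nat star_word \<Rightarrow> cop" where
  "rep_word w = prod_list (map rep_letter (letters w))"

definition rep :: "nat star_poly \<Rightarrow> cop" where
  "rep f = (\<Sum>w\<in>Poly_Mapping.keys f. scal (Poly_Mapping.lookup f w) * rep_word w)"

lemma rep_add: "rep (f + g) = rep f + rep g"
  unfolding rep_def by (rule sum_keys_add[where F = "\<lambda>w c. scal c * rep_word w"]) (simp_all add: scal_add distrib_right)

lemma rep_single: "rep (Poly_Mapping.single w c) = scal c * rep_word w"
  by (cases "c = 0") (simp_all add: rep_def)

lemma rep_0 [simp]: "rep 0 = 0" by (simp add: rep_def)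

lemma rep_word_add: "rep_word (v + w) = rep_word v * rep_word w"
  by (simp add: rep_word_def plus_star_word_def)

lemma rep_mult: "rep (f * g) = rep f * rep g"
proof (induction f rule: star_poly_induct)
  case (word v c)
  show ?case
  proof (induction g rule: star_poly_induct)
    case (word w d)
    have "rep_word v * (scal d * rep_word w) = scal d * (rep_word v * rep_word w)"
      by (simp only: mult.assoc[symmetric] scal_central[of "rep_word v"])
    thus ?case by (simp add: mult_single rep_single rep_word_add scal_mult mult.assoc)
  qed (simp_all add: rep_add distrib_left)
qed (simp_all add: rep_add distrib_right)

lemma rep_scale: "rep (poly_scale c f) = scal c * rep f"
  by (simp add: poly_scale_conv rep_mult rep_single rep_word_def zero_star_word_def)

lemma rep_uminus: "rep (- f) = - rep f"
  using rep_scale[of "- 1" f] by (simp add: poly_scale_minus scal_minus)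

lemma rep_diff: "rep (f - g) = rep f - rep g"
  using rep_add[of f "- g"] by (simp add: rep_uminus)

lemma rep_sum: "rep (\<Sum>i\<in>I. f i) = (\<Sum>i\<in>I. rep (f i))"
  by (induction I rule: infinite_finite_induct) (simp_all add: rep_add)

lemma adj_rep_letter: "adj (rep_letter (x, b)) = rep_letter (x, \<not> b)"
  by (simp add: rep_letter_def)

lemma adj_rep_word: "adj (rep_word w) = rep_word (word_star w)"
proof -
  have "adj (prod_list (map rep_letter xs)) = prod_list (map rep_letter (rev (map (\<lambda>(x, b). (x, \<not> b)) xs)))" for xs
    by (induction xs) (auto simp: adj_mult adj_rep_letter)
  thus ?thesis by (simp add: rep_word_def word_star_def)
qed

lemma rep_star: "rep (poly_star f) = adj (rep f)"
proof (induction f rule: star_poly_induct)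
  case (word w c)
  have "adj (scal c * rep_word w) = scal (cnj c) * adj (rep_word w)" by (simp only: adj_mult adj_scal scal_central)
  thus ?case by (simp add: poly_star_single rep_single adj_rep_word)
qed (simp_all add: poly_star_add rep_add adj_add)

lemma rep_gen: "rep (gen e) = (if odd e then 0 else munit (e div 2) (e div 2 + 1))"
  by (simp add: gen_def rep_single rep_word_def rep_letter_def)

section \<open>The relations of the ray\<close>

text \<open>
  The generators of the edges away from \<open>0\<close>.
\<close>

abbreviation fwd :: "nat \<Rightarrow> nat star_poly" where "fwd n \<equiv> gen (2 * n)"
abbreviation fwd_star :: "nat \<Rightarrow> nat star_poly" where "fwd_star n \<equiv> poly_star (gen (2 * n))"

text \<open>
  Without turning back, a path goes on in the direction in which it is moving, and it ends when it reaches the vertex \<open>0\<close>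
  along the edge \<open>1\<close>.
\<close>

lemma edge_support:
  "{f \<in> arcs ray. edge_matrix ray ray_rev e f \<noteq> 0} = (if even e then {e + 2} else if e = 1 then {} else {e - 2})"
  unfolding edge_matrix_def ray_rev_def
  by (auto elim!: evenE oddE split: if_splits)

lemma relators_eq:
  "relators = {gen e * poly_star (gen e) * gen e - gen e | e. True} \<union>
     {(gen e * poly_star (gen e)) * (gen f * poly_star (gen f)) | e f. e \<noteq> f} \<union>
     {poly_star (gen e) * gen e - (if even e then gen (e + 2) * poly_star (gen (e + 2))
        else if e = 1 then 0 else gen (e - 2) * poly_star (gen (e - 2))) | e. True}"
proof -
  have "(\<Sum>f\<in>{f \<in> arcs ray. edge_matrix ray ray_rev e f \<noteq> 0}. poly_scale (edge_matrix ray ray_rev e f) (gen f * poly_star (gen f))) =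
    (\<Sum>f\<in>{f \<in> arcs ray. edge_matrix ray ray_rev e f \<noteq> 0}. gen f * poly_star (gen f))" for e
    by (rule sum.cong) (auto simp: edge_matrix_def split: if_splits)
  hence "(\<Sum>f\<in>{f \<in> arcs ray. edge_matrix ray ray_rev e f \<noteq> 0}. poly_scale (edge_matrix ray ray_rev e f) (gen f * poly_star (gen f))) =
    (if even e then gen (e + 2) * poly_star (gen (e + 2))
        else if e = 1 then 0 else gen (e - 2) * poly_star (gen (e - 2)))" for e
    unfolding edge_support by simp
  thus ?thesis unfolding graph_relators_def Let_def by simp
qed

section \<open>Equality modulo the relations\<close>

definition ray_seminorms :: "(nat star_poly \<Rightarrow> real) set" where
  "ray_seminorms = {p. cstar_seminorm_on free_alg p \<and> (\<forall>r\<in>relators. p r = 0)}"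

lemma seminormD:
  assumes "p \<in> ray_seminorms"
  shows "f \<in> free_alg \<Longrightarrow> 0 \<le> p f"
    "f \<in> free_alg \<Longrightarrow> g \<in> free_alg \<Longrightarrow> p (f + g) \<le> p f + p g"
    "f \<in> free_alg \<Longrightarrow> p (poly_scale c f) = cmod c * p f"
    "f \<in> free_alg \<Longrightarrow> g \<in> free_alg \<Longrightarrow> p (f * g) \<le> p f * p g"
    "f \<in> free_alg \<Longrightarrow> p (poly_star f * f) = (p f)\<^sup>2"
    "r \<in> relators \<Longrightarrow> p r = 0"
  using assms unfolding ray_seminorms_def cstar_seminorm_on_def by blast+

lemma seminorm_zero: "p \<in> ray_seminorms \<Longrightarrow> p 0 = 0"
  using seminormD(3)[of p 0 0] free_alg_zero by simp

lemma seminorm_uminus: "p \<in> ray_seminorms \<Longrightarrow> f \<in> free_alg \<Longrightarrow> p (- f) = p f"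
  using seminormD(3)[of p f "- 1"] by (simp add: poly_scale_minus)

lemma seminorm_star:
  assumes p: "p \<in> ray_seminorms" and f: "f \<in> free_alg"
  shows "p (poly_star f) = p f"
proof -
  have le: "p g \<le> p (poly_star g)" if g: "g \<in> free_alg" for g
  proof (cases "p g = 0")
    case True
    thus ?thesis using seminormD(1)[OF p free_alg_star[OF g]] by simp
  next
    case False
    have "(p g)\<^sup>2 \<le> p (poly_star g) * p g"
      using seminormD(4)[OF p free_alg_star[OF g] g] seminormD(5)[OF p g] by simp
    moreover have "p g > 0" using seminormD(1)[OF p g] False by simp
    ultimately show ?thesis by (simp add: power2_eq_square)
  qed
  from le[OF f] le[OF free_alg_star[OF f]] show ?thesis by simp
qed

text \<open>
  Equality in every C*-algebra that is generated by a family satisfying the relations.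
\<close>

definition eqv :: "nat star_poly \<Rightarrow> nat star_poly \<Rightarrow> bool" where
  "eqv f g \<longleftrightarrow> f \<in> free_alg \<and> g \<in> free_alg \<and> (\<forall>p\<in>ray_seminorms. p (f - g) = 0)"

lemma eqvI: "f \<in> free_alg \<Longrightarrow> g \<in> free_alg \<Longrightarrow> f - g \<in> relators \<Longrightarrow> eqv f g"
  unfolding eqv_def using seminormD(6) by blast

lemma eqv_mem: "eqv f g \<Longrightarrow> f \<in> free_alg" "eqv f g \<Longrightarrow> g \<in> free_alg"
  by (simp_all add: eqv_def)

lemma eqv_refl: "f \<in> free_alg \<Longrightarrow> eqv f f"
  by (simp add: eqv_def seminorm_zero)

lemma eqv_sym: "eqv f g \<Longrightarrow> eqv g f"
proof -
  assume a: "eqv f g"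
  have "p (g - f) = 0" if "p \<in> ray_seminorms" for p
    using seminorm_uminus[OF that, of "f - g"] a that by (simp add: eqv_def free_alg_diff)
  with a show ?thesis by (simp add: eqv_def)
qed

lemma seminorm_null_add:
  assumes "p \<in> ray_seminorms" "f \<in> free_alg" "g \<in> free_alg" "p f = 0" "p g = 0"
  shows "p (f + g) = 0"
  using seminormD(2)[OF assms(1-3)] seminormD(1)[OF assms(1) free_alg_add[OF assms(2,3)]] assms(4,5) by simp

lemma seminorm_null_mult:
  assumes "p \<in> ray_seminorms" "f \<in> free_alg" "g \<in> free_alg" "p f = 0 \<or> p g = 0"
  shows "p (f * g) = 0"
  using seminormD(4)[OF assms(1-3)] seminormD(1)[OF assms(1) free_alg_mult[OF assms(2,3)]] assms(4) by auto

lemma eqv_trans [trans]: "eqv f g \<Longrightarrow> eqv g h \<Longrightarrow> eqv f h"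
proof -
  assume a: "eqv f g" "eqv g h"
  have "p (f - h) = 0" if p: "p \<in> ray_seminorms" for p
    using seminorm_null_add[OF p, of "f - g" "g - h"] a p by (simp add: eqv_def free_alg_diff)
  with a show ?thesis by (simp add: eqv_def)
qed

lemma eqv_add: "eqv f f' \<Longrightarrow> eqv g g' \<Longrightarrow> eqv (f + g) (f' + g')"
proof -
  assume a: "eqv f f'" "eqv g g'"
  have "p (f + g - (f' + g')) = 0" if p: "p \<in> ray_seminorms" for p
    using seminorm_null_add[OF p, of "f - f'" "g - g'"] a p by (simp add: eqv_def free_alg_diff algebra_simps)
  with a show ?thesis by (simp add: eqv_def free_alg_add)
qed

lemma eqv_mult: "eqv f f' \<Longrightarrow> eqv g g' \<Longrightarrow> eqv (f * g) (f' * g')"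
proof -
  assume a: "eqv f f'" "eqv g g'"
  hence m: "f \<in> free_alg" "f' \<in> free_alg" "g \<in> free_alg" "g' \<in> free_alg" by (auto simp: eqv_def)
  have "p (f * g - f' * g') = 0" if p: "p \<in> ray_seminorms" for p
  proof -
    have eq: "f * g - f' * g' = f * (g - g') + (f - f') * g'" by (simp add: algebra_simps)
    have z: "p (g - g') = 0" "p (f - f') = 0" using a p by (auto simp: eqv_def)
    note d = free_alg_diff[OF m(3,4)] free_alg_diff[OF m(1,2)]
    have "p (f * (g - g')) = 0" "p ((f - f') * g') = 0"
      using seminorm_null_mult[OF p m(1) d(1)] seminorm_null_mult[OF p d(2) m(4)] z by auto
    thus ?thesis unfolding eq
      by (rule seminorm_null_add[OF p free_alg_mult[OF m(1) d(1)] free_alg_mult[OF d(2) m(4)]])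
  qed
  with m show ?thesis by (simp add: eqv_def free_alg_mult)
qed

lemma eqv_scale: "eqv f g \<Longrightarrow> eqv (poly_scale c f) (poly_scale c g)"
proof -
  assume a: "eqv f g"
  have "p (poly_scale c f - poly_scale c g) = 0" if p: "p \<in> ray_seminorms" for p
  proof -
    have "poly_scale c f - poly_scale c g = poly_scale c (f - g)" by (simp add: poly_scale_conv right_diff_distrib)
    thus ?thesis using seminormD(3)[OF p, of "f - g"] a p by (simp add: eqv_def free_alg_diff)
  qed
  with a show ?thesis by (simp add: eqv_def free_alg_scale)
qed

lemma eqv_star: "eqv f g \<Longrightarrow> eqv (poly_star f) (poly_star g)"
  unfolding eqv_def by (auto simp: free_alg_star seminorm_star free_alg_diff simp flip: poly_star_diff)

lemma eqv_seminorm: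
  assumes "eqv f g" and p: "p \<in> ray_seminorms"
  shows "p f = p g"
proof -
  have m: "f \<in> free_alg" "g \<in> free_alg" "p (f - g) = 0" "p (g - f) = 0"
    using assms eqv_sym[OF assms(1)] by (auto simp: eqv_def)
  have "p f \<le> p (f - g) + p g" "p g \<le> p (g - f) + p f"
    using seminormD(2)[OF p, of "f - g" g] seminormD(2)[OF p, of "g - f" f] m by (auto simp: free_alg_diff)
  with m show ?thesis by simp
qed

text \<open>
  The matrix units satisfy the relations, so that equivalent elements have the same image under \<open>rep\<close>.
\<close>

lemma norm_rep_seminorm: "(\<lambda>f. norm (rep f)) \<in> ray_seminorms"
proof -
  have mm: "munit a b * munit c d = (if b = c then munit a d else 0)" for a b c d by (rule munit_mult)
  have "rep r = 0" if "r \<in> relators" for r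
    using that unfolding relators_eq
    by (auto simp: rep_diff rep_mult rep_star rep_gen mm elim!: evenE oddE)
  thus ?thesis
    unfolding ray_seminorms_def cstar_seminorm_on_def
    by (auto simp: rep_add rep_scale rep_mult rep_star norm_triangle_ineq norm_scal_mult norm_mult_ineq norm_adj_mult)
qed

lemma eqv_rep: "eqv f g \<Longrightarrow> rep f = rep g"
  using norm_rep_seminorm by (auto simp: eqv_def rep_diff)

section \<open>The relations give matrix units\<close>

abbreviation rangep :: "nat \<Rightarrow> nat star_poly" where "rangep n \<equiv> fwd n * fwd_star n"

lemma eqv_partial_isometry: "eqv (gen e * poly_star (gen e) * gen e) (gen e)"
  by (rule eqvI) (auto simp: relators_eq intro!: free_alg_intros)

lemma eqv_orthogonal:
  assumes "m \<noteq> n"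
  shows "eqv (rangep m * rangep n) 0"
proof (rule eqvI)
  have "rangep m * rangep n \<in> relators"
    unfolding relators_eq
    by (rule UnI1, rule UnI2, rule CollectI, rule exI[of _ "2 * m"], rule exI[of _ "2 * n"]) (use assms in simp)
  thus "rangep m * rangep n - 0 \<in> relators" by simp
qed (auto intro!: free_alg_intros)

lemma eqv_fwd_star_fwd: "eqv (fwd_star n * fwd n) (rangep (Suc n))"
proof (rule eqvI)
  have "fwd_star n * fwd n - rangep (Suc n) = poly_star (gen (2*n)) * gen (2*n) - (if even (2*n) then gen (2*n + 2) * poly_star (gen (2*n + 2))
        else if 2*n = 1 then 0 else gen (2*n - 2) * poly_star (gen (2*n - 2)))" by simp
  also have "\<dots> \<in> relators" unfolding relators_eq by blast
  finally show "fwd_star n * fwd n - rangep (Suc n) \<in> relators" .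
qed (auto intro!: free_alg_intros)

lemma eqv_null_of_square: 
  assumes "f \<in> free_alg" "eqv (poly_star f * f) 0"
  shows "eqv f 0"
proof -
  have "p f = 0" if p: "p \<in> ray_seminorms" for p
    using eqv_seminorm[OF assms(2) p] seminormD(5)[OF p assms(1)] seminorm_zero[OF p] by simp
  thus ?thesis using assms(1) by (simp add: eqv_def free_alg_zero)
qed

text \<open>
  No path without turning back continues beyond the vertex \<open>0\<close>, which kills the edge \<open>1\<close>; the source
  projection of every later edge towards \<open>0\<close> is the range projection of the one before.
\<close>

lemma eqv_backward_edge: "eqv (gen (2 * n + 1)) 0"
proof (induction n)
  case 0
  have "eqv (poly_star (gen 1) * gen 1) (0 :: nat star_poly)"
  proof (rule eqvI)
    have "poly_star (gen 1) * gen 1 - 0 = poly_star (gen 1) * gen 1 - (if even (1::nat) then gen (1 + 2) * poly_star (gen (1 + 2))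
        else if (1::nat) = 1 then 0 else gen (1 - 2) * poly_star (gen (1 - 2)))" by simp
    also have "\<dots> \<in> relators" unfolding relators_eq by blast
    finally show "poly_star (gen 1) * gen 1 - 0 \<in> relators" .
  qed (auto intro!: free_alg_intros)
  from eqv_null_of_square[OF gen_free_alg this] show ?case by simp
next
  case (Suc n)
  let ?e = "2 * Suc n + 1"
  have "eqv (poly_star (gen ?e) * gen ?e) (gen (2 * n + 1) * poly_star (gen (2 * n + 1)))"
  proof (rule eqvI)
    have "poly_star (gen ?e) * gen ?e - gen (2 * n + 1) * poly_star (gen (2 * n + 1)) =
      poly_star (gen ?e) * gen ?e - (if even ?e then gen (?e + 2) * poly_star (gen (?e + 2))
        else if ?e = 1 then 0 else gen (?e - 2) * poly_star (gen (?e - 2)))" by simp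
    also have "\<dots> \<in> relators" unfolding relators_eq by blast
    finally show "poly_star (gen ?e) * gen ?e - gen (2 * n + 1) * poly_star (gen (2 * n + 1)) \<in> relators" .
  qed (auto intro!: free_alg_intros)
  also have "eqv \<dots> (0 * poly_star (gen (2 * n + 1)))"
    by (intro eqv_mult Suc eqv_refl free_alg_intros)
  finally have "eqv (poly_star (gen ?e) * gen ?e) 0" by simp
  thus ?case by (rule eqv_null_of_square[OF gen_free_alg])
qed

text \<open>
  The elements of the first column of the matrix, from which all matrix units are obtained as
  products. Multiplication rules for them are proved by induction along the ray.
\<close>

fun column :: "nat \<Rightarrow> nat star_poly" where
  "column 0 = rangep 0"
| "column (Suc n) = fwd_star n * column n"

lemma col_free_alg: "column n \<in> free_alg"
  by (induction n) (auto intro!: free_alg_intros)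

lemmas mem_intros = free_alg_intros col_free_alg

lemma rangep_star [simp]: "poly_star (rangep n) = rangep n"
  by (simp add: poly_star_mult)

lemma eqv_rangep_idem: "eqv (rangep n * rangep n) (rangep n)"
proof -
  have "rangep n * rangep n = (gen (2*n) * poly_star (gen (2*n)) * gen (2*n)) * fwd_star n" by (simp only: mult.assoc)
  also have "eqv \<dots> (fwd n * fwd_star n)" by (intro eqv_mult eqv_partial_isometry eqv_refl mem_intros)
  finally show ?thesis .
qed

lemma eqv_rangep_col: "eqv (rangep n * column n) (column n)"
proof (induction n)
  case 0
  show ?case using eqv_rangep_idem[of 0] by simp
next
  case (Suc n)
  have "eqv (rangep (Suc n) * column (Suc n)) ((fwd_star n * fwd n) * column (Suc n))"
    by (intro eqv_mult eqv_sym[OF eqv_fwd_star_fwd] eqv_refl mem_intros)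
  also have "(fwd_star n * fwd n) * column (Suc n) = fwd_star n * (rangep n * column n)" by (simp add: mult.assoc)
  also have "eqv \<dots> (fwd_star n * column n)" by (intro eqv_mult Suc eqv_refl mem_intros)
  finally show ?case by simp
qed

lemma eqv_col_star_col: "eqv (poly_star (column n) * column n) (rangep 0)"
proof (induction n)
  case 0
  show ?case using eqv_rangep_idem[of 0] by (simp add: poly_star_mult)
next
  case (Suc n)
  have "poly_star (column (Suc n)) * column (Suc n) = poly_star (column n) * (rangep n * column n)"
    by (simp add: poly_star_mult mult.assoc)
  also have "eqv \<dots> (poly_star (column n) * column n)" by (intro eqv_mult eqv_rangep_col eqv_refl mem_intros)
  also note Suc
  finally show ?case .
qed

lemma eqv_col_orthogonal:
  assumes "m \<noteq> n"
  shows "eqv (poly_star (column m) * column n) 0"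
proof -
  have "eqv (poly_star (column m) * column n) (poly_star (rangep m * column m) * (rangep n * column n))"
    by (intro eqv_mult eqv_star eqv_sym[OF eqv_rangep_col])
  also have "poly_star (rangep m * column m) = poly_star (column m) * rangep m"
    by (simp only: poly_star_mult[of "rangep m"] rangep_star)
  also have "poly_star (column m) * rangep m * (rangep n * column n) =
      poly_star (column m) * (rangep m * rangep n) * column n" by (simp only: mult.assoc)
  also have "eqv \<dots> (poly_star (column m) * 0 * column n)"
    by (intro eqv_mult eqv_orthogonal[OF assms] eqv_refl mem_intros)
  finally show ?thesis by simp
qed

lemma eqv_col_col_star: "eqv (column n * poly_star (column n)) (rangep n)"
proof (induction n)
  case 0
  show ?case using eqv_rangep_idem[of 0] by (simp add: poly_star_mult)
next
  case (Suc n)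
  have "column (Suc n) * poly_star (column (Suc n)) = fwd_star n * (column n * poly_star (column n)) * fwd n"
    by (simp add: poly_star_mult mult.assoc)
  also have "eqv \<dots> (fwd_star n * rangep n * fwd n)" by (intro eqv_mult Suc eqv_refl mem_intros)
  also have "fwd_star n * rangep n * fwd n = fwd_star n * (gen (2*n) * poly_star (gen (2*n)) * gen (2*n))" by (simp only: mult.assoc)
  also have "eqv \<dots> (fwd_star n * fwd n)" by (intro eqv_mult eqv_partial_isometry eqv_refl mem_intros)
  also note eqv_fwd_star_fwd
  finally show ?case .
qed

definition unit_poly :: "nat \<Rightarrow> nat \<Rightarrow> nat star_poly" where
  "unit_poly a b = column a * poly_star (column b)"

lemma unit_poly_free_alg: "unit_poly a b \<in> free_alg"
  unfolding unit_poly_def by (intro mem_intros)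

lemma unit_poly_star: "poly_star (unit_poly a b) = unit_poly b a"
  by (simp add: unit_poly_def poly_star_mult)

text \<open>
  All generators are matrix units, hence so are all nonzero words in them.
\<close>

lemma eqv_forward_edge: "eqv (fwd n) (unit_poly n (Suc n))"
proof -
  have "eqv (fwd n) (gen (2*n) * poly_star (gen (2*n)) * gen (2*n))" by (rule eqv_sym[OF eqv_partial_isometry])
  also have "eqv \<dots> (column n * poly_star (column n) * fwd n)"
    by (intro eqv_mult eqv_sym[OF eqv_col_col_star] eqv_refl mem_intros)
  also have "column n * poly_star (column n) * fwd n = unit_poly n (Suc n)"
    by (simp add: unit_poly_def poly_star_mult mult.assoc)
  finally show ?thesis .
qed

lemma eqv_col_rangep: "eqv (column n * rangep 0) (column n)"
proof (induction n)
  case 0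
  show ?case using eqv_rangep_idem[of 0] by simp
next
  case (Suc n)
  have "column (Suc n) * rangep 0 = fwd_star n * (column n * rangep 0)" by (simp add: mult.assoc)
  also have "eqv \<dots> (fwd_star n * column n)" by (intro eqv_mult Suc eqv_refl mem_intros)
  finally show ?case by simp
qed

lemma eqv_unit_poly_mult: "eqv (unit_poly a b * unit_poly c d) (if b = c then unit_poly a d else 0)"
proof -
  have eq: "unit_poly a b * unit_poly c d = column a * (poly_star (column b) * column c) * poly_star (column d)"
    by (simp add: unit_poly_def mult.assoc)
  show ?thesis
  proof (cases "b = c")
    case True
    have "eqv (column a * (poly_star (column b) * column c) * poly_star (column d)) (column a * rangep 0 * poly_star (column d))"
      unfolding True by (intro eqv_mult eqv_col_star_col eqv_refl mem_intros)
    also have "eqv \<dots> (column a * poly_star (column d))" by (intro eqv_mult eqv_col_rangep eqv_refl mem_intros)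
    finally show ?thesis unfolding eq using True by (simp add: unit_poly_def)
  next
    case False
    have "eqv (column a * (poly_star (column b) * column c) * poly_star (column d)) (column a * 0 * poly_star (column d))"
      by (intro eqv_mult eqv_col_orthogonal[OF False] eqv_refl mem_intros)
    thus ?thesis unfolding eq using False by simp
  qed
qed

lemma rep_unit_poly: "rep (unit_poly a b) = munit a b"
proof -
  have "rep (column n) = munit n 0" for n
    by (induction n) (simp_all add: rep_mult rep_star rep_gen munit_mult)
  thus ?thesis by (simp add: unit_poly_def rep_mult rep_star munit_mult)
qed

text \<open>
  A projection has seminorm \<open>0\<close> or \<open>1\<close> by the C*-identity, and the square of the seminorm of a column is the
  seminorm of such a projection.
\<close>

lemma seminorm_unit_poly_le:
  assumes p: "p \<in> ray_seminorms"
  shows "p (unit_poly a b) \<le> 1"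
proof -
  have m: "rangep 0 \<in> free_alg" by (intro mem_intros)
  have "(p (rangep 0))\<^sup>2 = p (rangep 0)"
    using seminormD(5)[OF p m, unfolded rangep_star] eqv_seminorm[OF eqv_rangep_idem p, of 0] by simp
  hence P: "p (rangep 0) \<le> 1" by (auto simp: power2_eq_square)
  have c: "p (column n) \<le> 1" for n
  proof (rule power2_le_imp_le)
    show "(p (column n))\<^sup>2 \<le> 1\<^sup>2"
      using seminormD(5)[OF p col_free_alg, of n] eqv_seminorm[OF eqv_col_star_col p, of n] P by simp
  qed simp
  have "p (unit_poly a b) \<le> p (column a) * p (poly_star (column b))"
    unfolding unit_poly_def by (rule seminormD(4)[OF p]) (intro mem_intros)+
  also have "\<dots> \<le> 1 * 1"
    using c seminormD(1)[OF p] by (intro mult_mono) (auto simp: seminorm_star[OF p] col_free_alg free_alg_star)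
  finally show ?thesis by simp
qed

section \<open>Normal forms and the universal norm\<close>

definition lin :: "nat \<Rightarrow> (nat \<Rightarrow> nat \<Rightarrow> complex) \<Rightarrow> nat star_poly" where
  "lin N m = (\<Sum>a<N. \<Sum>b<N. poly_scale (m a b) (unit_poly a b))"

lemma lin_induct:
  assumes "P 0" "\<And>f g. P f \<Longrightarrow> P g \<Longrightarrow> P (f + g)" "\<And>c f. P f \<Longrightarrow> P (poly_scale c f)"
    "\<And>a b. a < N \<Longrightarrow> b < N \<Longrightarrow> P (unit_poly a b)"
  shows "P (lin N m)"
proof -
  have sum: "P (\<Sum>i\<in>I. f i)" if "\<And>i. i \<in> I \<Longrightarrow> P (f i)" for I :: "nat set" and f
    using that by (induction I rule: infinite_finite_induct) (auto intro: assms)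
  show ?thesis unfolding lin_def by (intro sum assms) auto
qed

lemma lin_add: "lin N m + lin N m' = lin N (\<lambda>a b. m a b + m' a b)"
  by (simp add: lin_def poly_scale_add_left sum.distrib)

lemma poly_scale_sum: "poly_scale c (\<Sum>i\<in>I. f i) = (\<Sum>i\<in>I. poly_scale c (f i))"
  by (simp add: poly_scale_conv sum_distrib_left)

lemma lin_scale: "poly_scale c (lin N m) = lin N (\<lambda>a b. c * m a b)"
  by (simp add: lin_def poly_scale_sum poly_scale_assoc)

lemma lin_zero: "lin N (\<lambda>_ _. 0) = 0"
  by (simp add: lin_def)

lemma lin_unit:
  assumes "a < N" "b < N"
  shows "lin N (\<lambda>i j. if i = a \<and> j = b then 1 else 0) = unit_poly a b"
proof -
  have "lin N (\<lambda>i j. if i = a \<and> j = b then 1 else 0) =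
      (\<Sum>i<N. \<Sum>j<N. if i = a then if j = b then unit_poly a b else 0 else 0)"
    unfolding lin_def by (intro sum.cong) auto
  also have "\<dots> = (\<Sum>i<N. if i = a then \<Sum>j<N. if j = b then unit_poly a b else 0 else 0)"
    by (intro sum.cong) auto
  finally show ?thesis using assms by simp
qed

text \<open>
  The bound \<open>N\<close> is fixed because products of elements with this property have it for the same \<open>N\<close>. That makes the
  constant \<open>N\<^sup>2\<close> below uniform over all powers of an element.
\<close>

definition normalizable :: "nat \<Rightarrow> nat star_poly \<Rightarrow> bool" where
  "normalizable N f \<longleftrightarrow> (\<exists>m. eqv f (lin N m))"

lemma normalizable_eqv: "eqv f g \<Longrightarrow> normalizable N g \<Longrightarrow> normalizable N f"
  unfolding normalizable_def by (meson eqv_trans)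

lemma normalizable_mem: "normalizable N f \<Longrightarrow> f \<in> free_alg"
  by (auto simp: normalizable_def eqv_mem)

lemma normalizable_zero: "normalizable N 0"
  unfolding normalizable_def by (rule exI[of _ "\<lambda>_ _. 0"]) (simp add: lin_zero eqv_refl free_alg_zero)

lemma normalizable_add: "normalizable N f \<Longrightarrow> normalizable N g \<Longrightarrow> normalizable N (f + g)"
  unfolding normalizable_def by (metis eqv_add lin_add)

lemma normalizable_scale: "normalizable N f \<Longrightarrow> normalizable N (poly_scale c f)"
  unfolding normalizable_def by (metis eqv_scale lin_scale)

lemma normalizable_unit: "a < N \<Longrightarrow> b < N \<Longrightarrow> normalizable N (unit_poly a b)"
  unfolding normalizable_def by (metis eqv_refl lin_unit unit_poly_free_alg)

lemma normalizable_mult: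
  assumes "normalizable N f" "normalizable N g"
  shows "normalizable N (f * g)"
proof -
  obtain m m' where m: "eqv f (lin N m)" "eqv g (lin N m')" using assms by (auto simp: normalizable_def)
  have "normalizable N (unit_poly a b * lin N m')" if ab: "a < N" "b < N" for a b
  proof (rule lin_induct[where P = "\<lambda>g. normalizable N (unit_poly a b * g)"])
    show "normalizable N (unit_poly a b * unit_poly c d)" if "c < N" "d < N" for c d
      by (rule normalizable_eqv[OF eqv_unit_poly_mult]) (use ab that in \<open>auto intro: normalizable_unit normalizable_zero\<close>)
  qed (simp_all add: normalizable_zero normalizable_add normalizable_scale distrib_left poly_scale_mult_right)
  hence "normalizable N (lin N m * lin N m')"
    by (intro lin_induct[where P = "\<lambda>f. normalizable N (f * lin N m')"])
      (simp_all add: normalizable_zero normalizable_add normalizable_scale distrib_right poly_scale_mult_left)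
  thus ?thesis by (rule normalizable_eqv[OF eqv_mult[OF m]])
qed

lemma normalizable_star:
  assumes "normalizable N f"
  shows "normalizable N (poly_star f)"
proof -
  obtain m where m: "eqv f (lin N m)" using assms by (auto simp: normalizable_def)
  have sc: "poly_star (poly_scale c f) = poly_scale (cnj c) (poly_star f)" for c and f :: "nat star_poly"
  proof -
    have "poly_star (poly_scale c f) = poly_star f * Poly_Mapping.single 0 (cnj c)"
      by (simp add: poly_scale_conv poly_star_mult poly_star_single word_star_def zero_star_word_def)
    thus ?thesis by (simp add: single_0_central poly_scale_conv)
  qed
  have "normalizable N (poly_star (lin N m))"
    by (intro lin_induct[where P = "\<lambda>f. normalizable N (poly_star f)"])
      (simp_all add: normalizable_zero normalizable_add normalizable_scale poly_star_add sc unit_poly_star normalizable_unit)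
  thus ?thesis by (rule normalizable_eqv[OF eqv_star[OF m]])
qed

lemma normalizable_mono:
  assumes "normalizable M f" "M \<le> N"
  shows "normalizable N f"
proof -
  obtain m where m: "eqv f (lin M m)" using assms by (auto simp: normalizable_def)
  have "normalizable N (lin M m)"
    by (rule lin_induct) (use assms(2) in \<open>auto intro: normalizable_zero normalizable_add normalizable_scale normalizable_unit\<close>)
  thus ?thesis by (rule normalizable_eqv[OF m])
qed

lemma normalizable_gen: "\<exists>N. normalizable N (gen e)"
proof (cases "even e")
  case True
  then obtain n where n: "e = 2 * n" by blast
  have "normalizable (n + 2) (gen e)"
    unfolding n by (rule normalizable_eqv[OF eqv_forward_edge]) (rule normalizable_unit; simp)
  thus ?thesis by blast
next
  case False
  then obtain n where n: "e = 2 * n + 1" by (blast elim: oddE)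
  have "normalizable 0 (gen e)"
    unfolding n by (rule normalizable_eqv[OF eqv_backward_edge normalizable_zero])
  thus ?thesis by blast
qed

lemma normalizable_letter: "\<exists>N. normalizable N (Poly_Mapping.single (Word [x]) 1)"
proof -
  obtain e b where x: "x = (e, b)" by fastforce
  have "Poly_Mapping.single (Word [x]) 1 = (if b then poly_star (gen e) else gen e)"
    by (simp add: x gen_def poly_star_single word_star_def)
  thus ?thesis using normalizable_gen[of e] normalizable_star by (cases b) auto
qed

lemma normalizable_two:
  assumes "\<exists>N. normalizable N f" "\<exists>N. normalizable N g"
  obtains N where "normalizable N f" "normalizable N g"
proof -
  from assms obtain M N where "normalizable M f" "normalizable N g" by blast
  hence "normalizable (max M N) f" "normalizable (max M N) g" by (auto intro: normalizable_mono)
  thus ?thesis by (rule that)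
qed

lemma normalizable_word:
  assumes "xs \<noteq> []"
  shows "\<exists>N. normalizable N (Poly_Mapping.single (Word xs) 1)"
  using assms
proof (induction xs rule: list_nonempty_induct)
  case (single x)
  show ?case by (rule normalizable_letter)
next
  case (cons x xs)
  obtain N where "normalizable N (Poly_Mapping.single (Word [x]) 1)" "normalizable N (Poly_Mapping.single (Word xs) 1)"
    using normalizable_two[OF normalizable_letter cons.IH] .
  hence "normalizable N (Poly_Mapping.single (Word [x]) 1 * Poly_Mapping.single (Word xs) 1)" by (rule normalizable_mult)
  thus ?case by (auto simp: mult_single plus_star_word_def)
qed

lemma normalizable:
  assumes "f \<in> free_alg"
  shows "\<exists>N. normalizable N f"
proof (rule star_poly_induct[of "\<lambda>f. \<exists>N. normalizable N f" f])
  show "\<exists>N. normalizable N 0" using normalizable_zero by blast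
  show "\<exists>N. normalizable N (f + g)" if "\<exists>N. normalizable N f" "\<exists>N. normalizable N g" for f g
    using normalizable_two[OF that] normalizable_add by metis
  show "\<exists>N. normalizable N (Poly_Mapping.single w c)" if "w \<in> Poly_Mapping.keys f" for w c
  proof -
    have "letters w \<noteq> []" using that assms by (simp add: free_alg_iff)
    then obtain N where "normalizable N (Poly_Mapping.single w 1)" using normalizable_word[of "letters w"] by auto
    from normalizable_scale[OF this, of c] show ?thesis by (auto simp: poly_scale_single)
  qed
qed

lemma rep_lin: "rep (lin N m) = (\<Sum>a<N. \<Sum>b<N. scal (m a b) * munit a b)"
  by (simp add: lin_def rep_sum rep_scale rep_unit_poly)

lemma lin_coefficient_le:
  assumes "a < N" "b < N"
  shows "cmod (m a b) \<le> norm (rep (lin N m))"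
proof -
  have "munit a a * (scal c * munit i j) * munit b b = (if i = a then if j = b then scal c * munit a b else 0 else 0)" for c i j
    unfolding scal_sandwich by (simp add: munit_mult)
  hence "munit a a * rep (lin N m) * munit b b = (\<Sum>i<N. \<Sum>j<N. if i = a then if j = b then scal (m i j) * munit a b else 0 else 0)"
    unfolding rep_lin by (simp add: sum_distrib_left sum_distrib_right)
  also have "\<dots> = (\<Sum>i<N. if i = a then \<Sum>j<N. if j = b then scal (m i j) * munit a b else 0 else 0)"
    by (intro sum.cong) auto
  also have "\<dots> = scal (m a b) * munit a b" using assms by simp
  finally have "cmod (m a b) = norm (munit a a * rep (lin N m) * munit b b)"
    by (simp add: norm_scal_mult)
  also have "\<dots> \<le> norm (munit a a) * norm (rep (lin N m)) * norm (munit b b)"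
    by (meson mult_right_mono norm_ge_zero norm_mult_ineq order_trans)
  finally show ?thesis by simp
qed

lemma seminorm_sum_le:
  assumes p: "p \<in> ray_seminorms" and "finite I" "\<And>i. i \<in> I \<Longrightarrow> f i \<in> free_alg"
  shows "p (\<Sum>i\<in>I. f i) \<le> (\<Sum>i\<in>I. p (f i))"
  using assms(2,3)
proof (induction I)
  case (insert i I)
  have "p (f i + (\<Sum>i\<in>I. f i)) \<le> p (f i) + p (\<Sum>i\<in>I. f i)"
    by (rule seminormD(2)[OF p]) (use insert in \<open>auto intro: free_alg_sum\<close>)
  thus ?case using insert by force
qed (simp add: seminorm_zero[OF p])

text \<open>
  A crude bound, with a constant that depends on the size of the matrices only.
\<close>

lemma normalizable_seminorm_le:
  assumes "normalizable N f" and p: "p \<in> ray_seminorms"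
  shows "p f \<le> (real N)\<^sup>2 * norm (rep f)"
proof -
  obtain m where m: "eqv f (lin N m)" using assms by (auto simp: normalizable_def)
  have "p (lin N m) \<le> (\<Sum>a<N. \<Sum>b<N. p (poly_scale (m a b) (unit_poly a b)))"
    unfolding lin_def
    by (intro order_trans[OF seminorm_sum_le[OF p] sum_mono] seminorm_sum_le[OF p]) (auto intro!: free_alg_intros unit_poly_free_alg)
  also have "\<dots> \<le> (\<Sum>a<N. \<Sum>b<N. norm (rep (lin N m)) * 1)"
    unfolding seminormD(3)[OF p unit_poly_free_alg]
    by (intro sum_mono mult_mono lin_coefficient_le seminorm_unit_poly_le[OF p] seminormD(1)[OF p unit_poly_free_alg]) auto
  also have "\<dots> = (real N)\<^sup>2 * norm (rep (lin N m))" by (simp add: power2_eq_square)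
  finally show ?thesis using eqv_seminorm[OF m p] eqv_rep[OF m] by simp
qed

fun repeated_square :: "nat star_poly \<Rightarrow> nat \<Rightarrow> nat star_poly" where
  "repeated_square g 0 = g"
| "repeated_square g (Suc k) = repeated_square g k * repeated_square g k"

text \<open>
  On selfadjoint elements both sides turn repeated squares into powers, so the crude bound holds for
  \<open>p (f\<^sup>* f)\<close> and \<open>norm (rep (f\<^sup>* f))\<close> raised to arbitrarily high powers with one and the same constant, and the constant
  disappears in the limit.
\<close>

theorem seminorm_le_norm_rep:
  assumes f: "f \<in> free_alg" and p: "p \<in> ray_seminorms"
  shows "p f \<le> norm (rep f)"
proof -
  let ?g = "poly_star f * f"
  have g: "?g \<in> free_alg" using f by (intro mem_intros)
  obtain N where N: "normalizable N ?g" using normalizable[OF g] by blast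
  let ?s = "repeated_square ?g"
  have star: "poly_star (?s k) = ?s k" for k
    by (induction k) (simp_all add: poly_star_mult)
  have nf: "normalizable N (?s k)" for k
    by (induction k) (simp_all add: N normalizable_mult)
  have ps: "p (?s k) = p ?g ^ (2 ^ k)" for k
  proof (induction k)
    case (Suc k)
    have "p (?s (Suc k)) = p (poly_star (?s k) * ?s k)" by (simp add: star)
    also have "\<dots> = (p (?s k))\<^sup>2" by (rule seminormD(5)[OF p normalizable_mem[OF nf]])
    finally show ?case using Suc by (simp add: power_mult[symmetric] mult.commute)
  qed simp
  have rs: "norm (rep (?s k)) \<le> norm (rep ?g) ^ (2 ^ k)" for k
  proof (induction k)
    case (Suc k)
    have "norm (rep (?s (Suc k))) \<le> norm (rep (?s k)) * norm (rep (?s k))" by (simp add: rep_mult norm_mult_ineq)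
    also have "\<dots> \<le> norm (rep ?g) ^ (2 ^ k) * norm (rep ?g) ^ (2 ^ k)" using Suc by (intro mult_mono) auto
    finally show ?case by (simp add: mult_2 power_add)
  qed simp
  have bound: "p ?g ^ (2 ^ k) \<le> (real N)\<^sup>2 * norm (rep ?g) ^ (2 ^ k)" for k
  proof -
    have "p ?g ^ (2 ^ k) \<le> (real N)\<^sup>2 * norm (rep (?s k))"
      using normalizable_seminorm_le[OF nf p, of k] by (simp only: ps)
    also have "\<dots> \<le> (real N)\<^sup>2 * norm (rep ?g) ^ (2 ^ k)" by (rule mult_left_mono[OF rs]) simp
    finally show ?thesis .
  qed
  have "p ?g \<le> norm (rep ?g)"
  proof (rule ccontr)
    assume "\<not> p ?g \<le> norm (rep ?g)"
    hence lt: "norm (rep ?g) < p ?g" by simp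
    show False
    proof (cases "norm (rep ?g) = 0")
      case True
      thus False using bound[of 0] lt by simp
    next
      case False
      hence pos: "norm (rep ?g) > 0" by (simp only: norm_ge_zero less_le) simp
      define q where "q = p ?g / norm (rep ?g)"
      have q: "q > 1" using lt pos by (simp add: q_def)
      have qk: "q ^ (2 ^ k) \<le> (real N)\<^sup>2" for k
        using bound[of k] pos by (simp add: q_def power_divide pos_divide_le_eq)
      \<comment> \<open>The powers of a number above 1 exceed the constant.\<close>
      obtain k where "(real N)\<^sup>2 < q ^ k" using real_arch_pow[OF q] by blast
      also have "q ^ k \<le> q ^ (2 ^ k)" using q by (intro power_increasing) (auto simp: less_imp_le)
      finally show False using qk[of k] by simp
    qed
  qed
  hence "(p f)\<^sup>2 \<le> (norm (rep f))\<^sup>2"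
    using seminormD(5)[OF p f] by (simp add: rep_mult rep_star norm_adj_mult)
  thus ?thesis by (rule power2_le_imp_le) simp
qed

theorem universal_norm_ray:
  assumes "f \<in> free_alg"
  shows "universal_norm UNIV relators f = norm (rep f)"
  unfolding universal_norm_def ray_seminorms_def[symmetric]
  by (rule cSup_eq_maximum) (use norm_rep_seminorm seminorm_le_norm_rep[OF assms] in auto)

lemma rep_finite_rank: "f \<in> free_alg \<Longrightarrow> rep f \<in> finite_rank"
proof -
  assume "f \<in> free_alg"
  then obtain N m where "eqv f (lin N m)" using normalizable[of f] unfolding normalizable_def by blast
  hence "rep f = rep (lin N m)" by (rule eqv_rep)
  thus ?thesis unfolding rep_lin
    by (auto intro!: subspace_sum[OF finite_rank_subspace] finite_rank_scal munit_finite_rank)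
qed

lemma finite_rank_rep: "x \<in> finite_rank \<Longrightarrow> \<exists>f\<in>free_alg. rep f = x"
proof (induction rule: finite_rank_induct)
  case zero
  show ?case by (rule bexI[of _ 0]) (simp_all add: free_alg_zero)
next
  case (add x y)
  thus ?case using free_alg_add rep_add by metis
next
  case (scale c x)
  thus ?case using free_alg_scale rep_scale by metis
next
  case (munit a b)
  show ?case by (rule bexI[of _ "unit_poly a b"]) (simp_all add: rep_unit_poly unit_poly_free_alg)
qed

section \<open>The C*-algebra of the ray\<close>

abbreviation ray_cstar :: "(nat \<Rightarrow> nat star_poly) set star_alg" where
  "ray_cstar \<equiv> graph_cstar ray ray_rev"

text \<open>
  The element of the completion that corresponds to the compact operator \<open>z\<close>.
\<close>

definition limit_class :: "cop \<Rightarrow> (nat \<Rightarrow> nat star_poly) set" where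
  "limit_class z = {X. (\<forall>n. X n \<in> free_alg) \<and> (\<lambda>n. rep (X n)) \<longlonglongrightarrow> z}"

lemma cauchy_seqs_ray:
  "X \<in> cauchy_seqs UNIV relators \<longleftrightarrow> (\<forall>n. X n \<in> free_alg) \<and> Cauchy (\<lambda>n. rep (X n))"
proof (cases "\<forall>n. X n \<in> free_alg")
  case True
  hence "universal_norm UNIV relators (X m - X n) = dist (rep (X m)) (rep (X n))" for m n
    by (simp add: universal_norm_ray free_alg_diff rep_diff dist_norm)
  thus ?thesis using True by (simp add: cauchy_seqs_def Cauchy_def)
qed (auto simp: cauchy_seqs_def)

lemma limit_class_cauchy: "X \<in> limit_class z \<Longrightarrow> X \<in> cauchy_seqs UNIV relators"
  unfolding cauchy_seqs_ray limit_class_def using LIMSEQ_imp_Cauchy by blast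

lemma cauchy_limit_class:
  assumes "X \<in> cauchy_seqs UNIV relators"
  obtains z where "z \<in> compact_ops" "X \<in> limit_class z"
proof -
  have X: "\<And>n. X n \<in> free_alg" "Cauchy (\<lambda>n. rep (X n))" using assms by (auto simp: cauchy_seqs_ray)
  then obtain z where z: "(\<lambda>n. rep (X n)) \<longlonglongrightarrow> z" by (meson Cauchy_convergent convergent_def)
  have "z \<in> compact_ops"
    by (rule closed_sequentially[OF closed_compact_ops _ z]) (rule finite_rank_compact[OF rep_finite_rank[OF X(1)]])
  thus ?thesis using that X z by (simp add: limit_class_def)
qed

lemma limit_class_nonempty:
  assumes "z \<in> compact_ops"
  obtains X where "X \<in> limit_class z"
proof -
  obtain x where x: "\<And>n. x n \<in> finite_rank" "x \<longlonglongrightarrow> z"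
    using assms unfolding compact_ops_def closure_sequential by blast
  have "\<forall>n. \<exists>f\<in>free_alg. rep f = x n" using finite_rank_rep x(1) by blast
  then obtain X where "\<And>n. X n \<in> free_alg" "\<And>n. rep (X n) = x n" by metis
  thus ?thesis using that[of X] x(2) by (simp add: limit_class_def)
qed

lemma null_rel_Image:
  assumes "X \<in> limit_class z"
  shows "null_rel UNIV relators `` {X} = limit_class z"
proof (rule Set.set_eqI)
  fix Y
  have X: "\<And>n. X n \<in> free_alg" "(\<lambda>n. rep (X n)) \<longlonglongrightarrow> z" using assms by (auto simp: limit_class_def)
  show "Y \<in> null_rel UNIV relators `` {X} \<longleftrightarrow> Y \<in> limit_class z"
  proof
    assume "Y \<in> null_rel UNIV relators `` {X}"
    hence Y: "Y \<in> cauchy_seqs UNIV relators" and lim: "(\<lambda>n. universal_norm UNIV relators (X n - Y n)) \<longlonglongrightarrow> 0"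
      by (auto simp: null_rel_def)
    hence Ym: "\<And>n. Y n \<in> free_alg" by (simp add: cauchy_seqs_ray)
    hence "(\<lambda>n. norm (rep (X n) - rep (Y n))) \<longlonglongrightarrow> 0"
      using lim X by (simp add: universal_norm_ray free_alg_diff rep_diff)
    hence "(\<lambda>n. rep (X n) - rep (Y n)) \<longlonglongrightarrow> 0" by (rule tendsto_norm_zero_cancel)
    from tendsto_diff[OF X(2) this] show "Y \<in> limit_class z" using Ym by (simp add: limit_class_def)
  next
    assume Y: "Y \<in> limit_class z"
    hence Ym: "\<And>n. Y n \<in> free_alg" and Yl: "(\<lambda>n. rep (Y n)) \<longlonglongrightarrow> z" by (auto simp: limit_class_def)
    have "(\<lambda>n. norm (rep (X n) - rep (Y n))) \<longlonglongrightarrow> 0"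
      using tendsto_norm[OF tendsto_diff[OF X(2) Yl]] by simp
    hence "(\<lambda>n. universal_norm UNIV relators (X n - Y n)) \<longlonglongrightarrow> 0"
      using X Ym by (simp add: universal_norm_ray free_alg_diff rep_diff)
    thus "Y \<in> null_rel UNIV relators `` {X}"
      using limit_class_cauchy[OF assms] limit_class_cauchy[OF Y] by (simp add: null_rel_def)
  qed
qed

lemma limit_class_inject: "z \<in> compact_ops \<Longrightarrow> limit_class z = limit_class w \<Longrightarrow> z = w"
proof -
  assume "z \<in> compact_ops" and eq: "limit_class z = limit_class w"
  then obtain X where "X \<in> limit_class z" using limit_class_nonempty by blast
  with eq have "X \<in> limit_class z" "X \<in> limit_class w" by auto
  thus "z = w" by (auto simp: limit_class_def intro: LIMSEQ_unique)
qed

lemma carrier_ray_cstar: "carrier ray_cstar = limit_class ` compact_ops"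
proof -
  have "carrier ray_cstar = cauchy_seqs UNIV relators // null_rel UNIV relators"
    by (simp add: graph_cstar_def universal_cstar_def Let_def)
  also have "\<dots> = limit_class ` compact_ops"
  proof (rule antisym; rule subsetI)
    fix a assume "a \<in> cauchy_seqs UNIV relators // null_rel UNIV relators"
    then obtain X where X: "X \<in> cauchy_seqs UNIV relators" "a = null_rel UNIV relators `` {X}"
      by (auto elim: quotientE)
    obtain z where "z \<in> compact_ops" "X \<in> limit_class z" using cauchy_limit_class[OF X(1)] .
    thus "a \<in> limit_class ` compact_ops" using X(2) null_rel_Image by auto
  next
    fix a assume "a \<in> limit_class ` compact_ops"
    then obtain z where z: "z \<in> compact_ops" "a = limit_class z" by blast
    obtain X where X: "X \<in> limit_class z" using limit_class_nonempty[OF z(1)] .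
    thus "a \<in> cauchy_seqs UNIV relators // null_rel UNIV relators"
      using quotientI[OF limit_class_cauchy[OF X], of "null_rel UNIV relators"] null_rel_Image[OF X] z(2) by simp
  qed
  finally show ?thesis .
qed

lemma UN_constant_nonempty: "A \<noteq> {} \<Longrightarrow> (\<And>x. x \<in> A \<Longrightarrow> f x = c) \<Longrightarrow> (\<Union>x\<in>A. f x) = c"
  by auto

lemma ray_cstar_mult:
  assumes "z \<in> compact_ops" "w \<in> compact_ops"
  shows "limit_class z \<otimes>\<^bsub>ray_cstar\<^esub> limit_class w = limit_class (z * w)"
proof -
  have "null_rel UNIV relators `` {\<lambda>n. X n * Y n} = limit_class (z * w)"
    if "X \<in> limit_class z" "Y \<in> limit_class w" for X Y
    by (rule null_rel_Image)
      (use that in \<open>auto simp: limit_class_def rep_mult intro!: free_alg_mult tendsto_mult\<close>)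
  moreover have "limit_class z \<noteq> {}" "limit_class w \<noteq> {}" using assms limit_class_nonempty by blast+
  ultimately have "(\<Union>X\<in>limit_class z. \<Union>Y\<in>limit_class w. null_rel UNIV relators `` {\<lambda>n. X n * Y n}) = limit_class (z * w)"
    by (intro UN_constant_nonempty) auto
  thus ?thesis by (simp add: graph_cstar_def universal_cstar_def Let_def)
qed

lemma ray_cstar_add:
  assumes "z \<in> compact_ops" "w \<in> compact_ops"
  shows "limit_class z \<oplus>\<^bsub>ray_cstar\<^esub> limit_class w = limit_class (z + w)"
proof -
  have "null_rel UNIV relators `` {\<lambda>n. X n + Y n} = limit_class (z + w)"
    if "X \<in> limit_class z" "Y \<in> limit_class w" for X Y
    by (rule null_rel_Image)
      (use that in \<open>auto simp: limit_class_def rep_add intro!: free_alg_add tendsto_add\<close>)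
  moreover have "limit_class z \<noteq> {}" "limit_class w \<noteq> {}" using assms limit_class_nonempty by blast+
  ultimately have "(\<Union>X\<in>limit_class z. \<Union>Y\<in>limit_class w. null_rel UNIV relators `` {\<lambda>n. X n + Y n}) = limit_class (z + w)"
    by (intro UN_constant_nonempty) auto
  thus ?thesis by (simp add: graph_cstar_def universal_cstar_def Let_def)
qed

lemma ray_cstar_smult:
  assumes "z \<in> compact_ops"
  shows "c \<odot>\<^bsub>ray_cstar\<^esub> limit_class z = limit_class (scal c * z)"
proof -
  have "null_rel UNIV relators `` {\<lambda>n. poly_scale c (X n)} = limit_class (scal c * z)"
    if "X \<in> limit_class z" for X
    by (rule null_rel_Image)
      (use that in \<open>auto simp: limit_class_def rep_scale intro!: free_alg_scale tendsto_mult\<close>)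
  moreover have "limit_class z \<noteq> {}" using assms limit_class_nonempty by blast
  ultimately have "(\<Union>X\<in>limit_class z. null_rel UNIV relators `` {\<lambda>n. poly_scale c (X n)}) = limit_class (scal c * z)"
    by (intro UN_constant_nonempty) auto
  thus ?thesis by (simp add: graph_cstar_def universal_cstar_def Let_def)
qed

lemma ray_cstar_star:
  assumes "z \<in> compact_ops"
  shows "star ray_cstar (limit_class z) = limit_class (adj z)"
proof -
  have "null_rel UNIV relators `` {\<lambda>n. poly_star (X n)} = limit_class (adj z)"
    if "X \<in> limit_class z" for X
    by (rule null_rel_Image)
      (use that in \<open>auto simp: limit_class_def rep_star intro!: free_alg_star continuous_adj\<close>)
  moreover have "limit_class z \<noteq> {}" using assms limit_class_nonempty by blast
  ultimately have "(\<Union>X\<in>limit_class z. null_rel UNIV relators `` {\<lambda>n. poly_star (X n)}) = limit_class (adj z)"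
    by (intro UN_constant_nonempty) auto
  thus ?thesis by (simp add: graph_cstar_def universal_cstar_def Let_def)
qed

lemma ray_cstar_zero: "\<zero>\<^bsub>ray_cstar\<^esub> = limit_class 0"
proof -
  have "null_rel UNIV relators `` {\<lambda>n. 0} = limit_class 0"
    by (rule null_rel_Image) (simp add: limit_class_def free_alg_zero)
  thus ?thesis by (simp add: graph_cstar_def universal_cstar_def Let_def)
qed

lemma ray_cstar_norm:
  assumes "z \<in> compact_ops"
  shows "cnorm ray_cstar (limit_class z) = norm z"
proof -
  obtain X where "X \<in> limit_class z" using limit_class_nonempty[OF assms] .
  hence X: "(SOME X. X \<in> limit_class z) \<in> limit_class z" by (rule someI[of "\<lambda>X. X \<in> limit_class z"])
  define Y where "Y = (SOME X. X \<in> limit_class z)"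
  have Y: "\<And>n. Y n \<in> free_alg" "(\<lambda>n. rep (Y n)) \<longlonglongrightarrow> z" using X by (auto simp: limit_class_def Y_def)
  have "(\<lambda>n. universal_norm UNIV relators (Y n)) \<longlonglongrightarrow> norm z"
    using tendsto_norm[OF Y(2)] by (simp add: universal_norm_ray Y(1))
  hence "lim (\<lambda>n. universal_norm UNIV relators (Y n)) = norm z" by (rule limI)
  thus ?thesis by (simp add: graph_cstar_def universal_cstar_def Let_def Y_def)
qed

section \<open>The unitization\<close>

abbreviation RU :: "((nat \<Rightarrow> nat star_poly) set \<times> complex) star_alg" where
  "RU \<equiv> unitization ray_cstar"

definition limit_of :: "(nat \<Rightarrow> nat star_poly) set \<Rightarrow> cop" where
  "limit_of a = (THE z. z \<in> compact_ops \<and> a = limit_class z)"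

lemma limit_of [simp]: "z \<in> compact_ops \<Longrightarrow> limit_of (limit_class z) = z"
  unfolding limit_of_def by (rule the_equality) (auto dest: limit_class_inject)

definition to_op :: "(nat \<Rightarrow> nat star_poly) set \<times> complex \<Rightarrow> cop" where
  "to_op x = limit_of (fst x) + scal (snd x)"

text \<open>
  The element of the unitization with the operator \<open>z\<close> and the scalar \<open>c\<close>; it corresponds to \<open>z + c\<close>.
\<close>

definition elem :: "cop \<Rightarrow> complex \<Rightarrow> (nat \<Rightarrow> nat star_poly) set \<times> complex" where
  "elem z c = (limit_class z, c)"

lemma to_op_elem [simp]: "z \<in> compact_ops \<Longrightarrow> to_op (elem z c) = z + scal c"
  by (simp add: to_op_def elem_def)

lemma carrier_ray_unitization: "carrier RU = {elem z c | z c. z \<in> compact_ops}"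
  by (auto simp: unitization_def carrier_ray_cstar elem_def)

lemma carrier_cases:
  assumes "x \<in> carrier RU"
  obtains z c where "z \<in> compact_ops" "x = elem z c"
  using assms by (auto simp: carrier_ray_unitization)

lemma ray_unitization_ops:
  assumes "z \<in> compact_ops" "w \<in> compact_ops"
  shows "elem z c \<oplus>\<^bsub>RU\<^esub> elem w d = elem (z + w) (c + d)"
    and "elem z c \<otimes>\<^bsub>RU\<^esub> elem w d = elem (z * w + scal c * w + scal d * z) (c * d)"
    and "star RU (elem z c) = elem (adj z) (cnj c)"
proof -
  note K = subspace_add[OF compact_ops_subspace] compact_ops_mult compact_ops_scal
  show "elem z c \<oplus>\<^bsub>RU\<^esub> elem w d = elem (z + w) (c + d)"
    by (simp add: unitization_def elem_def ray_cstar_add assms)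
  show "elem z c \<otimes>\<^bsub>RU\<^esub> elem w d = elem (z * w + scal c * w + scal d * z) (c * d)"
    by (simp add: unitization_def elem_def ray_cstar_add ray_cstar_mult ray_cstar_smult assms K)
  show "star RU (elem z c) = elem (adj z) (cnj c)"
    by (simp add: unitization_def elem_def ray_cstar_star assms)
qed

lemma ray_unitization_zero: "\<zero>\<^bsub>RU\<^esub> = elem 0 0"
  and ray_unitization_one: "\<one>\<^bsub>RU\<^esub> = elem 0 1"
  by (simp_all add: unitization_def elem_def ray_cstar_zero)

lemma zero_compact: "0 \<in> compact_ops" by (rule subspace_0[OF compact_ops_subspace])

text \<open>
  One inequality between the two norms suffices to turn paths of operators into continuous paths of
  the unitization.
\<close>

lemma ray_unitization_norm_le:
  assumes "x \<in> carrier RU"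
  shows "cnorm RU x \<le> norm (to_op x)"
proof -
  obtain z c where z: "z \<in> compact_ops" and x: "x = elem z c" using carrier_cases[OF assms] .
  let ?B = "{b \<in> carrier ray_cstar. cnorm ray_cstar b \<le> 1}"
  have "(SUP b\<in>?B. cnorm ray_cstar (limit_class z \<otimes>\<^bsub>ray_cstar\<^esub> b \<oplus>\<^bsub>ray_cstar\<^esub> c \<odot>\<^bsub>ray_cstar\<^esub> b)) \<le> norm (z + scal c)"
  proof (rule cSUP_least)
    have "limit_class 0 \<in> ?B" by (simp add: carrier_ray_cstar zero_compact ray_cstar_norm)
    thus "?B \<noteq> {}" by blast
    fix b assume "b \<in> ?B"
    then obtain w where w: "w \<in> compact_ops" "b = limit_class w" "norm w \<le> 1"
      by (auto simp: carrier_ray_cstar ray_cstar_norm)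
    have "cnorm ray_cstar (limit_class z \<otimes>\<^bsub>ray_cstar\<^esub> b \<oplus>\<^bsub>ray_cstar\<^esub> c \<odot>\<^bsub>ray_cstar\<^esub> b) = norm ((z + scal c) * w)"
      using z w by (simp add: ray_cstar_mult ray_cstar_smult ray_cstar_add ray_cstar_norm compact_ops_mult
          compact_ops_scal subspace_add[OF compact_ops_subspace] distrib_right)
    also have "\<dots> \<le> norm (z + scal c) * 1"
      using w(3) by (intro order_trans[OF norm_mult_ineq mult_left_mono]) auto
    finally show "cnorm ray_cstar (limit_class z \<otimes>\<^bsub>ray_cstar\<^esub> b \<oplus>\<^bsub>ray_cstar\<^esub> c \<odot>\<^bsub>ray_cstar\<^esub> b) \<le> norm (z + scal c)" by simp
  qed
  thus ?thesis using scalar_part_bound[OF z, of c] by (simp add: x unitization_def elem_def to_op_def z)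
qed

section \<open>Projections over a *-ring\<close>

hide_const (open) Finite_Cartesian_Product.mat

definition mat_adj :: "('r \<Rightarrow> 'r) \<Rightarrow> 'r mat \<Rightarrow> 'r mat" where
  "mat_adj \<sigma> M = mat (dim_col M) (dim_row M) (\<lambda>(i, j). \<sigma> (M $$ (j, i)))"

text \<open>
  A unital *-algebra given by a carrier, together with an injective *-homomorphism into a ring of
  the type class hierarchy. Identities between matrices hold over that ring, and injectivity
  pulls them back to the carrier.
\<close>

locale star_rep =
  fixes A :: "'a star_alg" and \<phi> :: "'a \<Rightarrow> 'r::ring_1" and \<sigma> :: "'r \<Rightarrow> 'r"
  assumes zero_closed: "\<zero>\<^bsub>A\<^esub> \<in> carrier A"
    and one_closed: "\<one>\<^bsub>A\<^esub> \<in> carrier A"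
    and add_closed: "x \<in> carrier A \<Longrightarrow> y \<in> carrier A \<Longrightarrow> x \<oplus>\<^bsub>A\<^esub> y \<in> carrier A"
    and mult_closed: "x \<in> carrier A \<Longrightarrow> y \<in> carrier A \<Longrightarrow> x \<otimes>\<^bsub>A\<^esub> y \<in> carrier A"
    and star_closed: "x \<in> carrier A \<Longrightarrow> star A x \<in> carrier A"
    and neg_closed: "x \<in> carrier A \<Longrightarrow> \<exists>y\<in>carrier A. \<phi> y = - \<phi> x"
    and hom_zero: "\<phi> \<zero>\<^bsub>A\<^esub> = 0"
    and hom_one: "\<phi> \<one>\<^bsub>A\<^esub> = 1"
    and hom_add: "x \<in> carrier A \<Longrightarrow> y \<in> carrier A \<Longrightarrow> \<phi> (x \<oplus>\<^bsub>A\<^esub> y) = \<phi> x + \<phi> y"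
    and hom_mult: "x \<in> carrier A \<Longrightarrow> y \<in> carrier A \<Longrightarrow> \<phi> (x \<otimes>\<^bsub>A\<^esub> y) = \<phi> x * \<phi> y"
    and hom_star: "x \<in> carrier A \<Longrightarrow> \<phi> (star A x) = \<sigma> (\<phi> x)"
    and hom_inj: "inj_on \<phi> (carrier A)"
    and invol_add: "\<sigma> (a + b) = \<sigma> a + \<sigma> b"
    and invol_mult: "\<sigma> (a * b) = \<sigma> b * \<sigma> a"
    and invol_invol: "\<sigma> (\<sigma> a) = a"
begin

lemma eqI: "x \<in> carrier A \<Longrightarrow> y \<in> carrier A \<Longrightarrow> \<phi> x = \<phi> y \<Longrightarrow> x = y"
  using hom_inj by (rule inj_onD)

lemma abelian_group: "abelian_group A"
proof (rule abelian_groupI)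
  fix x assume x: "x \<in> carrier A"
  obtain y where y: "y \<in> carrier A" "\<phi> y = - \<phi> x" using neg_closed[OF x] by blast
  hence "y \<oplus>\<^bsub>A\<^esub> x = \<zero>\<^bsub>A\<^esub>" using x by (intro eqI) (auto simp: add_closed zero_closed hom_add hom_zero)
  thus "\<exists>y\<in>carrier A. y \<oplus>\<^bsub>A\<^esub> x = \<zero>\<^bsub>A\<^esub>" using y(1) by blast
qed (auto intro!: eqI add_closed zero_closed simp: hom_add hom_zero add_closed zero_closed ac_simps)

lemma hom_minus:
  assumes "x \<in> carrier A" "y \<in> carrier A"
  shows "x \<ominus>\<^bsub>A\<^esub> y \<in> carrier A" "\<phi> (x \<ominus>\<^bsub>A\<^esub> y) = \<phi> x - \<phi> y"
proof -
  interpret abelian_group A by (rule abelian_group)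
  have y': "\<ominus>\<^bsub>A\<^esub> y \<in> carrier A" by (rule a_inv_closed[OF assms(2)])
  have "\<phi> (y \<oplus>\<^bsub>A\<^esub> \<ominus>\<^bsub>A\<^esub> y) = 0" by (simp add: r_neg assms hom_zero)
  hence "\<phi> (\<ominus>\<^bsub>A\<^esub> y) = - \<phi> y" using hom_add[OF assms(2) y'] by (simp add: eq_neg_iff_add_eq_0 add.commute)
  thus "\<phi> (x \<ominus>\<^bsub>A\<^esub> y) = \<phi> x - \<phi> y" "x \<ominus>\<^bsub>A\<^esub> y \<in> carrier A"
    using hom_add[OF assms(1) y'] add_closed[OF assms(1) y'] by (simp_all add: a_minus_def)
qed

lemma hom_finsum:
  assumes "finite I" "\<And>i. i \<in> I \<Longrightarrow> f i \<in> carrier A"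
  shows "finsum A f I \<in> carrier A \<and> \<phi> (finsum A f I) = (\<Sum>i\<in>I. \<phi> (f i))"
proof -
  interpret abelian_group A by (rule abelian_group)
  show ?thesis
    using assms
  proof (induction I)
    case (insert i I)
    hence "finsum A f (insert i I) = f i \<oplus>\<^bsub>A\<^esub> finsum A f I" by (intro finsum_insert) auto
    thus ?case using insert by (simp add: add_closed hom_add)
  qed (simp add: zero_closed hom_zero)
qed

lemma matsI: "dim_row M = m \<Longrightarrow> dim_col M = n \<Longrightarrow> (\<And>i j. i < m \<Longrightarrow> j < n \<Longrightarrow> M $$ (i, j) \<in> carrier A) \<Longrightarrow> M \<in> mats A m n"
  by (auto simp: mats_def elements_mat_def)

lemma mats_dim: "M \<in> mats A m n \<Longrightarrow> dim_row M = m" "M \<in> mats A m n \<Longrightarrow> dim_col M = n"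
  by (auto simp: mats_def)

lemma mats_entry: "M \<in> mats A m n \<Longrightarrow> i < m \<Longrightarrow> j < n \<Longrightarrow> M $$ (i, j) \<in> carrier A"
proof -
  assume M: "M \<in> mats A m n" and "i < m" "j < n"
  hence "M $$ (i, j) \<in> elements_mat M" by (fastforce simp: elements_mat_def mats_dim)
  thus ?thesis using M by (auto simp: mats_def)
qed

abbreviation hat :: "'a mat \<Rightarrow> 'r mat" where "hat M \<equiv> map_mat \<phi> M"

lemma hat_carrier: "M \<in> mats A m n \<Longrightarrow> hat M \<in> carrier_mat m n"
  by (auto simp: mats_def)

lemma hat_inject: "M \<in> mats A m n \<Longrightarrow> N \<in> mats A m n \<Longrightarrow> hat M = hat N \<Longrightarrow> M = N"
proof (rule eq_matI)
  assume M: "M \<in> mats A m n" and N: "N \<in> mats A m n" and eq: "hat M = hat N"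
  show "dim_row M = dim_row N" "dim_col M = dim_col N" using M N by (auto simp: mats_dim)
  fix i j assume ij: "i < dim_row N" "j < dim_col N"
  have "hat M $$ (i, j) = hat N $$ (i, j)" by (simp add: eq)
  thus "M $$ (i, j) = N $$ (i, j)"
    using M N ij by (intro eqI) (auto simp: mats_dim intro: mats_entry)
qed

lemma mat_mult_mats:
  assumes "M \<in> mats A m k" "N \<in> mats A k n"
  shows "mat_mult A M N \<in> mats A m n"
  by (rule matsI) (use assms in \<open>auto simp: mat_mult_def mats_dim intro!: hom_finsum[THEN conjunct1] mult_closed mats_entry\<close>)

lemma hat_mult:
  assumes "M \<in> mats A m k" "N \<in> mats A k n"
  shows "hat (mat_mult A M N) = hat M * hat N"
proof (rule eq_matI)
  fix i j assume "i < dim_row (hat M * hat N)" "j < dim_col (hat M * hat N)"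
  hence ij: "i < m" "j < n" using assms by (auto simp: mats_dim)
  have "\<phi> (finsum A (\<lambda>k. M $$ (i, k) \<otimes>\<^bsub>A\<^esub> N $$ (k, j)) {..<k}) = (\<Sum>k<k. \<phi> (M $$ (i, k) \<otimes>\<^bsub>A\<^esub> N $$ (k, j)))"
    by (rule hom_finsum[THEN conjunct2]) (use assms ij in \<open>auto intro!: mult_closed mats_entry\<close>)
  also have "\<dots> = (\<Sum>k<k. \<phi> (M $$ (i, k)) * \<phi> (N $$ (k, j)))"
    by (rule sum.cong) (use assms ij in \<open>auto intro!: hom_mult mats_entry\<close>)
  finally show "hat (mat_mult A M N) $$ (i, j) = (hat M * hat N) $$ (i, j)"
    using ij assms by (simp add: mat_mult_def mats_dim scalar_prod_def atLeast0LessThan)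
qed (use assms in \<open>auto simp: mat_mult_def mats_dim\<close>)

lemma mat_star_mats: "M \<in> mats A m n \<Longrightarrow> mat_star A M \<in> mats A n m"
  by (rule matsI) (auto simp: mat_star_def mats_dim intro!: star_closed mats_entry)

lemma hat_star: "M \<in> mats A m n \<Longrightarrow> hat (mat_star A M) = mat_adj \<sigma> (hat M)"
  by (rule eq_matI) (auto simp: mat_star_def mat_adj_def mats_dim intro!: hom_star mats_entry)

lemma invol_zero: "\<sigma> 0 = 0"
  using invol_add[of 0 0] by simp

lemma invol_sum: "\<sigma> (\<Sum>i\<in>I. f i) = (\<Sum>i\<in>I. \<sigma> (f i))"
  by (induction I rule: infinite_finite_induct) (simp_all add: invol_zero invol_add)

lemma mat_mult_assoc:
  assumes "M \<in> mats A m k" "N \<in> mats A k l" "P \<in> mats A l n"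
  shows "mat_mult A (mat_mult A M N) P = mat_mult A M (mat_mult A N P)"
proof (rule hat_inject[of _ m n])
  note MN = mat_mult_mats[OF assms(1,2)] and NP = mat_mult_mats[OF assms(2,3)]
  have "hat (mat_mult A (mat_mult A M N) P) = hat M * hat N * hat P"
    using hat_mult[OF MN assms(3)] hat_mult[OF assms(1,2)] by simp
  also have "\<dots> = hat M * (hat N * hat P)" by (rule assoc_mult_mat[OF assms[THEN hat_carrier]])
  also have "\<dots> = hat (mat_mult A M (mat_mult A N P))"
    using hat_mult[OF assms(1) NP] hat_mult[OF assms(2,3)] by simp
  finally show "hat (mat_mult A (mat_mult A M N) P) = hat (mat_mult A M (mat_mult A N P))" .
  show "mat_mult A (mat_mult A M N) P \<in> mats A m n" "mat_mult A M (mat_mult A N P) \<in> mats A m n"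
    by (rule mat_mult_mats[OF MN assms(3)], rule mat_mult_mats[OF assms(1) NP])
qed

lemma mat_star_mult:
  assumes "M \<in> mats A m k" "N \<in> mats A k n"
  shows "mat_star A (mat_mult A M N) = mat_mult A (mat_star A N) (mat_star A M)"
proof (rule hat_inject[of _ n m])
  have "hat (mat_star A (mat_mult A M N)) = mat_adj \<sigma> (hat M * hat N)"
    using hat_star[OF mat_mult_mats[OF assms]] hat_mult[OF assms] by simp
  also have "\<dots> = mat_adj \<sigma> (hat N) * mat_adj \<sigma> (hat M)"
    by (rule eq_matI) (use assms in \<open>auto simp: mat_adj_def mats_dim scalar_prod_def invol_sum invol_mult\<close>)
  finally show "hat (mat_star A (mat_mult A M N)) = hat (mat_mult A (mat_star A N) (mat_star A M))"
    using hat_mult[OF mat_star_mats[OF assms(2)] mat_star_mats[OF assms(1)]] hat_star assms by metis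
qed (use assms in \<open>auto intro!: mat_mult_mats mat_star_mats\<close>)

lemma star_star: "x \<in> carrier A \<Longrightarrow> star A (star A x) = x"
  by (rule eqI) (auto intro!: star_closed simp: hom_star star_closed invol_invol)

lemma mat_star_star: "M \<in> mats A m n \<Longrightarrow> mat_star A (mat_star A M) = M"
  by (rule eq_matI) (auto simp: mat_star_def mats_dim intro!: star_star mats_entry)

lemma mat_zero_mats: "mat_zero A m n \<in> mats A m n"
  by (rule matsI) (auto simp: mat_zero_def zero_closed)

lemma mat_one_mats: "mat_one A n \<in> mats A n n"
  by (rule matsI) (auto simp: mat_one_def zero_closed one_closed)

lemma four_block_mats:
  assumes "P \<in> mats A m n" "Q \<in> mats A m n'" "R \<in> mats A m' n" "S \<in> mats A m' n'"
  shows "four_block_mat P Q R S \<in> mats A (m + m') (n + n')"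
  by (rule matsI) (use assms in \<open>auto simp: mats_dim intro: mats_entry\<close>)

lemma hat_four_block:
  assumes "P \<in> mats A m n" "Q \<in> mats A m n'" "R \<in> mats A m' n" "S \<in> mats A m' n'"
  shows "hat (four_block_mat P Q R S) = four_block_mat (hat P) (hat Q) (hat R) (hat S)"
  by (rule eq_matI) (use assms in \<open>auto simp: mats_dim\<close>)

lemma hat_zero: "hat (mat_zero A m n) = 0\<^sub>m m n"
  by (rule eq_matI) (auto simp: mat_zero_def hom_zero)

lemma mat_star_four_block:
  assumes "P \<in> mats A m n" "Q \<in> mats A m n'" "R \<in> mats A m' n" "S \<in> mats A m' n'"
  shows "mat_star A (four_block_mat P Q R S) =
     four_block_mat (mat_star A P) (mat_star A R) (mat_star A Q) (mat_star A S)"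
  by (rule eq_matI) (use assms in \<open>auto simp: mats_dim mat_star_def\<close>)

lemma star_zero: "star A \<zero>\<^bsub>A\<^esub> = \<zero>\<^bsub>A\<^esub>"
  by (rule eqI) (auto intro!: star_closed zero_closed simp: hom_star zero_closed hom_zero invol_zero)

lemma mat_star_zero: "mat_star A (mat_zero A m n) = mat_zero A n m"
  by (rule eq_matI) (auto simp: mat_star_def mat_zero_def star_zero)

lemma mat_dsum_mats: "P \<in> mats A m n \<Longrightarrow> Q \<in> mats A m' n' \<Longrightarrow> mat_dsum A P Q \<in> mats A (m + m') (n + n')"
  unfolding mat_dsum_def by (intro four_block_mats) (auto simp: mats_dim mat_zero_mats)

lemma hat_dsum:
  assumes "P \<in> mats A m n" "Q \<in> mats A m' n'"
  shows "hat (mat_dsum A P Q) = four_block_mat (hat P) (0\<^sub>m m n') (0\<^sub>m m' n) (hat Q)"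
  using hat_four_block[OF assms(1) mat_zero_mats mat_zero_mats assms(2)] assms
  by (simp add: mat_dsum_def mats_dim hat_zero)

lemma mat_star_dsum:
  assumes "P \<in> mats A m n" "Q \<in> mats A m' n'"
  shows "mat_star A (mat_dsum A P Q) = mat_dsum A (mat_star A P) (mat_star A Q)"
  using mat_star_four_block[OF assms(1) mat_zero_mats mat_zero_mats assms(2)] assms
  by (simp add: mat_dsum_def mats_dim mat_star_zero mats_dim[OF mat_star_mats])

lemma mat_dsum_mult:
  assumes "P \<in> mats A m k" "Q \<in> mats A m' k'" "P' \<in> mats A k n" "Q' \<in> mats A k' n'"
  shows "mat_mult A (mat_dsum A P Q) (mat_dsum A P' Q') = mat_dsum A (mat_mult A P P') (mat_mult A Q Q')"
proof (rule hat_inject[of _ "m + m'" "n + n'"])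
  note h = assms[THEN hat_carrier]
  have "hat (mat_mult A (mat_dsum A P Q) (mat_dsum A P' Q')) = hat (mat_dsum A P Q) * hat (mat_dsum A P' Q')"
    by (rule hat_mult[OF mat_dsum_mats[OF assms(1,2)] mat_dsum_mats[OF assms(3,4)]])
  also have "\<dots> = four_block_mat (hat P * hat P') (0\<^sub>m m n') (0\<^sub>m m' n) (hat Q * hat Q')"
    unfolding hat_dsum[OF assms(1,2)] hat_dsum[OF assms(3,4)]
    by (subst mult_four_block_mat[OF h(1) zero_carrier_mat zero_carrier_mat h(2) h(3) zero_carrier_mat zero_carrier_mat h(4)])
      (use h in simp)
  also have "\<dots> = hat (mat_dsum A (mat_mult A P P') (mat_mult A Q Q'))"
    using hat_dsum[OF mat_mult_mats[OF assms(1,3)] mat_mult_mats[OF assms(2,4)]]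
      hat_mult[OF assms(1,3)] hat_mult[OF assms(2,4)] by simp
  finally show "hat (mat_mult A (mat_dsum A P Q) (mat_dsum A P' Q')) = hat (mat_dsum A (mat_mult A P P') (mat_mult A Q Q'))" .
  show "mat_mult A (mat_dsum A P Q) (mat_dsum A P' Q') \<in> mats A (m + m') (n + n')"
    by (rule mat_mult_mats[OF mat_dsum_mats[OF assms(1,2)] mat_dsum_mats[OF assms(3,4)]])
  show "mat_dsum A (mat_mult A P P') (mat_mult A Q Q') \<in> mats A (m + m') (n + n')"
    by (rule mat_dsum_mats[OF mat_mult_mats[OF assms(1,3)] mat_mult_mats[OF assms(2,4)]])
qed

lemma mat_dsum_assoc:
  assumes "P \<in> mats A m m" "Q \<in> mats A n n" "R \<in> mats A k k"
  shows "mat_dsum A (mat_dsum A P Q) R = mat_dsum A P (mat_dsum A Q R)"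
proof (rule hat_inject[of _ "m + n + k" "m + n + k"])
  note PQ = mat_dsum_mats[OF assms(1,2)] and QR = mat_dsum_mats[OF assms(2,3)]
  have "hat (mat_dsum A P (mat_dsum A Q R)) = four_block_mat (hat P) (0\<^sub>m m (n + k)) (0\<^sub>m (n + k) m)
      (four_block_mat (hat Q) (0\<^sub>m n k) (0\<^sub>m k n) (hat R))"
    by (simp only: hat_dsum[OF assms(1) QR] hat_dsum[OF assms(2,3)])
  also have "\<dots> = four_block_mat (four_block_mat (hat P) (0\<^sub>m m n) (0\<^sub>m n m) (hat Q)) (0\<^sub>m (m + n) k) (0\<^sub>m k (m + n)) (hat R)"
    using assoc_four_block_mat[of "hat P" "hat Q" "hat R"] assms by (simp add: mats_dim)
  also have "\<dots> = hat (mat_dsum A (mat_dsum A P Q) R)"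
    by (simp only: hat_dsum[OF PQ assms(3)] hat_dsum[OF assms(1,2)])
  finally show "hat (mat_dsum A (mat_dsum A P Q) R) = hat (mat_dsum A P (mat_dsum A Q R))" by (rule sym)
  show "mat_dsum A (mat_dsum A P Q) R \<in> mats A (m + n + k) (m + n + k)" by (rule mat_dsum_mats[OF PQ assms(3)])
  show "mat_dsum A P (mat_dsum A Q R) \<in> mats A (m + n + k) (m + n + k)"
    using mat_dsum_mats[OF assms(1) QR] by (simp only: add.assoc)
qed

lemma mat_dsum_zero:
  assumes "P \<in> mats A m m"
  shows "mat_dsum A (mat_zero A 0 0) P = P" "mat_dsum A P (mat_zero A 0 0) = P"
  by (rule eq_matI; use assms in \<open>auto simp: mat_dsum_def mat_zero_def mats_dim\<close>)+

lemma projectionsE: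
  assumes "p \<in> projections A"
  obtains n where "p \<in> mats A n n" "mat_mult A p p = p" "mat_star A p = p"
  using assms by (auto simp: projections_def)

lemma projectionsI: "p \<in> mats A n n \<Longrightarrow> mat_mult A p p = p \<Longrightarrow> mat_star A p = p \<Longrightarrow> p \<in> projections A"
  by (auto simp: projections_def)

lemma projections_dsum:
  assumes "p \<in> projections A" "q \<in> projections A"
  shows "mat_dsum A p q \<in> projections A"
proof -
  obtain m where p: "p \<in> mats A m m" "mat_mult A p p = p" "mat_star A p = p" using projectionsE[OF assms(1)] .
  obtain n where q: "q \<in> mats A n n" "mat_mult A q q = q" "mat_star A q = q" using projectionsE[OF assms(2)] .
  show ?thesis
    using p q by (intro projectionsI[OF mat_dsum_mats[OF p(1) q(1)]])
      (simp_all add: mat_dsum_mult[OF p(1) q(1) p(1) q(1)] mat_star_dsum[OF p(1) q(1)])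
qed

lemma mvnI:
  assumes "p \<in> projections A" "q \<in> projections A" "p \<in> mats A m m" "q \<in> mats A n n" "v \<in> mats A n m"
    "mat_mult A (mat_star A v) v = p" "mat_mult A v (mat_star A v) = q"
  shows "(p, q) \<in> mvn_rel A"
  using assms by (auto simp: mvn_rel_def mats_dim)

lemma mvnE:
  assumes "(p, q) \<in> mvn_rel A"
  obtains m n v where "p \<in> projections A" "q \<in> projections A" "p \<in> mats A m m" "q \<in> mats A n n" "v \<in> mats A n m"
    "mat_mult A (mat_star A v) v = p" "mat_mult A v (mat_star A v) = q"
proof -
  have pq: "p \<in> projections A" "q \<in> projections A" using assms by (auto simp: mvn_rel_def)
  obtain m n where "p \<in> mats A m m" "q \<in> mats A n n" using pq projectionsE by metis
  with assms pq that show ?thesis by (auto simp: mvn_rel_def mats_dim)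
qed

lemma mvn_refl: "p \<in> projections A \<Longrightarrow> (p, p) \<in> mvn_rel A"
  by (metis mvnI projectionsE)

lemma mvn_sym: "(p, q) \<in> mvn_rel A \<Longrightarrow> (q, p) \<in> mvn_rel A"
proof -
  assume "(p, q) \<in> mvn_rel A"
  then obtain m n v where v: "p \<in> projections A" "q \<in> projections A" "p \<in> mats A m m" "q \<in> mats A n n" "v \<in> mats A n m"
    "mat_mult A (mat_star A v) v = p" "mat_mult A v (mat_star A v) = q" by (rule mvnE)
  show ?thesis
    by (rule mvnI[OF v(2,1,4,3) mat_star_mats[OF v(5)]]) (simp_all add: mat_star_star[OF v(5)] v(6,7))
qed

lemma mvn_trans:
  assumes "(p, q) \<in> mvn_rel A" "(q, r) \<in> mvn_rel A"
  shows "(p, r) \<in> mvn_rel A"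
proof -
  obtain m n v where v: "p \<in> projections A" "q \<in> projections A" "p \<in> mats A m m" "q \<in> mats A n n" "v \<in> mats A n m"
    "mat_mult A (mat_star A v) v = p" "mat_mult A v (mat_star A v) = q" using assms(1) by (rule mvnE)
  obtain n' k w where w: "r \<in> projections A" "q \<in> mats A n' n'" "r \<in> mats A k k" "w \<in> mats A k n'"
    "mat_mult A (mat_star A w) w = q" "mat_mult A w (mat_star A w) = r" using assms(2) by (rule mvnE)
  have "n' = n" using v(4) w(2) by (metis mats_dim(1))
  note w = w[unfolded this]
  note s = mat_star_mats[OF v(5)] mat_star_mats[OF w(4)]
  have pp: "mat_mult A p p = p" "mat_mult A r r = r"
    using v(1) w(1) by (auto elim!: projectionsE)
  have vq: "mat_mult A (mat_mult A (mat_star A v) q) v = p"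
    using mat_mult_assoc[OF s(1) v(5) mat_mult_mats[OF s(1) v(5)]] mat_mult_assoc[OF s(1) v(4) v(5)]
      mat_mult_assoc[OF v(5) s(1) v(5)] v(6,7) pp(1) by metis
  have wq: "mat_mult A (mat_mult A w q) (mat_star A w) = r"
    using mat_mult_assoc[OF w(4) s(2) mat_mult_mats[OF w(4) s(2)]] mat_mult_assoc[OF w(4) v(4) s(2)]
      mat_mult_assoc[OF s(2) w(4) s(2)] w(5,6) pp(2) by metis
  show ?thesis
  proof (rule mvnI[OF v(1) w(1) v(3) w(3) mat_mult_mats[OF w(4) v(5)]])
    show "mat_mult A (mat_star A (mat_mult A w v)) (mat_mult A w v) = p"
      using mat_star_mult[OF w(4) v(5)] mat_mult_assoc[OF mat_mult_mats[OF s] w(4) v(5)]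
        mat_mult_assoc[OF s(1) s(2) w(4)] w(5) vq by metis
    show "mat_mult A (mat_mult A w v) (mat_star A (mat_mult A w v)) = r"
      using mat_star_mult[OF w(4) v(5)] mat_mult_assoc[OF mat_mult_mats[OF w(4) v(5)] s]
        mat_mult_assoc[OF w(4) v(5) s(1)] v(7) wq by metis
  qed
qed

lemma mvn_equiv: "equiv (projections A) (mvn_rel A)"
proof (rule equivI)
  show "mvn_rel A \<subseteq> projections A \<times> projections A" by (auto simp: mvn_rel_def)
  show "refl_on (projections A) (mvn_rel A)" by (rule refl_onI) (rule mvn_refl)
  show "sym (mvn_rel A)" by (rule symI) (rule mvn_sym)
  show "trans (mvn_rel A)" by (rule transI) (rule mvn_trans)
qed

lemma mvn_dsum:
  assumes "(p, p') \<in> mvn_rel A" "(q, q') \<in> mvn_rel A"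
  shows "(mat_dsum A p q, mat_dsum A p' q') \<in> mvn_rel A"
proof -
  obtain m n v where v: "p \<in> projections A" "p' \<in> projections A" "p \<in> mats A m m" "p' \<in> mats A n n" "v \<in> mats A n m"
    "mat_mult A (mat_star A v) v = p" "mat_mult A v (mat_star A v) = p'" using assms(1) by (rule mvnE)
  obtain k l w where w: "q \<in> projections A" "q' \<in> projections A" "q \<in> mats A k k" "q' \<in> mats A l l" "w \<in> mats A l k"
    "mat_mult A (mat_star A w) w = q" "mat_mult A w (mat_star A w) = q'" using assms(2) by (rule mvnE)
  note s = mat_star_mats[OF v(5)] mat_star_mats[OF w(5)]
  show ?thesis
    by (rule mvnI[OF projections_dsum[OF v(1) w(1)] projections_dsum[OF v(2) w(2)] mat_dsum_mats[OF v(3) w(3)]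
          mat_dsum_mats[OF v(4) w(4)] mat_dsum_mats[OF v(5) w(5)]])
      (simp_all add: mat_star_dsum[OF v(5) w(5)] mat_dsum_mult[OF s v(5) w(5)] mat_dsum_mult[OF v(5) w(5) s] v(6,7) w(6,7))
qed

text \<open>
  The partial isometry is the block matrix that exchanges the two summands.
\<close>

lemma mvn_dsum_commute:
  assumes "p \<in> projections A" "q \<in> projections A"
  shows "(mat_dsum A p q, mat_dsum A q p) \<in> mvn_rel A"
proof -
  obtain m where p: "p \<in> mats A m m" "mat_mult A p p = p" "mat_star A p = p" using projectionsE[OF assms(1)] .
  obtain n where q: "q \<in> mats A n n" "mat_mult A q q = q" "mat_star A q = q" using projectionsE[OF assms(2)] .
  let ?v = "four_block_mat (mat_zero A n m) q p (mat_zero A m n)"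
  let ?w = "four_block_mat (mat_zero A m n) p q (mat_zero A n m)"
  have v: "?v \<in> mats A (n + m) (m + n)" and w: "?w \<in> mats A (m + n) (n + m)"
    by (intro four_block_mats mat_zero_mats p q)+
  have vw: "mat_star A ?v = ?w"
    using mat_star_four_block[OF mat_zero_mats q(1) p(1) mat_zero_mats] p q by (simp add: mat_star_zero)
  have block: "mat_mult A (four_block_mat (mat_zero A b a) y x (mat_zero A a b)) (four_block_mat (mat_zero A a b) x y (mat_zero A b a))
      = mat_dsum A y x"
    if x: "x \<in> mats A a a" "mat_mult A x x = x" and y: "y \<in> mats A b b" "mat_mult A y y = y" for a b x y
  proof (rule hat_inject[of _ "b + a" "b + a"])
    let ?X = "four_block_mat (mat_zero A b a) y x (mat_zero A a b)"
    let ?Y = "four_block_mat (mat_zero A a b) x y (mat_zero A b a)"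
    have X: "?X \<in> mats A (b + a) (a + b)" and Y: "?Y \<in> mats A (a + b) (b + a)"
      by (intro four_block_mats mat_zero_mats x y)+
    show "mat_mult A ?X ?Y \<in> mats A (b + a) (b + a)" "mat_dsum A y x \<in> mats A (b + a) (b + a)"
      by (intro mat_mult_mats[OF X Y] mat_dsum_mats x y)+
    note hx = hat_carrier[OF x(1)] and hy = hat_carrier[OF y(1)]
    have xx: "hat x * hat x = hat x" "hat y * hat y = hat y" using hat_mult[OF x(1) x(1)] hat_mult[OF y(1) y(1)] x y by auto
    have "hat (mat_mult A ?X ?Y) = four_block_mat (0\<^sub>m b a) (hat y) (hat x) (0\<^sub>m a b) * four_block_mat (0\<^sub>m a b) (hat x) (hat y) (0\<^sub>m b a)"
      using hat_mult[OF X Y] hat_four_block[OF mat_zero_mats y(1) x(1) mat_zero_mats]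
        hat_four_block[OF mat_zero_mats x(1) y(1) mat_zero_mats] by (simp add: hat_zero)
    also have "\<dots> = four_block_mat (hat y) (0\<^sub>m b a) (0\<^sub>m a b) (hat x)"
      by (subst mult_four_block_mat[OF zero_carrier_mat hy hx zero_carrier_mat zero_carrier_mat hx hy zero_carrier_mat])
        (use hx hy xx in simp)
    also have "\<dots> = hat (mat_dsum A y x)" by (simp add: hat_dsum[OF y(1) x(1)])
    finally show "hat (mat_mult A ?X ?Y) = hat (mat_dsum A y x)" .
  qed
  show ?thesis
  proof (rule mvnI[OF projections_dsum[OF assms] projections_dsum[OF assms(2,1)] mat_dsum_mats[OF p(1) q(1)] mat_dsum_mats[OF q(1) p(1)]])
    show "?v \<in> mats A (n + m) (m + n)" by (rule v)
    show "mat_mult A (mat_star A ?v) ?v = mat_dsum A p q" unfolding vw by (rule block[OF q(1,2) p(1,2)])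
    show "mat_mult A ?v (mat_star A ?v) = mat_dsum A q p" unfolding vw by (rule block[OF p(1,2) q(1,2)])
  qed
qed

lemma mat_zero_projection: "mat_zero A n n \<in> projections A"
proof (rule projectionsI[OF mat_zero_mats])
  show "mat_mult A (mat_zero A n n) (mat_zero A n n) = mat_zero A n n"
    by (rule hat_inject[of _ n n]) (auto simp: hat_mult[OF mat_zero_mats mat_zero_mats] hat_zero intro!: mat_mult_mats mat_zero_mats)
qed (rule mat_star_zero)

lemma mvn_zero: "(mat_zero A m m, mat_zero A n n) \<in> mvn_rel A"
proof (rule mvnI[OF mat_zero_projection mat_zero_projection mat_zero_mats mat_zero_mats mat_zero_mats])
  show "mat_mult A (mat_star A (mat_zero A n m)) (mat_zero A n m) = mat_zero A m m"
    by (rule hat_inject[of _ m m]) (auto simp: mat_star_zero hat_mult[OF mat_zero_mats mat_zero_mats] hat_zero intro!: mat_mult_mats mat_zero_mats)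
  show "mat_mult A (mat_zero A n m) (mat_star A (mat_zero A n m)) = mat_zero A n n"
    by (rule hat_inject[of _ n n]) (auto simp: mat_star_zero hat_mult[OF mat_zero_mats mat_zero_mats] hat_zero intro!: mat_mult_mats mat_zero_mats)
qed

abbreviation mvn_class :: "'a mat \<Rightarrow> 'a mat set" where
  "mvn_class p \<equiv> mvn_rel A `` {p}"

lemma mvn_class_eq_iff:
  "p \<in> projections A \<Longrightarrow> q \<in> projections A \<Longrightarrow> mvn_class p = mvn_class q \<longleftrightarrow> (p, q) \<in> mvn_rel A"
  by (rule eq_equiv_class_iff[OF mvn_equiv])

lemma V_monoid_carrier: "carrier (V_monoid A) = mvn_class ` projections A"
  by (auto simp: V_monoid_def quotient_def)

lemma V_monoid_mult:
  assumes "p \<in> projections A" "q \<in> projections A"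
  shows "mvn_class p \<otimes>\<^bsub>V_monoid A\<^esub> mvn_class q = mvn_class (mat_dsum A p q)"
proof -
  have "mvn_class (mat_dsum A p' q') = mvn_class (mat_dsum A p q)" if "(p, p') \<in> mvn_rel A" "(q, q') \<in> mvn_rel A" for p' q'
    by (rule equiv_class_eq[OF mvn_equiv, symmetric]) (rule mvn_dsum[OF that])
  hence inner: "(\<Union>q'\<in>mvn_class q. mvn_class (mat_dsum A p' q')) = mvn_class (mat_dsum A p q)" if "p' \<in> mvn_class p" for p'
    by (rule UN_constant_nonempty[rotated]) (use that mvn_refl[OF assms(2)] in auto)
  have "(\<Union>p'\<in>mvn_class p. \<Union>q'\<in>mvn_class q. mvn_class (mat_dsum A p' q')) = mvn_class (mat_dsum A p q)"
    by (rule UN_constant_nonempty[OF _ inner]) (use mvn_refl[OF assms(1)] in auto)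
  thus ?thesis by (simp add: V_monoid_def)
qed

lemma V_monoid_one: "\<one>\<^bsub>V_monoid A\<^esub> = mvn_class (mat_zero A 0 0)"
  by (simp add: V_monoid_def)

lemma V_comm_monoid: "comm_monoid (V_monoid A)"
proof (rule comm_monoidI)
  show "\<one>\<^bsub>V_monoid A\<^esub> \<in> carrier (V_monoid A)"
    by (simp add: V_monoid_one V_monoid_carrier mat_zero_projection)
  fix x assume "x \<in> carrier (V_monoid A)"
  then obtain p where p: "p \<in> projections A" "x = mvn_class p" by (auto simp: V_monoid_carrier)
  show "\<one>\<^bsub>V_monoid A\<^esub> \<otimes>\<^bsub>V_monoid A\<^esub> x = x"
    using p by (auto simp: V_monoid_one V_monoid_mult mat_zero_projection mat_dsum_zero elim: projectionsE)
  fix y assume "y \<in> carrier (V_monoid A)"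
  then obtain q where q: "q \<in> projections A" "y = mvn_class q" by (auto simp: V_monoid_carrier)
  show "x \<otimes>\<^bsub>V_monoid A\<^esub> y \<in> carrier (V_monoid A)"
    using p q by (auto simp: V_monoid_mult V_monoid_carrier projections_dsum)
  show "x \<otimes>\<^bsub>V_monoid A\<^esub> y = y \<otimes>\<^bsub>V_monoid A\<^esub> x"
    using p q by (simp add: V_monoid_mult mvn_class_eq_iff projections_dsum mvn_dsum_commute)
  fix z assume "z \<in> carrier (V_monoid A)"
  then obtain r where r: "r \<in> projections A" "z = mvn_class r" by (auto simp: V_monoid_carrier)
  show "x \<otimes>\<^bsub>V_monoid A\<^esub> y \<otimes>\<^bsub>V_monoid A\<^esub> z = x \<otimes>\<^bsub>V_monoid A\<^esub> (y \<otimes>\<^bsub>V_monoid A\<^esub> z)"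
    using p q r by (auto simp: V_monoid_mult projections_dsum elim!: projectionsE intro!: arg_cong[of _ _ mvn_class] mat_dsum_assoc)
qed

end

section \<open>Grothendieck groups\<close>

text \<open>
  Commutative monoids as bare monoid records, the type on which the Grothendieck group is defined.
\<close>

locale grothendieck_monoid = comm_monoid G for G :: "'a monoid" (structure)
begin

abbreviation diff_class :: "'a \<Rightarrow> 'a \<Rightarrow> ('a \<times> 'a) set" where
  "diff_class a b \<equiv> grothendieck_rel G `` {(a, b)}"

lemma grothendieck_rel_iff:
  "((a, b), (c, d)) \<in> grothendieck_rel G \<longleftrightarrow>
     a \<in> carrier G \<and> b \<in> carrier G \<and> c \<in> carrier G \<and> d \<in> carrier G \<and>
     (\<exists>e\<in>carrier G. a \<otimes> d \<otimes> e = c \<otimes> b \<otimes> e)"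
  by (simp add: grothendieck_rel_def)

lemma grothendieck_equiv: "equiv (carrier G \<times> carrier G) (grothendieck_rel G)"
proof (rule equivI)
  show "grothendieck_rel G \<subseteq> (carrier G \<times> carrier G) \<times> (carrier G \<times> carrier G)"
    by (auto simp: grothendieck_rel_def)
  show "refl_on (carrier G \<times> carrier G) (grothendieck_rel G)"
    by (auto simp: refl_on_def grothendieck_rel_def)
  show "sym (grothendieck_rel G)"
    by (rule symI) (auto simp: grothendieck_rel_def dest: sym)
  show "trans (grothendieck_rel G)"
  proof (rule transI, clarify)
    fix a b c d a' b'
    assume "((a, b), (c, d)) \<in> grothendieck_rel G" "((c, d), (a', b')) \<in> grothendieck_rel G"
    then obtain e f where m: "a \<in> carrier G" "b \<in> carrier G" "c \<in> carrier G" "d \<in> carrier G" "a' \<in> carrier G" "b' \<in> carrier G"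
      "e \<in> carrier G" "f \<in> carrier G" and eq: "a \<otimes> d \<otimes> e = c \<otimes> b \<otimes> e" "c \<otimes> b' \<otimes> f = a' \<otimes> d \<otimes> f"
      by (auto simp: grothendieck_rel_iff)
    have "a \<otimes> b' \<otimes> (d \<otimes> e \<otimes> f) = (a \<otimes> d \<otimes> e) \<otimes> (b' \<otimes> f)" using m by (simp add: m_ac)
    also have "\<dots> = (c \<otimes> b' \<otimes> f) \<otimes> (b \<otimes> e)" unfolding eq(1) using m by (simp add: m_ac)
    also have "\<dots> = a' \<otimes> b \<otimes> (d \<otimes> e \<otimes> f)" unfolding eq(2) using m by (simp add: m_ac)
    finally show "((a, b), (a', b')) \<in> grothendieck_rel G"
      using m by (auto simp: grothendieck_rel_iff)
  qed
qed

lemma diff_class_eq_iff: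
  assumes "a \<in> carrier G" "b \<in> carrier G" "c \<in> carrier G" "d \<in> carrier G"
  shows "diff_class a b = diff_class c d \<longleftrightarrow> (\<exists>e\<in>carrier G. a \<otimes> d \<otimes> e = c \<otimes> b \<otimes> e)"
  using eq_equiv_class_iff[OF grothendieck_equiv, of "(a, b)" "(c, d)"] assms by (simp add: grothendieck_rel_iff)

lemma grothendieck_carrier: "carrier (grothendieck_group G) = {diff_class a b | a b. a \<in> carrier G \<and> b \<in> carrier G}"
  by (auto simp: grothendieck_group_def quotient_def)

lemma grothendieck_one: "\<one>\<^bsub>grothendieck_group G\<^esub> = diff_class \<one> \<one>"
  by (simp add: grothendieck_group_def)

lemma grothendieck_mult:
  assumes m: "a \<in> carrier G" "b \<in> carrier G" "c \<in> carrier G" "d \<in> carrier G"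
  shows "diff_class a b \<otimes>\<^bsub>grothendieck_group G\<^esub> diff_class c d = diff_class (a \<otimes> c) (b \<otimes> d)"
proof -
  have eq: "diff_class (a' \<otimes> c') (b' \<otimes> d') = diff_class (a \<otimes> c) (b \<otimes> d)"
    if r: "((a, b), (a', b')) \<in> grothendieck_rel G" "((c, d), (c', d')) \<in> grothendieck_rel G" for a' b' c' d'
  proof -
    obtain e f where n: "a' \<in> carrier G" "b' \<in> carrier G" "c' \<in> carrier G" "d' \<in> carrier G"
      "e \<in> carrier G" "f \<in> carrier G" and eqs: "a \<otimes> b' \<otimes> e = a' \<otimes> b \<otimes> e" "c \<otimes> d' \<otimes> f = c' \<otimes> d \<otimes> f"
      using r by (auto simp: grothendieck_rel_iff)
    have "a' \<otimes> c' \<otimes> (b \<otimes> d) \<otimes> (e \<otimes> f) = (a' \<otimes> b \<otimes> e) \<otimes> (c' \<otimes> d \<otimes> f)" using m n by (simp add: m_ac)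
    also have "\<dots> = (a \<otimes> b' \<otimes> e) \<otimes> (c \<otimes> d' \<otimes> f)" by (simp only: eqs)
    also have "\<dots> = a \<otimes> c \<otimes> (b' \<otimes> d') \<otimes> (e \<otimes> f)" using m n by (simp add: m_ac)
    finally show ?thesis using m n by (subst diff_class_eq_iff) auto
  qed
  have ne: "(a, b) \<in> diff_class a b" "(c, d) \<in> diff_class c d"
    using m by (auto simp: grothendieck_rel_iff)
  have "(\<Union>(a, b)\<in>diff_class a b. \<Union>(c, d)\<in>diff_class c d. diff_class (a \<otimes> c) (b \<otimes> d)) = diff_class (a \<otimes> c) (b \<otimes> d)"
    (is "(\<Union>x\<in>?X. ?f x) = _")
  proof (rule UN_constant_nonempty)
    show "?X \<noteq> {}" using ne(1) by blast
    fix x assume x: "x \<in> ?X"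
    obtain a' b' where x': "x = (a', b')" by (cases x)
    have r1: "((a, b), (a', b')) \<in> grothendieck_rel G" using x unfolding x' by (rule ImageE) simp
    have "(\<Union>y\<in>diff_class c d. case y of (c', d') \<Rightarrow> diff_class (a' \<otimes> c') (b' \<otimes> d')) = diff_class (a \<otimes> c) (b \<otimes> d)"
    proof (rule UN_constant_nonempty)
      show "diff_class c d \<noteq> {}" using ne(2) by blast
      fix y assume y: "y \<in> diff_class c d"
      obtain c' d' where y': "y = (c', d')" by (cases y)
      have r2: "((c, d), (c', d')) \<in> grothendieck_rel G" using y unfolding y' by (rule ImageE) simp
      show "(case y of (c', d') \<Rightarrow> diff_class (a' \<otimes> c') (b' \<otimes> d')) = diff_class (a \<otimes> c) (b \<otimes> d)"
        unfolding y' prod.case by (rule eq[OF r1 r2])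
    qed
    thus "?f x = diff_class (a \<otimes> c) (b \<otimes> d)" unfolding x' prod.case .
  qed
  thus ?thesis by (simp add: grothendieck_group_def)
qed

lemma grothendieck_l_one:
  assumes "x \<in> carrier (grothendieck_group G)"
  shows "\<one>\<^bsub>grothendieck_group G\<^esub> \<otimes>\<^bsub>grothendieck_group G\<^esub> x = x"
    "x \<otimes>\<^bsub>grothendieck_group G\<^esub> \<one>\<^bsub>grothendieck_group G\<^esub> = x"
  using assms by (auto simp: grothendieck_carrier grothendieck_one grothendieck_mult)

end

section \<open>Functoriality\<close>

sublocale star_rep \<subseteq> V: grothendieck_monoid "V_monoid A"
  unfolding grothendieck_monoid_def by (rule V_comm_monoid)

interpretation R: star_rep RU to_op adj
proof
  note K = zero_compact subspace_add[OF compact_ops_subspace] compact_ops_mult compact_ops_scal compact_ops_adj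
    subspace_neg[OF compact_ops_subspace]
  have C: "elem z c \<in> carrier RU" if "z \<in> compact_ops" for z c
    using that by (auto simp: carrier_ray_unitization)
  show "\<zero>\<^bsub>RU\<^esub> \<in> carrier RU" "\<one>\<^bsub>RU\<^esub> \<in> carrier RU"
    by (simp_all add: ray_unitization_zero ray_unitization_one C K)
  show "to_op \<zero>\<^bsub>RU\<^esub> = 0" "to_op \<one>\<^bsub>RU\<^esub> = 1"
    by (simp_all add: ray_unitization_zero ray_unitization_one K)
  show "inj_on to_op (carrier RU)"
  proof (rule inj_onI)
    fix x y assume x: "x \<in> carrier RU" and y: "y \<in> carrier RU" and eq: "to_op x = to_op y"
    obtain z c where z: "z \<in> compact_ops" "x = elem z c" using carrier_cases[OF x] .
    obtain w d where w: "w \<in> compact_ops" "y = elem w d" using carrier_cases[OF y] .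
    show "x = y" using compact_plus_scalar_inject[OF z(1) w(1), of c d] eq z w by simp
  qed
  fix x assume x: "x \<in> carrier RU"
  obtain z c where z: "z \<in> compact_ops" "x = elem z c" using carrier_cases[OF x] .
  show "star RU x \<in> carrier RU" "to_op (star RU x) = adj (to_op x)"
    using z by (simp_all add: ray_unitization_ops(3)[of z z] C K adj_add adj_scal)
  show "\<exists>y\<in>carrier RU. to_op y = - to_op x"
    using z by (intro bexI[of _ "elem (- z) (- c)"]) (simp_all add: C K scal_minus)
  fix y assume y: "y \<in> carrier RU"
  obtain w d where w: "w \<in> compact_ops" "y = elem w d" using carrier_cases[OF y] .
  show "x \<oplus>\<^bsub>RU\<^esub> y \<in> carrier RU" "x \<otimes>\<^bsub>RU\<^esub> y \<in> carrier RU"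
    "to_op (x \<oplus>\<^bsub>RU\<^esub> y) = to_op x + to_op y"
    using z w by (simp_all add: ray_unitization_ops C K scal_add)
  have "to_op (x \<otimes>\<^bsub>RU\<^esub> y) = z * w + scal c * w + scal d * z + scal (c * d)"
    using z w by (simp add: ray_unitization_ops K)
  also have "\<dots> = (z + scal c) * (w + scal d)" by (simp add: distrib_left distrib_right scal_mult scal_central[of z])
  finally show "to_op (x \<otimes>\<^bsub>RU\<^esub> y) = to_op x * to_op y" using z w by simp
qed (auto simp: adj_add adj_mult)

interpretation Cx: star_rep complex_alg "\<lambda>z. z" cnj
  by standard (auto simp: complex_alg_def inj_on_def)

locale star_hom = A: star_rep A \<phi> \<sigma> + B: star_rep B \<psi> \<tau>
  for A :: "'a star_alg" and \<phi> :: "'a \<Rightarrow> 'r::ring_1" and \<sigma> and B :: "'b star_alg" and \<psi> :: "'b \<Rightarrow> 's::ring_1" and \<tau> +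
  fixes h :: "'a \<Rightarrow> 'b"
  assumes h_closed: "x \<in> carrier A \<Longrightarrow> h x \<in> carrier B"
    and h_zero: "h \<zero>\<^bsub>A\<^esub> = \<zero>\<^bsub>B\<^esub>"
    and h_add: "x \<in> carrier A \<Longrightarrow> y \<in> carrier A \<Longrightarrow> h (x \<oplus>\<^bsub>A\<^esub> y) = h x \<oplus>\<^bsub>B\<^esub> h y"
    and h_mult: "x \<in> carrier A \<Longrightarrow> y \<in> carrier A \<Longrightarrow> h (x \<otimes>\<^bsub>A\<^esub> y) = h x \<otimes>\<^bsub>B\<^esub> h y"
    and h_star: "x \<in> carrier A \<Longrightarrow> h (star A x) = star B (h x)"
begin

lemma h_finsum:
  assumes "finite I" "\<And>i. i \<in> I \<Longrightarrow> f i \<in> carrier A"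
  shows "h (finsum A f I) = finsum B (\<lambda>i. h (f i)) I"
proof -
  interpret A': abelian_group A by (rule A.abelian_group)
  interpret B': abelian_group B by (rule B.abelian_group)
  show ?thesis
    using assms
  proof (induction I)
    case (insert i I)
    have f: "\<And>j. j \<in> I \<Longrightarrow> f j \<in> carrier A" "f i \<in> carrier A" using insert.prems by auto
    have "finsum A f (insert i I) = f i \<oplus>\<^bsub>A\<^esub> finsum A f I"
      using insert.hyps f by (intro A'.finsum_insert) auto
    moreover have "finsum B (\<lambda>i. h (f i)) (insert i I) = h (f i) \<oplus>\<^bsub>B\<^esub> finsum B (\<lambda>i. h (f i)) I"
      using insert.hyps f by (intro B'.finsum_insert) (auto intro: h_closed)
    moreover have "finsum A f I \<in> carrier A" by (rule A'.finsum_closed) (use f in auto)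
    ultimately show ?case using insert.IH f by (simp add: h_add)
  qed (simp add: h_zero)
qed

lemma map_mats: "M \<in> mats A m n \<Longrightarrow> map_mat h M \<in> mats B m n"
  by (rule B.matsI) (auto simp: A.mats_dim intro!: h_closed A.mats_entry)

lemma map_mult:
  assumes "M \<in> mats A m k" "N \<in> mats A k n"
  shows "map_mat h (mat_mult A M N) = mat_mult B (map_mat h M) (map_mat h N)"
proof (rule eq_matI)
  interpret B': abelian_group B by (rule B.abelian_group)
  fix i j assume "i < dim_row (mat_mult B (map_mat h M) (map_mat h N))" "j < dim_col (mat_mult B (map_mat h M) (map_mat h N))"
  hence ij: "i < m" "j < n" using assms by (auto simp: mat_mult_def A.mats_dim)
  have "h (finsum A (\<lambda>k. M $$ (i, k) \<otimes>\<^bsub>A\<^esub> N $$ (k, j)) {..<k}) = finsum B (\<lambda>k. h (M $$ (i, k) \<otimes>\<^bsub>A\<^esub> N $$ (k, j))) {..<k}"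
    by (rule h_finsum) (use assms ij in \<open>auto intro!: A.mult_closed A.mats_entry\<close>)
  also have "\<dots> = finsum B (\<lambda>k. h (M $$ (i, k)) \<otimes>\<^bsub>B\<^esub> h (N $$ (k, j))) {..<k}"
  proof (rule B'.finsum_cong')
    show "(\<lambda>k. h (M $$ (i, k)) \<otimes>\<^bsub>B\<^esub> h (N $$ (k, j))) \<in> {..<k} \<rightarrow> carrier B"
      using assms ij by (auto intro!: B.mult_closed h_closed A.mats_entry)
    fix l assume "l \<in> {..<k}"
    thus "h (M $$ (i, l) \<otimes>\<^bsub>A\<^esub> N $$ (l, j)) = h (M $$ (i, l)) \<otimes>\<^bsub>B\<^esub> h (N $$ (l, j))"
      using assms ij by (intro h_mult A.mats_entry) auto
  qed simp
  also have "\<dots> = finsum B (\<lambda>l. map_mat h M $$ (i, l) \<otimes>\<^bsub>B\<^esub> map_mat h N $$ (l, j)) {..<k}"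
  proof (rule B'.finsum_cong')
    show "(\<lambda>l. map_mat h M $$ (i, l) \<otimes>\<^bsub>B\<^esub> map_mat h N $$ (l, j)) \<in> {..<k} \<rightarrow> carrier B"
      using assms ij by (auto intro!: B.mult_closed h_closed A.mats_entry simp: A.mats_dim)
  qed (use assms ij in \<open>auto simp: A.mats_dim\<close>)
  finally show "map_mat h (mat_mult A M N) $$ (i, j) = mat_mult B (map_mat h M) (map_mat h N) $$ (i, j)"
    using ij assms by (simp add: mat_mult_def A.mats_dim)
qed (use assms in \<open>auto simp: mat_mult_def A.mats_dim\<close>)

lemma map_star: "M \<in> mats A m n \<Longrightarrow> map_mat h (mat_star A M) = mat_star B (map_mat h M)"
  by (rule eq_matI) (auto simp: mat_star_def A.mats_dim intro!: h_star A.mats_entry)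

lemma map_zero: "map_mat h (mat_zero A m n) = mat_zero B m n"
  by (rule eq_matI) (auto simp: mat_zero_def h_zero)

lemma map_dsum:
  assumes "P \<in> mats A m n" "Q \<in> mats A m' n'"
  shows "map_mat h (mat_dsum A P Q) = mat_dsum B (map_mat h P) (map_mat h Q)"
  by (rule eq_matI) (use assms in \<open>auto simp: mat_dsum_def mat_zero_def A.mats_dim h_zero\<close>)

lemma map_projection: "p \<in> projections A \<Longrightarrow> map_mat h p \<in> projections B"
  by (elim A.projectionsE) (rule B.projectionsI[OF map_mats]; simp flip: map_mult map_star)

lemma map_mvn:
  assumes "(p, q) \<in> mvn_rel A"
  shows "(map_mat h p, map_mat h q) \<in> mvn_rel B"
proof -
  obtain m n v where v: "p \<in> projections A" "q \<in> projections A" "p \<in> mats A m m" "q \<in> mats A n n" "v \<in> mats A n m"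
    "mat_mult A (mat_star A v) v = p" "mat_mult A v (mat_star A v) = q" using assms by (rule A.mvnE)
  note s = A.mat_star_mats[OF v(5)]
  show ?thesis
  proof (rule B.mvnI[OF map_projection[OF v(1)] map_projection[OF v(2)] map_mats[OF v(3)] map_mats[OF v(4)] map_mats[OF v(5)]])
    show "mat_mult B (mat_star B (map_mat h v)) (map_mat h v) = map_mat h p"
      unfolding map_star[OF v(5), symmetric] map_mult[OF s v(5), symmetric] v(6) ..
    show "mat_mult B (map_mat h v) (mat_star B (map_mat h v)) = map_mat h q"
      unfolding map_star[OF v(5), symmetric] map_mult[OF v(5) s, symmetric] v(7) ..
  qed
qed

lemma map_dsum_projections:
  "p \<in> projections A \<Longrightarrow> q \<in> projections A \<Longrightarrow> map_mat h (mat_dsum A p q) = mat_dsum B (map_mat h p) (map_mat h q)"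
  by (elim A.projectionsE) (rule map_dsum)

text \<open>
  The map on \<open>K00\<close> is a union over all representatives of a difference class. Each of them satisfies the defining
  equation of the class up to a summand, and this equation is preserved by the homomorphism.
\<close>

lemma K00_map_eq_one:
  assumes p: "p \<in> projections A" and q: "q \<in> projections A" and pq: "(map_mat h p, map_mat h q) \<in> mvn_rel B"
  shows "K00_map B h (A.V.diff_class (A.mvn_class p) (A.mvn_class q)) = \<one>\<^bsub>K00 B\<^esub>"
proof -
  define V where "V = (\<lambda>P. \<Union>p\<in>P. B.mvn_class (map_mat h p))"
  have V: "V (A.mvn_class r) = B.mvn_class (map_mat h r)" if "r \<in> projections A" for r
    unfolding V_def
  proof (rule UN_constant_nonempty)
    show "A.mvn_class r \<noteq> {}" using A.mvn_refl[OF that] by blast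
    fix r' assume "r' \<in> A.mvn_class r"
    hence "(r, r') \<in> mvn_rel A" by simp
    thus "B.mvn_class (map_mat h r') = B.mvn_class (map_mat h r)"
      using equiv_class_eq[OF B.mvn_equiv map_mvn] by metis
  qed
  let ?Z = "A.V.diff_class (A.mvn_class p) (A.mvn_class q)"
  have cl: "A.mvn_class r \<in> carrier (V_monoid A)" if "r \<in> projections A" for r
    using that by (simp add: A.V_monoid_carrier)
  have clB: "B.mvn_class (map_mat h r) \<in> carrier (V_monoid B)" if "r \<in> projections A" for r
    using map_projection[OF that] by (simp add: B.V_monoid_carrier)
  have mapV: "B.mvn_class (map_mat h (mat_dsum A r s)) = B.mvn_class (map_mat h r) \<otimes>\<^bsub>V_monoid B\<^esub> B.mvn_class (map_mat h s)"
    if "r \<in> projections A" "s \<in> projections A" for r s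
    using that by (simp add: map_dsum_projections B.V_monoid_mult map_projection)
  have "(\<Union>x\<in>?Z. case x of (P, Q) \<Rightarrow> B.V.diff_class (V P) (V Q)) = B.V.diff_class \<one>\<^bsub>V_monoid B\<^esub> \<one>\<^bsub>V_monoid B\<^esub>"
  proof (rule UN_constant_nonempty)
    have "(A.mvn_class p, A.mvn_class q) \<in> ?Z"
      using A.V.grothendieck_equiv cl[OF p] cl[OF q] by (intro equiv_class_self[of "carrier (V_monoid A) \<times> carrier (V_monoid A)"]) auto
    thus "?Z \<noteq> {}" by blast
    fix x assume x: "x \<in> ?Z"
    obtain P Q where PQ: "x = (P, Q)" by (cases x)
    have "((A.mvn_class p, A.mvn_class q), (P, Q)) \<in> grothendieck_rel (V_monoid A)" using x unfolding PQ by (rule ImageE) simp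
    then obtain e where c: "P \<in> carrier (V_monoid A)" "Q \<in> carrier (V_monoid A)" "e \<in> carrier (V_monoid A)"
      and eq: "A.mvn_class p \<otimes>\<^bsub>V_monoid A\<^esub> Q \<otimes>\<^bsub>V_monoid A\<^esub> e = P \<otimes>\<^bsub>V_monoid A\<^esub> A.mvn_class q \<otimes>\<^bsub>V_monoid A\<^esub> e"
      unfolding A.V.grothendieck_rel_iff by blast
    obtain p' where p': "p' \<in> projections A" "P = A.mvn_class p'" using c(1) unfolding A.V_monoid_carrier by blast
    obtain q' where q': "q' \<in> projections A" "Q = A.mvn_class q'" using c(2) unfolding A.V_monoid_carrier by blast
    obtain f where f: "f \<in> projections A" "e = A.mvn_class f" using c(3) unfolding A.V_monoid_carrier by blast
    note pr = p q p'(1) q'(1) f(1) A.projections_dsum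
    have "A.mvn_class (mat_dsum A (mat_dsum A p q') f) = A.mvn_class (mat_dsum A (mat_dsum A p' q) f)"
      using eq unfolding p'(2) q'(2) f(2) by (simp add: A.V_monoid_mult pr)
    hence "(mat_dsum A (mat_dsum A p q') f, mat_dsum A (mat_dsum A p' q) f) \<in> mvn_rel A"
      by (simp add: A.mvn_class_eq_iff pr)
    from equiv_class_eq[OF B.mvn_equiv map_mvn[OF this]]
    have eqB: "B.mvn_class (map_mat h p) \<otimes>\<^bsub>V_monoid B\<^esub> B.mvn_class (map_mat h q') \<otimes>\<^bsub>V_monoid B\<^esub> B.mvn_class (map_mat h f) =
        B.mvn_class (map_mat h p') \<otimes>\<^bsub>V_monoid B\<^esub> B.mvn_class (map_mat h q) \<otimes>\<^bsub>V_monoid B\<^esub> B.mvn_class (map_mat h f)"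
      by (simp add: mapV pr)
    have pq': "B.mvn_class (map_mat h q) = B.mvn_class (map_mat h p)"
      using equiv_class_eq[OF B.mvn_equiv pq] by (rule sym)
    note cb = clB[OF p] clB[OF p'(1)] clB[OF q'(1)] clB[OF f(1)]
    have "B.V.diff_class (B.mvn_class (map_mat h p')) (B.mvn_class (map_mat h q')) = B.V.diff_class \<one>\<^bsub>V_monoid B\<^esub> \<one>\<^bsub>V_monoid B\<^esub>"
    proof (subst B.V.diff_class_eq_iff)
      show "\<exists>e\<in>carrier (V_monoid B). B.mvn_class (map_mat h p') \<otimes>\<^bsub>V_monoid B\<^esub> \<one>\<^bsub>V_monoid B\<^esub> \<otimes>\<^bsub>V_monoid B\<^esub> e =
          \<one>\<^bsub>V_monoid B\<^esub> \<otimes>\<^bsub>V_monoid B\<^esub> B.mvn_class (map_mat h q') \<otimes>\<^bsub>V_monoid B\<^esub> e"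
      proof (rule bexI[of _ "B.mvn_class (map_mat h p) \<otimes>\<^bsub>V_monoid B\<^esub> B.mvn_class (map_mat h f)"])
        show "B.mvn_class (map_mat h p') \<otimes>\<^bsub>V_monoid B\<^esub> \<one>\<^bsub>V_monoid B\<^esub> \<otimes>\<^bsub>V_monoid B\<^esub>
            (B.mvn_class (map_mat h p) \<otimes>\<^bsub>V_monoid B\<^esub> B.mvn_class (map_mat h f)) =
          \<one>\<^bsub>V_monoid B\<^esub> \<otimes>\<^bsub>V_monoid B\<^esub> B.mvn_class (map_mat h q') \<otimes>\<^bsub>V_monoid B\<^esub>
            (B.mvn_class (map_mat h p) \<otimes>\<^bsub>V_monoid B\<^esub> B.mvn_class (map_mat h f))"
          using eqB[unfolded pq'] cb by (simp add: B.V.m_ac)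
      qed (use cb in simp)
    qed (use cb in simp_all)
    thus "(case x of (P, Q) \<Rightarrow> B.V.diff_class (V P) (V Q)) = B.V.diff_class \<one>\<^bsub>V_monoid B\<^esub> \<one>\<^bsub>V_monoid B\<^esub>"
      unfolding PQ prod.case p'(2) q'(2) V[OF p'(1)] V[OF q'(1)] .
  qed
  thus ?thesis
    unfolding K00_map_def Let_def V_def[symmetric] K00_def B.V.grothendieck_one .
qed

end

interpretation S: star_hom RU to_op adj complex_alg "\<lambda>z. z" cnj snd
proof
  fix x assume x: "x \<in> carrier RU"
  obtain z c where z: "z \<in> compact_ops" "x = elem z c" using carrier_cases[OF x] .
  show "snd x \<in> carrier complex_alg" by (simp add: complex_alg_def)
  show "snd (star RU x) = star complex_alg (snd x)"
    using z by (simp add: ray_unitization_ops(3)[of z z], simp add: elem_def complex_alg_def)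
  fix y assume y: "y \<in> carrier RU"
  obtain w d where w: "w \<in> compact_ops" "y = elem w d" using carrier_cases[OF y] .
  show "snd (x \<oplus>\<^bsub>RU\<^esub> y) = snd x \<oplus>\<^bsub>complex_alg\<^esub> snd y"
    "snd (x \<otimes>\<^bsub>RU\<^esub> y) = snd x \<otimes>\<^bsub>complex_alg\<^esub> snd y"
    using z w by (simp_all add: ray_unitization_ops, simp_all add: elem_def complex_alg_def)
qed (simp add: ray_unitization_zero elem_def complex_alg_def)

section \<open>Matrices over the unitization as operators\<close>

definition mat_op :: "nat \<Rightarrow> ((nat \<Rightarrow> nat star_poly) set \<times> complex) mat \<Rightarrow> cop" where
  "mat_op k M = assemble k (\<lambda>i j. to_op (M $$ (i, j)))"

lemma to_op_mem: "x \<in> carrier RU \<Longrightarrow> to_op x \<in> compact_plus_scalars"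
  by (elim carrier_cases) (simp add: compact_plus_scalarsI)

lemma mat_op_mem: "M \<in> mats RU k k \<Longrightarrow> mat_op k M \<in> block_algebra k"
  unfolding mat_op_def by (intro assemble_in_block_algebra to_op_mem R.mats_entry)

lemma mat_op_mult:
  assumes "M \<in> mats RU k k" "N \<in> mats RU k k"
  shows "mat_op k (mat_mult RU M N) = mat_op k M * mat_op k N"
  unfolding mat_op_def assemble_mult
proof (rule assemble_cong)
  fix i j assume ij: "i < k" "j < k"
  have "to_op (mat_mult RU M N $$ (i, j)) = map_mat to_op (mat_mult RU M N) $$ (i, j)"
    using ij R.mat_mult_mats[OF assms] by (simp add: R.mats_dim)
  also have "\<dots> = (map_mat to_op M * map_mat to_op N) $$ (i, j)" by (simp only: R.hat_mult[OF assms])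
  also have "\<dots> = (\<Sum>l<k. to_op (M $$ (i, l)) * to_op (N $$ (l, j)))"
    using assms ij by (simp add: R.mats_dim scalar_prod_def atLeast0LessThan)
  finally show "to_op (mat_mult RU M N $$ (i, j)) = (\<Sum>l<k. to_op (M $$ (i, l)) * to_op (N $$ (l, j)))" .
qed

lemma mat_op_star:
  assumes "M \<in> mats RU k k"
  shows "mat_op k (mat_star RU M) = adj (mat_op k M)"
  unfolding mat_op_def adj_assemble
  by (rule assemble_cong) (use assms in \<open>auto simp: mat_star_def R.mats_dim intro!: R.hom_star R.mats_entry\<close>)

lemma mat_op_entry: "i < k \<Longrightarrow> j < k \<Longrightarrow> unslice i * mat_op k M * slice j = to_op (M $$ (i, j))"
  unfolding mat_op_def by (rule assemble_entry)

text \<open>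
  If \<open>v\<close> carries \<open>F\<close> onto the larger projection \<open>G\<close>, then \<open>v\<^sup>* + 1 - G\<close> is an isometry with range projection
  \<open>1 - G + F\<close>. It is unitary by \<open>AF_isometry_unitary\<close>.
\<close>

lemma AF_no_proper_subprojection:
  assumes AF: "AF_algebra A" and v: "v \<in> A" and F: "adj v * v = F" and G: "v * adj v = G"
    and proj: "F * F = F" "G * G = G" and sub: "F * G = F"
  shows "F = G"
proof -
  note mem = star_subalgebraD[of A]
  have A: "star_subalgebra A" using AF by (simp add: AF_algebra_def)
  have sa: "adj F = F" "adj G = G" using F G by (auto simp: adj_mult)
  have zero: "z = 0" if "adj z * z = 0" for z :: cop
    using norm_adj_mult[of z] that by simp
  \<comment> \<open>The partial isometry v has the source projection F.\<close>
  have vF: "v * F = v"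
  proof -
    have "adj (v - v * F) * (v - v * F) = adj v * v - (adj v * v) * F - F * (adj v * v) + F * (adj v * v) * F"
      by (simp add: adj_diff adj_mult sa left_diff_distrib right_diff_distrib mult.assoc)
    also have "\<dots> = 0" using proj(1) by (simp add: F)
    finally have "v - v * F = 0" by (rule zero)
    thus ?thesis by simp
  qed
  have Gv: "G * v = v" using vF by (simp add: F[symmetric] G[symmetric] mult.assoc)
  have vG: "v * G = v"
  proof -
    have "v * G = (v * F) * G" by (simp only: vF)
    also have "\<dots> = v * (F * G)" by (simp only: mult.assoc)
    finally show ?thesis by (simp only: sub vF)
  qed
  have aG: "G * adj v = adj v" "adj v * G = adj v"
    using arg_cong[OF vG, of adj] arg_cong[OF Gv, of adj] by (simp_all add: adj_mult sa)
  define w where "w = adj v + 1 - G"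
  have aw: "adj w = v + 1 - G" by (simp add: w_def adj_add adj_diff sa)
  have "adj w * w = 1"
    unfolding aw unfolding w_def
    by (simp add: distrib_left distrib_right left_diff_distrib right_diff_distrib vG aG Gv G proj)
  moreover have "w \<in> A" unfolding w_def G[symmetric] by (intro mem A v)
  ultimately have "w * adj w = 1" using AF_isometry_unitary[OF AF] by blast
  moreover have "w * adj w = F + 1 - G"
    unfolding aw unfolding w_def
    by (simp add: distrib_left distrib_right left_diff_distrib right_diff_distrib vG aG Gv F proj)
  ultimately show ?thesis by (simp add: algebra_simps)
qed

section \<open>A class of infinite order in \<open>K\<^sub>0\<close>\<close>

definition rank_one :: "((nat \<Rightarrow> nat star_poly) set \<times> complex) mat" where
  "rank_one = Matrix.mat 1 1 (\<lambda>_. elem (munit 0 0) 0)"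

lemma munit_compact: "munit a b \<in> compact_ops" by (rule finite_rank_compact[OF munit_finite_rank])

lemma rank_one_mats: "rank_one \<in> mats RU 1 1"
  by (rule R.matsI) (auto simp: rank_one_def carrier_ray_unitization munit_compact)

lemma rank_one_projection: "rank_one \<in> projections RU"
proof (rule R.projectionsI[OF rank_one_mats])
  note o = rank_one_mats
  have h: "map_mat to_op rank_one = Matrix.mat 1 1 (\<lambda>_. munit 0 0)"
    by (rule eq_matI) (auto simp: rank_one_def munit_compact)
  show "mat_mult RU rank_one rank_one = rank_one"
    by (rule R.hat_inject[OF R.mat_mult_mats[OF o o] o])
      (unfold R.hat_mult[OF o o] h, rule eq_matI, auto simp: scalar_prod_def munit_mult)
  show "mat_star RU rank_one = rank_one"
    by (rule R.hat_inject[OF R.mat_star_mats[OF o] o])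
      (unfold R.hat_star[OF o] h mat_adj_def, rule eq_matI, auto)
qed

text \<open>
  The summand \<open>f\<close> is first enlarged by zeros to the size of the left-hand side. It is then a subprojection of the
  left-hand side that is equivalent to it, hence equal to it, although their upper left entries differ.
\<close>

lemma rank_one_not_absorbed:
  assumes "p \<in> projections RU" "f \<in> projections RU"
  shows "(mat_dsum RU (mat_dsum RU rank_one p) f, f) \<notin> mvn_rel RU"
proof
  let ?P = "mat_dsum RU rank_one p"
  assume eq: "(mat_dsum RU ?P f, f) \<in> mvn_rel RU"
  have P: "?P \<in> projections RU" by (rule R.projections_dsum[OF rank_one_projection assms(1)])
  obtain n where n: "p \<in> mats RU n n" using R.projectionsE[OF assms(1)] by metis
  obtain m where m: "f \<in> mats RU m m" "mat_mult RU f f = f" using R.projectionsE[OF assms(2)] by metis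
  let ?n = "1 + n" and ?k = "1 + n + m"
  let ?Z = "mat_zero RU ?n ?n"
  have Pm: "?P \<in> mats RU ?n ?n" by (rule R.mat_dsum_mats[OF rank_one_mats n])
  note Z = R.mat_zero_mats[of ?n ?n] R.mat_zero_projection[of ?n]
  let ?F = "mat_dsum RU ?Z f" and ?G = "mat_dsum RU ?P f"
  have Fm: "?F \<in> mats RU ?k ?k" and Gm: "?G \<in> mats RU ?k ?k" by (rule R.mat_dsum_mats[OF Z(1) m(1)], rule R.mat_dsum_mats[OF Pm m(1)])
  have "(mat_dsum RU (mat_zero RU 0 0) f, ?F) \<in> mvn_rel RU"
    by (rule R.mvn_dsum[OF R.mvn_zero R.mvn_refl[OF assms(2)]])
  hence "(f, ?F) \<in> mvn_rel RU" by (simp only: R.mat_dsum_zero[OF m(1)])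
  hence "(?F, ?G) \<in> mvn_rel RU" using R.mvn_trans[OF eq] R.mvn_sym by blast
  then obtain v where v: "v \<in> mats RU ?k ?k" "mat_mult RU (mat_star RU v) v = ?F" "mat_mult RU v (mat_star RU v) = ?G"
    using Fm Gm by (auto simp: mvn_rel_def R.mats_dim)
  have pr: "mat_mult RU ?F ?F = ?F" "mat_mult RU ?G ?G = ?G"
    using R.projections_dsum[OF Z(2) assms(2)] R.projections_dsum[OF P assms(2)] by (auto elim: R.projectionsE)
  have ZP: "mat_mult RU ?Z ?P = ?Z"
    by (rule R.hat_inject[OF R.mat_mult_mats[OF Z(1) Pm] Z(1)])
      (simp only: R.hat_mult[OF Z(1) Pm] R.hat_zero left_mult_zero_mat[OF R.hat_carrier[OF Pm]])
  have FG: "mat_mult RU ?F ?G = ?F"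
    by (simp only: R.mat_dsum_mult[OF Z(1) m(1) Pm m(1)] ZP m(2))
  have "mat_op ?k ?F = mat_op ?k ?G"
  proof (rule AF_no_proper_subprojection[OF AF_block_algebra mat_op_mem[OF v(1)]])
    note s = R.mat_star_mats[OF v(1)]
    show "adj (mat_op ?k v) * mat_op ?k v = mat_op ?k ?F"
      by (simp only: mat_op_star[OF v(1), symmetric] mat_op_mult[OF s v(1), symmetric] v(2))
    show "mat_op ?k v * adj (mat_op ?k v) = mat_op ?k ?G"
      by (simp only: mat_op_star[OF v(1), symmetric] mat_op_mult[OF v(1) s, symmetric] v(3))
    show "mat_op ?k ?F * mat_op ?k ?F = mat_op ?k ?F" "mat_op ?k ?G * mat_op ?k ?G = mat_op ?k ?G"
      "mat_op ?k ?F * mat_op ?k ?G = mat_op ?k ?F"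
      by (simp_all only: mat_op_mult[OF Fm Fm, symmetric] mat_op_mult[OF Gm Gm, symmetric] mat_op_mult[OF Fm Gm, symmetric] pr FG)
  qed
  hence "to_op (?F $$ (0, 0)) = to_op (?G $$ (0, 0))"
    using mat_op_entry[of 0 ?k 0 ?F] mat_op_entry[of 0 ?k 0 ?G] by simp
  moreover have "?F $$ (0, 0) = \<zero>\<^bsub>RU\<^esub>"
    using m(1) by (simp add: mat_dsum_def mat_zero_def R.mats_dim)
  moreover have "?G $$ (0, 0) = elem (munit 0 0) 0"
    using m(1) n by (simp add: mat_dsum_def R.mats_dim, simp add: rank_one_def)
  ultimately have "munit 0 0 = 0" by (simp add: R.hom_zero munit_compact)
  hence "norm (munit 0 0) = 0" by simp
  thus False by simp
qed

abbreviation KG where "KG \<equiv> K0 ray_cstar"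

lemma KG_simps: "\<one>\<^bsub>KG\<^esub> = \<one>\<^bsub>K00 RU\<^esub>" "x \<otimes>\<^bsub>KG\<^esub> y = x \<otimes>\<^bsub>K00 RU\<^esub> y"
  by (simp_all add: K0_def)

lemma KG_carrier: "carrier KG = {x \<in> carrier (K00 RU). K00_map complex_alg snd x = \<one>\<^bsub>K00 complex_alg\<^esub>}"
  by (simp add: K0_def kernel_def)

text \<open>
  The class of \<open>E\<^sub>0\<^sub>0\<close>. It belongs to \<open>K\<^sub>0\<close> because the scalar part of this projection is zero.
\<close>

definition generator where "generator = R.V.diff_class (R.mvn_class rank_one) \<one>\<^bsub>V_monoid RU\<^esub>"

lemma class_closed: "p \<in> projections RU \<Longrightarrow> R.mvn_class p \<in> carrier (V_monoid RU)"
  by (simp add: R.V_monoid_carrier)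

lemma KG_one: "\<one>\<^bsub>KG\<^esub> = R.V.diff_class \<one>\<^bsub>V_monoid RU\<^esub> \<one>\<^bsub>V_monoid RU\<^esub>"
  by (simp add: KG_simps K00_def R.V.grothendieck_one)

lemma KG_mem:
  assumes "p \<in> projections RU" "(map_mat snd p, mat_zero complex_alg 0 0) \<in> mvn_rel complex_alg"
  shows "R.V.diff_class (R.mvn_class p) \<one>\<^bsub>V_monoid RU\<^esub> \<in> carrier KG"
proof -
  have "K00_map complex_alg snd (R.V.diff_class (R.mvn_class p) (R.mvn_class (mat_zero RU 0 0))) = \<one>\<^bsub>K00 complex_alg\<^esub>"
    by (rule S.K00_map_eq_one[OF assms(1) R.mat_zero_projection]) (use assms(2) in \<open>simp add: S.map_zero\<close>)
  moreover have "R.V.diff_class (R.mvn_class p) (R.mvn_class (mat_zero RU 0 0)) \<in> carrier (K00 RU)"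
    unfolding K00_def R.V.grothendieck_carrier using class_closed[OF assms(1)] class_closed[OF R.mat_zero_projection] by blast
  ultimately show ?thesis by (simp add: KG_carrier R.V_monoid_one)
qed

lemma generator_mem: "generator \<in> carrier KG"
  unfolding generator_def
proof (rule KG_mem[OF rank_one_projection])
  have "map_mat snd rank_one = mat_zero complex_alg 1 1"
    by (rule eq_matI) (auto simp: rank_one_def mat_zero_def elem_def complex_alg_def)
  thus "(map_mat snd rank_one, mat_zero complex_alg 0 0) \<in> mvn_rel complex_alg" by (simp only: Cx.mvn_zero)
qed

lemma KG_one_mem: "\<one>\<^bsub>KG\<^esub> \<in> carrier KG"
  unfolding KG_one
  using KG_mem[OF R.mat_zero_projection[of 0]] S.map_zero[of 0 0] Cx.mvn_zero[of 0 0] by (simp only: R.V_monoid_one)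

lemma KG_carrier_grothendieck: "x \<in> carrier KG \<Longrightarrow> x \<in> carrier (grothendieck_group (V_monoid RU))"
  by (simp add: KG_carrier K00_def)

lemma KG_unit_laws:
  assumes "x \<in> carrier KG"
  shows "\<one>\<^bsub>KG\<^esub> \<otimes>\<^bsub>KG\<^esub> x = x" "x \<otimes>\<^bsub>KG\<^esub> \<one>\<^bsub>KG\<^esub> = x"
  using R.V.grothendieck_l_one[OF KG_carrier_grothendieck[OF assms]] by (simp_all add: KG_simps K00_def)

lemma KG_pow: "x [^]\<^bsub>KG\<^esub> (0::nat) = \<one>\<^bsub>KG\<^esub>" "x [^]\<^bsub>KG\<^esub> (Suc n) = x [^]\<^bsub>KG\<^esub> n \<otimes>\<^bsub>KG\<^esub> x"
  by (simp_all add: nat_pow_def)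

text \<open>
  Only the summand \<open>rank_one\<close> of a multiple of the generator matters: by \<open>rank_one_not_absorbed\<close> it cannot
  be cancelled, whatever the rest is.
\<close>

lemma generator_pow:
  "\<exists>P\<in>projections RU. generator [^]\<^bsub>KG\<^esub> (Suc n) =
     R.V.diff_class (R.mvn_class (mat_dsum RU rank_one P)) \<one>\<^bsub>V_monoid RU\<^esub>"
proof (induction n)
  case 0
  have o: "mat_dsum RU rank_one (mat_zero RU 0 0) = rank_one" by (rule R.mat_dsum_zero[OF rank_one_mats])
  have "generator [^]\<^bsub>KG\<^esub> (Suc 0) = generator"
    by (simp only: KG_pow KG_unit_laws[OF generator_mem])
  thus ?case unfolding generator_def by (intro bexI[of _ "mat_zero RU 0 0"] R.mat_zero_projection) (simp only: o)
next
  case (Suc n)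
  then obtain P where P: "P \<in> projections RU" "generator [^]\<^bsub>KG\<^esub> (Suc n) =
     R.V.diff_class (R.mvn_class (mat_dsum RU rank_one P)) \<one>\<^bsub>V_monoid RU\<^esub>" by blast
  let ?Q = "mat_dsum RU rank_one P"
  have Q: "?Q \<in> projections RU" by (rule R.projections_dsum[OF rank_one_projection P(1)])
  have "generator [^]\<^bsub>KG\<^esub> (Suc (Suc n)) = R.V.diff_class (R.mvn_class ?Q) \<one>\<^bsub>V_monoid RU\<^esub> \<otimes>\<^bsub>grothendieck_group (V_monoid RU)\<^esub> generator"
    unfolding KG_pow(2)[of _ "Suc n"] P(2) KG_simps K00_def ..
  also have "\<dots> = R.V.diff_class (R.mvn_class ?Q \<otimes>\<^bsub>V_monoid RU\<^esub> R.mvn_class rank_one) (\<one>\<^bsub>V_monoid RU\<^esub> \<otimes>\<^bsub>V_monoid RU\<^esub> \<one>\<^bsub>V_monoid RU\<^esub>)"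
    unfolding generator_def by (rule R.V.grothendieck_mult) (simp_all add: class_closed Q rank_one_projection)
  also have "R.mvn_class ?Q \<otimes>\<^bsub>V_monoid RU\<^esub> R.mvn_class rank_one = R.mvn_class rank_one \<otimes>\<^bsub>V_monoid RU\<^esub> R.mvn_class ?Q"
    by (rule R.V.m_comm) (simp_all add: class_closed Q rank_one_projection)
  also have "\<dots> = R.mvn_class (mat_dsum RU rank_one ?Q)" by (rule R.V_monoid_mult[OF rank_one_projection Q])
  finally show ?case using Q by (intro bexI[of _ ?Q]) simp
qed

lemma generator_infinite_order:
  assumes "n > 0"
  shows "generator [^]\<^bsub>KG\<^esub> (n::nat) \<noteq> \<one>\<^bsub>KG\<^esub>"
proof
  assume eq: "generator [^]\<^bsub>KG\<^esub> n = \<one>\<^bsub>KG\<^esub>"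
  obtain m where "n = Suc m" using assms by (cases n) auto
  then obtain P where P: "P \<in> projections RU" "generator [^]\<^bsub>KG\<^esub> n =
     R.V.diff_class (R.mvn_class (mat_dsum RU rank_one P)) \<one>\<^bsub>V_monoid RU\<^esub>" using generator_pow by blast
  let ?Q = "mat_dsum RU rank_one P"
  have Q: "?Q \<in> projections RU" by (rule R.projections_dsum[OF rank_one_projection P(1)])
  have "R.V.diff_class (R.mvn_class ?Q) \<one>\<^bsub>V_monoid RU\<^esub> = R.V.diff_class \<one>\<^bsub>V_monoid RU\<^esub> \<one>\<^bsub>V_monoid RU\<^esub>"
    using eq by (simp only: P(2) KG_one)
  then obtain e where e: "e \<in> carrier (V_monoid RU)"
    "R.mvn_class ?Q \<otimes>\<^bsub>V_monoid RU\<^esub> \<one>\<^bsub>V_monoid RU\<^esub> \<otimes>\<^bsub>V_monoid RU\<^esub> e = \<one>\<^bsub>V_monoid RU\<^esub> \<otimes>\<^bsub>V_monoid RU\<^esub> \<one>\<^bsub>V_monoid RU\<^esub> \<otimes>\<^bsub>V_monoid RU\<^esub> e"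
    using R.V.diff_class_eq_iff[OF class_closed[OF Q] R.V.one_closed R.V.one_closed R.V.one_closed] by blast
  obtain f where f: "f \<in> projections RU" "e = R.mvn_class f" using e(1) unfolding R.V_monoid_carrier by blast
  have "R.mvn_class (mat_dsum RU ?Q f) = R.mvn_class f"
    using e(2) class_closed[OF Q] class_closed[OF f(1)] by (simp add: f(2) R.V_monoid_mult[OF Q f(1)])
  hence "(mat_dsum RU ?Q f, f) \<in> mvn_rel RU"
    using R.mvn_class_eq_iff[OF R.projections_dsum[OF Q f(1)] f(1)] by blast
  thus False using rank_one_not_absorbed[OF P(1) f(1)] by blast
qed

theorem K0_mod_torsion_nontrivial:
  "\<exists>X\<in>carrier (KG Mod torsion_subgroup KG). \<exists>Y\<in>carrier (KG Mod torsion_subgroup KG). X \<noteq> Y"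
proof -
  let ?T = "torsion_subgroup KG"
  have car: "?T #>\<^bsub>KG\<^esub> a \<in> carrier (KG Mod ?T)" if "a \<in> carrier KG" for a
    using that by (auto simp: FactGroup_def RCOSETS_def)
  have "?T #>\<^bsub>KG\<^esub> generator \<noteq> ?T #>\<^bsub>KG\<^esub> \<one>\<^bsub>KG\<^esub>"
  proof
    assume eq: "?T #>\<^bsub>KG\<^esub> generator = ?T #>\<^bsub>KG\<^esub> \<one>\<^bsub>KG\<^esub>"
    have "\<one>\<^bsub>KG\<^esub> [^]\<^bsub>KG\<^esub> (Suc 0) = \<one>\<^bsub>KG\<^esub>" by (simp only: KG_pow KG_unit_laws[OF KG_one_mem])
    hence "\<one>\<^bsub>KG\<^esub> \<in> ?T" unfolding torsion_subgroup_def using KG_one_mem by blast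
    hence "\<one>\<^bsub>KG\<^esub> \<otimes>\<^bsub>KG\<^esub> generator \<in> ?T #>\<^bsub>KG\<^esub> generator" unfolding r_coset_def by blast
    hence "generator \<in> ?T #>\<^bsub>KG\<^esub> \<one>\<^bsub>KG\<^esub>" unfolding eq KG_unit_laws[OF generator_mem] .
    then obtain h where h: "h \<in> ?T" "generator = h \<otimes>\<^bsub>KG\<^esub> \<one>\<^bsub>KG\<^esub>" unfolding r_coset_def by blast
    have "h \<in> carrier KG" using h(1) by (simp add: torsion_subgroup_def)
    hence "generator \<in> ?T" using h KG_unit_laws(2) by metis
    then obtain n :: nat where "n > 0" "generator [^]\<^bsub>KG\<^esub> n = \<one>\<^bsub>KG\<^esub>"
      unfolding torsion_subgroup_def by blast
    thus False using generator_infinite_order by blast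
  qed
  thus ?thesis using car[OF generator_mem] car[OF KG_one_mem] by blast
qed

section \<open>The group \<open>K\<^sub>1\<close> of the ray\<close>

lemma (in star_rep) hat_one: "map_mat \<phi> (mat_one A n) = 1\<^sub>m n"
  by (rule eq_matI) (auto simp: mat_one_def hom_one hom_zero)

lemma (in star_rep) mat_one_mult: "mat_mult A (mat_one A n) (mat_one A n) = mat_one A n"
  by (rule hat_inject[OF mat_mult_mats[OF mat_one_mats mat_one_mats] mat_one_mats])
    (simp add: hat_mult[OF mat_one_mats mat_one_mats] hat_one)

lemma (in star_rep) star_one: "star A \<one>\<^bsub>A\<^esub> = \<one>\<^bsub>A\<^esub>"
proof (rule eqI)
  have "\<sigma> 1 = 1" using invol_mult[of "\<sigma> 1" 1] by (simp add: invol_invol)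
  thus "\<phi> (star A \<one>\<^bsub>A\<^esub>) = \<phi> \<one>\<^bsub>A\<^esub>" by (simp add: hom_star one_closed hom_one)
qed (auto intro: star_closed one_closed)

lemma (in star_rep) mat_star_one: "mat_star A (mat_one A n) = mat_one A n"
  by (rule eq_matI) (auto simp: mat_star_def mat_one_def star_one star_zero)

lemma (in star_rep) mat_one_dsum: "mat_dsum A (mat_one A m) (mat_one A n) = mat_one A (m + n)"
  by (rule eq_matI) (auto simp: mat_dsum_def mat_one_def mat_zero_def)

lemma (in star_rep) unitaries_dsum_one:
  assumes u: "u \<in> unitaries A m"
  shows "mat_dsum A u (mat_one A n) \<in> unitaries A (m + n)"
proof -
  have U: "u \<in> mats A m m" "mat_mult A (mat_star A u) u = mat_one A m" "mat_mult A u (mat_star A u) = mat_one A m"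
    using u by (auto simp: unitaries_def)
  note I = mat_one_mats[of n]
  note s = mat_star_mats[OF U(1)]
  have st: "mat_star A (mat_dsum A u (mat_one A n)) = mat_dsum A (mat_star A u) (mat_one A n)"
    by (simp only: mat_star_dsum[OF U(1) I] mat_star_one)
  show ?thesis
    using mat_dsum_mats[OF U(1) I]
    by (simp add: unitaries_def st mat_dsum_mult[OF s I U(1) I] mat_dsum_mult[OF U(1) I s I] mat_one_mult U(2,3) mat_one_dsum)
qed

definition from_op :: "cop \<Rightarrow> (nat \<Rightarrow> nat star_poly) set \<times> complex" where
  "from_op z = (SOME x. x \<in> carrier RU \<and> to_op x = z)"

lemma from_op:
  assumes "z \<in> compact_plus_scalars"
  shows "from_op z \<in> carrier RU" "to_op (from_op z) = z"
proof -
  obtain a c where "a \<in> compact_ops" "z = a + scal c" using assms unfolding compact_plus_scalars_def by blast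
  hence "elem a c \<in> carrier RU \<and> to_op (elem a c) = z" by (auto simp: carrier_ray_unitization)
  hence "from_op z \<in> carrier RU \<and> to_op (from_op z) = z" unfolding from_op_def by (rule someI)
  thus "from_op z \<in> carrier RU" "to_op (from_op z) = z" by auto
qed

text \<open>
  The inverse of assembling: the entries of an operator in the block algebra, read as elements of
  the unitization.
\<close>

definition compress :: "nat \<Rightarrow> cop \<Rightarrow> ((nat \<Rightarrow> nat star_poly) set \<times> complex) mat" where
  "compress k z = Matrix.mat k k (\<lambda>(i, j). from_op (unslice i * z * slice j))"

lemma compress_mats: "z \<in> block_algebra k \<Longrightarrow> compress k z \<in> mats RU k k"
  unfolding compress_def by (rule R.matsI) (auto intro: from_op block_algebra_entry)

lemma to_op_compress:
  "z \<in> block_algebra k \<Longrightarrow> i < k \<Longrightarrow> j < k \<Longrightarrow> to_op (compress k z $$ (i, j)) = unslice i * z * slice j"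
  unfolding compress_def by (simp add: from_op block_algebra_entry)

lemma mat_op_compress:
  assumes z: "z \<in> block_algebra k"
  shows "mat_op k (compress k z) = z * corner k"
proof -
  have "mat_op k (compress k z) = (\<Sum>i<k. \<Sum>j<k. (slice i * unslice i) * z * (slice j * unslice j))"
    unfolding mat_op_def assemble_def by (intro sum.cong refl) (simp add: to_op_compress[OF z] mult.assoc)
  also have "\<dots> = corner k * z * corner k"
    by (simp add: corner_def sum_distrib_left sum_distrib_right) (rule sum.swap)
  also have "\<dots> = z * corner k"
    unfolding block_algebra_corner[OF z] by (simp only: mult.assoc corner_idem)
  finally show ?thesis .
qed

lemma mat_op_inject:
  assumes "M \<in> mats RU k k" "N \<in> mats RU k k" "mat_op k M = mat_op k N"
  shows "M = N"
proof (rule eq_matI)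
  fix i j assume "i < dim_row N" "j < dim_col N"
  hence ij: "i < k" "j < k" using assms by (auto simp: R.mats_dim)
  have "to_op (M $$ (i, j)) = to_op (N $$ (i, j))"
    using mat_op_entry[OF ij, of M] mat_op_entry[OF ij, of N] assms(3) by simp
  thus "M $$ (i, j) = N $$ (i, j)" using assms ij by (intro R.eqI R.mats_entry)
qed (use assms in \<open>auto simp: R.mats_dim\<close>)

lemma mat_op_one: "mat_op k (mat_one RU k) = corner k"
  unfolding mat_op_def assemble_delta[symmetric]
  by (rule assemble_cong) (simp add: mat_one_def R.hom_one R.hom_zero)

lemma compress_unitary:
  assumes z: "z \<in> block_algebra k" "unitary_op z"
  shows "compress k z \<in> unitaries RU k"
proof -
  note M = compress_mats[OF z(1)]
  note s = R.mat_star_mats[OF M]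
  have zz: "adj z * z = 1" "z * adj z = 1" using z(2) by (auto simp: unitary_op_def)
  have a: "adj (z * corner k) = corner k * adj z" by (simp add: adj_mult)
  have az: "corner k * adj z = adj z * corner k" by (rule block_algebra_corner[OF block_algebraD(5)[OF z(1)]])
  have "mat_op k (mat_mult RU (mat_star RU (compress k z)) (compress k z)) = corner k * adj z * (z * corner k)"
    by (simp only: mat_op_mult[OF s M] mat_op_star[OF M] mat_op_compress[OF z(1)] a)
  also have "\<dots> = corner k * ((adj z * z) * corner k)" by (simp only: mult.assoc)
  also have "\<dots> = mat_op k (mat_one RU k)" by (simp add: zz mat_op_one corner_idem)
  finally have 1: "mat_mult RU (mat_star RU (compress k z)) (compress k z) = mat_one RU k"
    by (rule mat_op_inject[OF R.mat_mult_mats[OF s M] R.mat_one_mats])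
  have "mat_op k (mat_mult RU (compress k z) (mat_star RU (compress k z))) = z * corner k * (corner k * adj z)"
    by (simp only: mat_op_mult[OF M s] mat_op_star[OF M] mat_op_compress[OF z(1)] a)
  also have "\<dots> = z * (corner k * corner k) * adj z" by (simp only: mult.assoc)
  also have "\<dots> = z * (corner k * adj z)" by (simp only: corner_idem mult.assoc)
  also have "\<dots> = (z * adj z) * corner k" by (simp only: az mult.assoc)
  also have "\<dots> = mat_op k (mat_one RU k)" by (simp add: zz mat_op_one)
  finally have 2: "mat_mult RU (compress k z) (mat_star RU (compress k z)) = mat_one RU k"
    by (rule mat_op_inject[OF R.mat_mult_mats[OF M s] R.mat_one_mats])
  show ?thesis using M 1 2 by (simp add: unitaries_def)
qed

text \<open>
  The operator of a unitary matrix is unitary on the corner only; adding the complement of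
  the corner makes it unitary on \<open>\<ell>\<^sup>2\<close>.
\<close>

definition extend :: "nat \<Rightarrow> ((nat \<Rightarrow> nat star_poly) set \<times> complex) mat \<Rightarrow> cop" where
  "extend k u = mat_op k u + (1 - corner k)"

lemma extend_unitary:
  assumes "u \<in> unitaries RU k"
  shows "extend k u \<in> block_algebra k" "unitary_op (extend k u)" "compress k (extend k u) = u"
proof -
  have u: "u \<in> mats RU k k" "mat_mult RU (mat_star RU u) u = mat_one RU k" "mat_mult RU u (mat_star RU u) = mat_one RU k"
    using assms by (auto simp: unitaries_def)
  note s = R.mat_star_mats[OF u(1)]
  show mem: "extend k u \<in> block_algebra k"
    unfolding extend_def by (intro block_algebraD(7,8) block_algebraD(1) mat_op_mem[OF u(1)] corner_in_block_algebra)
  let ?w = "mat_op k u"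
  have w: "adj ?w * ?w = corner k" "?w * adj ?w = corner k"
    by (simp_all only: mat_op_star[OF u(1), symmetric] mat_op_mult[OF s u(1), symmetric] mat_op_mult[OF u(1) s, symmetric] u(2,3) mat_op_one)
  have c: "corner k * ?w = ?w" "?w * corner k = ?w" unfolding mat_op_def by (rule corner_assemble)+
  have ca: "corner k * adj ?w = adj ?w" "adj ?w * corner k = adj ?w"
    using arg_cong[OF c(2), of adj] arg_cong[OF c(1), of adj] by (simp_all add: adj_mult)
  have ad: "adj (extend k u) = adj ?w + (1 - corner k)" by (simp add: extend_def adj_add adj_diff)
  show "unitary_op (extend k u)"
    unfolding unitary_op_def ad unfolding extend_def
    by (simp add: distrib_left distrib_right left_diff_distrib right_diff_distrib w c ca corner_idem)
  show "compress k (extend k u) = u"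
  proof (rule mat_op_inject[OF compress_mats[OF mem] u(1)])
    show "mat_op k (compress k (extend k u)) = mat_op k u"
      unfolding mat_op_compress[OF mem] unfolding extend_def
      by (simp add: distrib_right left_diff_distrib c corner_idem)
  qed
qed

lemma cnorm_nonneg: "0 \<le> cnorm RU x"
proof -
  have "cmod (snd x) \<le> cnorm RU x" by (cases x) (simp add: unitization_def)
  thus ?thesis using norm_ge_zero order_trans by blast
qed

text \<open>
  A path between the extended unitaries in the block algebra, read entrywise.
\<close>

lemma unitaries_homotopic:
  assumes u: "u \<in> unitaries RU k" and v: "v \<in> unitaries RU k"
  shows "unitary_homotopic RU k u v"
proof -
  obtain \<delta> where d: "unitary_path (block_algebra k) (extend k u) (extend k v) \<delta>"
    using AF_unitaries_path_connected[OF AF_block_algebra extend_unitary(1,2)[OF u] extend_unitary(1,2)[OF v]] .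
  have mem: "\<delta> t \<in> block_algebra k" "unitary_op (\<delta> t)" if "t \<in> {0..1}" for t
    using d that by (auto simp: unitary_path_def)
  have cont: "continuous_on {0..1} \<delta>" using d by (simp add: unitary_path_def)
  show ?thesis
    unfolding unitary_homotopic_def
  proof (intro exI[of _ "\<lambda>t. compress k (\<delta> t)"] conjI ballI allI impI)
    show "compress k (\<delta> 0) = u" "compress k (\<delta> 1) = v"
      using d extend_unitary(3)[OF u] extend_unitary(3)[OF v] by (simp_all add: unitary_path_def)
    show "compress k (\<delta> t) \<in> unitaries RU k" if "t \<in> {0..1}" for t
      by (rule compress_unitary[OF mem[OF that]])
    fix i j t assume ij: "i < k" "j < k" and t: "t \<in> {0..1 :: real}"
    let ?g = "\<lambda>s. compress k (\<delta> s) $$ (i, j)"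
    have car: "?g s \<in> carrier RU" if "s \<in> {0..1}" for s
      using compress_mats[OF mem(1)[OF that]] ij by (rule R.mats_entry)
    have le: "cnorm RU (?g s \<ominus>\<^bsub>RU\<^esub> ?g t) \<le> norm (\<delta> s - \<delta> t)" if s: "s \<in> {0..1}" for s
    proof -
      have "cnorm RU (?g s \<ominus>\<^bsub>RU\<^esub> ?g t) \<le> norm (to_op (?g s \<ominus>\<^bsub>RU\<^esub> ?g t))"
        by (rule ray_unitization_norm_le[OF R.hom_minus(1)[OF car[OF s] car[OF t]]])
      also have "to_op (?g s \<ominus>\<^bsub>RU\<^esub> ?g t) = unslice i * (\<delta> s - \<delta> t) * slice j"
        by (simp only: R.hom_minus(2)[OF car[OF s] car[OF t]] to_op_compress[OF mem(1)[OF s] ij] to_op_compress[OF mem(1)[OF t] ij]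
            left_diff_distrib right_diff_distrib)
      also have "norm \<dots> \<le> norm (unslice i) * norm (\<delta> s - \<delta> t) * norm (slice j)"
        by (intro order_trans[OF norm_mult_ineq] mult_right_mono norm_mult_ineq) simp
      also have "\<dots> \<le> 1 * norm (\<delta> s - \<delta> t) * 1"
        by (intro mult_mono norm_unslice_le norm_slice_le) auto
      finally show ?thesis by simp
    qed
    have lim: "(\<delta> \<longlongrightarrow> \<delta> t) (at t within {0..1})" using cont t by (simp add: continuous_on_def)
    have lim0: "((\<lambda>s. norm (\<delta> s - \<delta> t)) \<longlongrightarrow> 0) (at t within {0..1})"
      using tendsto_norm[OF tendsto_diff[OF lim tendsto_const[of "\<delta> t"]]] by simp
    show "((\<lambda>s. cnorm RU (?g s \<ominus>\<^bsub>RU\<^esub> ?g t)) \<longlongrightarrow> 0) (at t within {0..1})"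
    proof (rule tendsto_sandwich[OF _ _ tendsto_const lim0])
      show "\<forall>\<^sub>F s in at t within {0..1}. 0 \<le> cnorm RU (?g s \<ominus>\<^bsub>RU\<^esub> ?g t)"
        by (rule always_eventually) (simp add: cnorm_nonneg)
      show "\<forall>\<^sub>F s in at t within {0..1}. cnorm RU (?g s \<ominus>\<^bsub>RU\<^esub> ?g t) \<le> norm (\<delta> s - \<delta> t)"
        unfolding eventually_at_filter by (rule always_eventually) (use le in blast)
    qed
  qed
qed

text \<open>
  After identity blocks have been added two unitaries have the same size, and then they are homotopic. So
  all unitaries form a single class.
\<close>

theorem K1_trivial:
  assumes "P \<in> carrier (K1 ray_cstar)" "Q \<in> carrier (K1 ray_cstar)"
  shows "P = Q"
proof -
  have rel: "(u, v) \<in> K1_rel RU" if u: "u \<in> unitaries RU m" and v: "v \<in> unitaries RU n" for u v m n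
  proof -
    let ?k = "max m n"
    have "mat_dsum RU u (mat_one RU (?k - m)) \<in> unitaries RU ?k" "mat_dsum RU v (mat_one RU (?k - n)) \<in> unitaries RU ?k"
      using R.unitaries_dsum_one[OF u, of "?k - m"] R.unitaries_dsum_one[OF v, of "?k - n"] by simp_all
    from unitaries_homotopic[OF this] u v show ?thesis unfolding K1_rel_def by blast
  qed
  have cls: "P = (\<Union>n. unitaries RU n)" if "P \<in> carrier (K1 ray_cstar)" for P
  proof -
    from that have "P \<in> (\<Union>n. unitaries RU n) // K1_rel RU" by (simp add: K1_def Let_def)
    then obtain u where u: "u \<in> (\<Union>n. unitaries RU n)" "P = K1_rel RU `` {u}" by (rule quotientE)
    obtain m where m: "u \<in> unitaries RU m" using u(1) by blast
    show ?thesis unfolding u(2)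
    proof (rule antisym; rule subsetI)
      fix v assume "v \<in> K1_rel RU `` {u}"
      thus "v \<in> (\<Union>n. unitaries RU n)" by (auto simp: K1_rel_def)
    next
      fix v assume "v \<in> (\<Union>n. unitaries RU n)"
      then obtain n where "v \<in> unitaries RU n" by blast
      from rel[OF m this] show "v \<in> K1_rel RU `` {u}" by blast
    qed
  qed
  show ?thesis using cls[OF assms(1)] cls[OF assms(2)] by simp
qed

section \<open>The ray as a bi-directed graph\<close>

lemma wf_digraph_ray: "wf_digraph ray"
  by unfold_locales auto

lemma bidirected_ray: "bidirected_digraph ray ray_rev"
  by (rule wf_digraph.bidirected_digraphI[OF wf_digraph_ray]) (auto simp: ray_rev_def elim!: evenE oddE)

lemma locally_finite_ray: "locally_finite ray"
  unfolding locally_finite_def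
proof
  fix v
  have "in_arcs ray v \<union> out_arcs ray v \<subseteq> {..2 * v + 2}"
    by (auto simp: in_arcs_def out_arcs_def split: if_splits)
  thus "finite (in_arcs ray v \<union> out_arcs ray v)" by (rule finite_subset) simp
qed

lemma connected_ray: "Digraph_Component.connected ray"
proof -
  interpret wf_digraph ray by (rule wf_digraph_ray)
  have e: "(n, Suc n) \<in> arcs_ends ray" "(Suc n, n) \<in> arcs_ends ray" for n
    unfolding arcs_ends_def arc_to_ends_def
    by (rule image_eqI[of _ _ "2 * n"]; simp) (rule image_eqI[of _ _ "2 * n + 1"]; simp)
  have "0 \<rightarrow>\<^sup>*\<^bsub>ray\<^esub> n \<and> n \<rightarrow>\<^sup>*\<^bsub>ray\<^esub> 0" for n
  proof (induction n)
    case (Suc n)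
    thus ?case using e[of n] reachable_adjI reachable_trans by blast
  qed (simp add: reachable_refl)
  hence "u \<rightarrow>\<^sup>*\<^bsub>ray\<^esub> v" for u v using reachable_trans[of u 0 v] by blast
  hence "u \<rightarrow>\<^sup>*\<^bsub>mk_symmetric ray\<^esub> v" for u v by (rule reachable_mk_symmetricI)
  thus ?thesis by (simp add: Digraph_Component.connected_def strongly_connected_def)
qed

section \<open>The comparison of \<open>K\<^sub>0\<close> and \<open>K\<^sub>1\<close>\<close>

theorem corollary4p6:
  shows "\<exists>(E :: (nat, nat) pre_digraph) (arev :: nat \<Rightarrow> nat).
    bidirected_digraph E arev \<and>
    infinite (verts E) \<and> locally_finite E \<and> Digraph_Component.connected E \<and>
    \<not> (K1 (graph_cstar E arev) \<cong>
        (K0 (graph_cstar E arev) Mod torsion_subgroup (K0 (graph_cstar E arev))))"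
proof (intro exI conjI)
  show "bidirected_digraph ray ray_rev" by (rule bidirected_ray)
  show "infinite (verts ray)" by simp
  show "locally_finite ray" by (rule locally_finite_ray)
  show "Digraph_Component.connected ray" by (rule connected_ray)
  show "\<not> (K1 ray_cstar \<cong> (KG Mod torsion_subgroup KG))"
  proof
    assume "K1 ray_cstar \<cong> (KG Mod torsion_subgroup KG)"
    then obtain h where h: "bij_betw h (carrier (K1 ray_cstar)) (carrier (KG Mod torsion_subgroup KG))"
      by (auto simp: is_iso_def iso_def)
    obtain X Y where XY: "X \<in> carrier (KG Mod torsion_subgroup KG)" "Y \<in> carrier (KG Mod torsion_subgroup KG)" "X \<noteq> Y"
      using K0_mod_torsion_nontrivial by blast
    have im: "h ` carrier (K1 ray_cstar) = carrier (KG Mod torsion_subgroup KG)" using h by (rule bij_betw_imp_surj_on)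
    obtain P where P: "P \<in> carrier (K1 ray_cstar)" "X = h P" using XY(1) unfolding im[symmetric] by (rule imageE)
    obtain Q where Q: "Q \<in> carrier (K1 ray_cstar)" "Y = h Q" using XY(2) unfolding im[symmetric] by (rule imageE)
    show False using K1_trivial[OF P(1) Q(1)] P(2) Q(2) XY(3) by simp
  qed
qed

end
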